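(* Let $(V,M,\sigma)$ be a quantum multi-brace algebra over $K$, and let $\ast: T(V)\underline{\otimes}T(V)\to T(V)$ be the map $$\ast=\varepsilon\otimes\varepsilon+\sum_{r\ge1}M^{\otimes r}\circ\bigtriangleup_\beta^{(r-1)}.$$ Then $(T(V),\ast,\beta)$ is a braided algebra.
   Context: $K$ is a field of characteristic $0$. $T(V)=\bigoplus_{n\ge0}V^{\otimes n}$, $V^{\otimes0}=K$; $\underline{\otimes}$ denotes the tensor product between copies of $T(V)$, while $\otimes$ is the one inside $T(V)$. Braiding on $V$: an invertible $\sigma\in\mathrm{End}(V\otimes V)$ with $\sigma_1\sigma_2\sigma_1=\sigma_2\sigma_1\sigma_2$ on $V^{\otimes3}$ ($\sigma_i$ is $\sigma$ acting on factors $i,i+1$); $(V,\sigma)$ is a braided vector space. For $w\in\mathfrak{S}_n$ with reduced expression $s_{i_1}\cdots s_{i_l}$, $T^\sigma_w=\sigma_{i_1}\cdots\sigma_{i_l}$. Let $\chi_{ij}\in\mathfrak{S}_{i+j}$, $\chi_{ij}(k)=j+k$ ($1\le k\le i$), $\chi_{ij}(i+k)=k$ ($1\le k\le j$). The braiding $\beta$ on $T(V)$ is $\beta_{ij}=T^\sigma_{\chi_{ij}}$ on $V^{\otimes i}\underline{\otimes}V^{\otimes j}$, with $\beta_{0i},\beta_{i0}$ the flips. $T^c(V)$ is $T(V)$ with deconcatenation $\delta(v_1\otimes\cdots\otimes v_n)=\sum_{i=0}^n(v_1\otimes\cdots\otimes v_i)\underline{\otimes}(v_{i+1}\otimes\cdots\otimes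 v_n)$; its counit $\varepsilon$ is the projection onto $K$. $\bigtriangleup_\beta=(\mathrm{id}\otimes\beta\otimes\mathrm{id})\circ(\delta\otimes\delta)$ is a coassociative coproduct on $T^c(V)\underline{\otimes}T^c(V)$; $\bigtriangleup_\beta^{(0)}=\mathrm{id}$, $\bigtriangleup_\beta^{(1)}=\bigtriangleup_\beta$ and $\bigtriangleup_\beta^{(n)}=(\bigtriangleup_\beta^{(n-1)}\otimes\mathrm{id})\bigtriangleup_\beta$. Quantum multi-brace algebra $(V,M,\sigma)$: a braided vector space with linear maps $M_{pq}:V^{\otimes p}\otimes V^{\otimes q}\to V$, $p,q\ge0$, $M=\bigoplus M_{pq}:T(V)\underline{\otimes}T(V)\to V$, such that: (1) $M_{00}=0$, $M_{10}=\mathrm{id}_V=M_{01}$, $M_{n0}=0=M_{0n}$ for $n\ge2$; (2) for all $i,j,k\ge1$, $\beta_{1k}(M_{ij}\otimes\mathrm{id}_V^{\otimes k})=(\mathrm{id}_V^{\otimes k}\otimes M_{ij})\beta_{i+j,k}$ and $\beta_{i1}(\mathrm{id}_V^{\otimes i}\otimes M_{jk})=(M_{jk}\otimes\mathrm{id}_V^{\otimes i})\beta_{i,j+k}$; (3) for all $i,j,k\ge1$, on $V^{\otimes i}\underline{\otimes}V^{\otimes j}\underline{\otimes}V^{\otimes k}$, $\sum_{r=1}^{i+j}M_{rk}\circ\big((M^{\otimes r}\circ\bigtriangleup_\beta^{(r-1)})\otimes\mathrm{id}_V^{\otimes k}\big)=\sum_{l=1}^{j+k}M_{il}\circ\big(\mathrm{id}_V^{\otimes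 i}\otimes(M^{\otimes l}\circ\bigtriangleup_\beta^{(l-1)})\big)$. Here $M^{\otimes r}\circ\bigtriangleup_\beta^{(r-1)}$ takes values in $V^{\otimes r}\subset T(V)$. A braided algebra $(A,m,\sigma)$ is an associative unital algebra with a braiding such that $\sigma(m\otimes\mathrm{id})=(\mathrm{id}\otimes m)\sigma_1\sigma_2$, $\sigma(\mathrm{id}\otimes m)=(m\otimes\mathrm{id})\sigma_2\sigma_1$, $\sigma(1\otimes a)=a\otimes1$, $\sigma(a\otimes1)=1\otimes a$. The unit of $T(V)$ is $1\in K$. *)

theory Defs
  imports
    Complex_Main
    "HOL-Library.Function_Algebras"
    "HOL-Library.Groups_Big_Fun"
    "HOL-Combinatorics.Transposition"
begin

section \<open>Tensor powers of a vector space\<close>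

text \<open>
  A vector space over the field \<open>'k\<close> is given by a scalar multiplication \<open>s\<close> with
  \<open>vector_space s\<close> and a subspace \<open>C\<close> of its type; \<open>C = UNIV\<close> for the space \<open>V\<close> itself.
  The carrier is needed because the construction below is applied to \<open>T(V)\<close> again, to form
  \<open>T(V) \<otimes> \<dots> \<otimes> T(V)\<close>.
\<close>

text \<open>Multilinear on words of every length over \<open>C\<close> (the empty word is unconstrained).\<close>

definition multilinear ::
  "('k \<Rightarrow> 'a \<Rightarrow> 'a) \<Rightarrow> 'a set \<Rightarrow> ('k \<Rightarrow> 'w \<Rightarrow> 'w) \<Rightarrow> ('a::plus list \<Rightarrow> 'w::plus) \<Rightarrow> bool" where
  "multilinear s C w g \<longleftrightarrow>
    (\<forall>xs\<in>lists C. \<forall>ys\<in>lists C. \<forall>a\<in>C.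
      (\<forall>b\<in>C. g (xs @ (a + b) # ys) = g (xs @ a # ys) + g (xs @ b # ys)) \<and>
      (\<forall>c. g (xs @ s c a # ys) = w c (g (xs @ a # ys))))"

text \<open>
  Pure tensors are realised inside the dual of the multilinear forms: \<open>a\<^sub>1 \<otimes> \<dots> \<otimes> a\<^sub>n\<close> is the
  evaluation functional \<open>f \<mapsto> f [a\<^sub>1, \<dots>, a\<^sub>n]\<close>. A multilinear form is an independent choice of
  an \<open>n\<close>-linear form for each \<open>n\<close>, so different tensor degrees are linearly independent, and
  the span of all pure tensors is the direct sum of the tensor powers. The universal property
  is lemma \<open>lift\<close> below.
\<close>

type_synonym ('a, 'k) tensor = "('a list \<Rightarrow> 'k) \<Rightarrow> 'k"

definition fscale :: "'k::times \<Rightarrow> ('b \<Rightarrow> 'k) \<Rightarrow> ('b \<Rightarrow> 'k)" where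
  "fscale c F = (\<lambda>f. c * F f)"

definition ptensor ::
  "('k::field \<Rightarrow> 'a \<Rightarrow> 'a) \<Rightarrow> 'a set \<Rightarrow> 'a::ab_group_add list \<Rightarrow> ('a, 'k) tensor" where
  "ptensor s C xs = (\<lambda>f. if multilinear s C (*) f then f xs else 0)"

definition tensor_power ::
  "('k::field \<Rightarrow> 'a \<Rightarrow> 'a) \<Rightarrow> 'a set \<Rightarrow> nat \<Rightarrow> ('a::ab_group_add, 'k) tensor set" where
  "tensor_power s C n = module.span fscale (ptensor s C ` {xs \<in> lists C. length xs = n})"

definition tensor_algebra ::
  "('k::field \<Rightarrow> 'a \<Rightarrow> 'a) \<Rightarrow> 'a set \<Rightarrow> ('a::ab_group_add, 'k) tensor set" where
  "tensor_algebra s C = module.span fscale (ptensor s C ` lists C)"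

text \<open>
  \<open>lift s C w g\<close> is the linear map sending \<open>a\<^sub>1 \<otimes> \<dots> \<otimes> a\<^sub>n\<close> to \<open>g [a\<^sub>1, \<dots>, a\<^sub>n]\<close>, for
  multilinear \<open>g\<close>. Only its values on \<open>tensor_algebra s C\<close> are determined, and only these
  are ever used.
\<close>

definition lift ::
  "('k::field \<Rightarrow> 'a \<Rightarrow> 'a) \<Rightarrow> 'a set \<Rightarrow> ('k \<Rightarrow> 'w \<Rightarrow> 'w) \<Rightarrow> ('a::ab_group_add list \<Rightarrow> 'w::ab_group_add)
    \<Rightarrow> ('a, 'k) tensor \<Rightarrow> 'w" where
  "lift s C w g =
    (SOME h. Vector_Spaces.linear fscale w h \<and> (\<forall>xs\<in>lists C. h (ptensor s C xs) = g xs))"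

lemma vector_space_fscale: "vector_space (fscale :: 'k::field \<Rightarrow> ('b \<Rightarrow> 'k) \<Rightarrow> _)"
  by unfold_locales (auto simp: fscale_def fun_eq_iff algebra_simps)

lemma vector_space_times: "vector_space ((*) :: 'k::field \<Rightarrow> 'k \<Rightarrow> 'k)"
  by unfold_locales (auto simp: algebra_simps)

lemma lift:
  fixes s :: "'k::field \<Rightarrow> 'a::ab_group_add \<Rightarrow> 'a" and w :: "'k \<Rightarrow> 'w::ab_group_add \<Rightarrow> 'w"
  assumes w: "vector_space w" and g: "multilinear s C w g"
  shows "Vector_Spaces.linear fscale w (lift s C w g)"
    and "xs \<in> lists C \<Longrightarrow> lift s C w g (ptensor s C xs) = g xs"
proof -
  interpret W: vector_space w by (fact w)
  interpret F: vector_space "fscale :: 'k \<Rightarrow> (('a list \<Rightarrow> 'k) \<Rightarrow> 'k) \<Rightarrow> _"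
    by (rule vector_space_fscale)
  interpret FW: vector_space_pair "fscale :: 'k \<Rightarrow> (('a list \<Rightarrow> 'k) \<Rightarrow> 'k) \<Rightarrow> _" w ..
  interpret K: vector_space "(*) :: 'k \<Rightarrow> 'k \<Rightarrow> 'k" by (rule vector_space_times)
  interpret WK: vector_space_pair w "(*) :: 'k \<Rightarrow> 'k \<Rightarrow> 'k" ..
  let ?P = "ptensor s C ` lists C"
  obtain B where B: "B \<subseteq> ?P" "F.independent B" "?P \<subseteq> F.span B"
    using F.maximal_independent_subset by blast
  define wd where "wd b = (SOME xs. xs \<in> lists C \<and> ptensor s C xs = b)" for b
  have wd: "wd b \<in> lists C" "ptensor s C (wd b) = b" if "b \<in> B" for b
  proof -
    have "\<exists>xs. xs \<in> lists C \<and> ptensor s C xs = b" using B(1) that by auto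
    from someI_ex[OF this] show "wd b \<in> lists C" "ptensor s C (wd b) = b"
      unfolding wd_def by blast+
  qed
  obtain h where h: "Vector_Spaces.linear fscale w h" and hB: "\<And>b. b \<in> B \<Longrightarrow> h b = g (wd b)"
    using FW.linear_independent_extend[OF B(2), of "\<lambda>b. g (wd b)"] by blast
  interpret h: Vector_Spaces.linear fscale w h by (fact h)
  have eq: "h (ptensor s C xs) = g xs" if xs: "xs \<in> lists C" for xs
  proof (rule ccontr)
    define d where "d = h (ptensor s C xs) - g xs"
    assume "h (ptensor s C xs) \<noteq> g xs"
    then have "d \<noteq> 0" by (simp add: d_def)
    then have "W.independent {d}" by simp
    from WK.linear_independent_extend[OF this, of "\<lambda>_. 1"] obtain p
      where p: "Vector_Spaces.linear w (*) p" and pd: "p d = 1" by auto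
    interpret p: Vector_Spaces.linear w "(*)" p by (fact p)
    have ml: "multilinear s C (*) (\<lambda>xs. p (g xs))"
      using g by (simp add: multilinear_def p.add p.scale)
    have "ptensor s C xs \<in> F.span B" using B(3) xs by auto
    then obtain t r where t: "finite t" "t \<subseteq> B"
      and e: "ptensor s C xs = (\<Sum>a\<in>t. fscale (r a) a)"
      unfolding F.span_explicit by (elim CollectE exE conjE) (rule that)
    have appl: "(\<Sum>a\<in>t. G a) f = (\<Sum>a\<in>t. G a f)"
      for G :: "(('a list \<Rightarrow> 'k) \<Rightarrow> 'k) \<Rightarrow> ('a list \<Rightarrow> 'k) \<Rightarrow> 'k" and f
      by (induction t rule: infinite_finite_induct) auto
    have "p (g xs) = ptensor s C xs (\<lambda>xs. p (g xs))" by (simp add: ptensor_def ml)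
    also have "\<dots> = (\<Sum>a\<in>t. r a * a (\<lambda>xs. p (g xs)))" by (simp add: e appl fscale_def)
    also have "\<dots> = (\<Sum>a\<in>t. r a * p (g (wd a)))"
    proof (rule sum.cong[OF refl])
      fix a assume "a \<in> t"
      then have "ptensor s C (wd a) = a" using t wd by auto
      then have "a (\<lambda>xs. p (g xs)) = ptensor s C (wd a) (\<lambda>xs. p (g xs))" by simp
      then show "r a * a (\<lambda>xs. p (g xs)) = r a * p (g (wd a))"
        by (simp add: ptensor_def ml)
    qed
    also have "\<dots> = (\<Sum>a\<in>t. r a * p (h a))" using t hB by (intro sum.cong) auto
    also have "\<dots> = p (h (ptensor s C xs))" by (simp add: e h.sum h.scale p.sum p.scale)
    finally have "p d = 0" by (simp add: d_def p.diff)
    with pd show False by simp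
  qed
  have "\<exists>h. Vector_Spaces.linear fscale w h \<and> (\<forall>xs\<in>lists C. h (ptensor s C xs) = g xs)"
    using h eq by blast
  then have *: "Vector_Spaces.linear fscale w (lift s C w g) \<and>
      (\<forall>xs\<in>lists C. lift s C w g (ptensor s C xs) = g xs)"
    unfolding lift_def by (rule someI_ex)
  show "Vector_Spaces.linear fscale w (lift s C w g)" using * by blast
  show "xs \<in> lists C \<Longrightarrow> lift s C w g (ptensor s C xs) = g xs" using * by blast
qed

text \<open>The bilinear map sending \<open>(a\<^sub>1 \<otimes> \<dots> \<otimes> a\<^sub>m, b\<^sub>1 \<otimes> \<dots> \<otimes> b\<^sub>n)\<close> to \<open>g [a\<^sub>1, \<dots>, a\<^sub>m] [b\<^sub>1, \<dots>, b\<^sub>n]\<close>.\<close>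

definition bilift ::
  "('k::field \<Rightarrow> 'a \<Rightarrow> 'a) \<Rightarrow> 'a set \<Rightarrow> ('k \<Rightarrow> 'w \<Rightarrow> 'w)
    \<Rightarrow> ('a::ab_group_add list \<Rightarrow> 'a list \<Rightarrow> 'w::ab_group_add)
    \<Rightarrow> ('a, 'k) tensor \<Rightarrow> ('a, 'k) tensor \<Rightarrow> 'w" where
  "bilift s C w g t u = lift s C w (\<lambda>xs. lift s C w (\<lambda>ys. g xs ys) u) t"

definition cat ::
  "('k::field \<Rightarrow> 'a \<Rightarrow> 'a) \<Rightarrow> 'a set
    \<Rightarrow> ('a::ab_group_add, 'k) tensor \<Rightarrow> ('a, 'k) tensor \<Rightarrow> ('a, 'k) tensor" where
  "cat s C = bilift s C fscale (\<lambda>xs ys. ptensor s C (xs @ ys))"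

text \<open>
  \<open>f \<otimes> g : C\<^bsup>\<otimes>(p+q)\<^esup> \<rightarrow> T(C)\<close> for \<open>f\<close> defined on \<open>C\<^bsup>\<otimes>p\<^esup>\<close> and \<open>g\<close> on \<open>C\<^bsup>\<otimes>q\<^esup>\<close>. Here
  \<open>C\<^bsup>\<otimes>p\<^esup> \<otimes> C\<^bsup>\<otimes>q\<^esup>\<close> is identified with \<open>C\<^bsup>\<otimes>(p+q)\<^esup>\<close>. Outside degree \<open>p + q\<close> the map is zero.
\<close>

definition tmap ::
  "('k::field \<Rightarrow> 'a \<Rightarrow> 'a) \<Rightarrow> 'a set \<Rightarrow> nat \<Rightarrow> nat
    \<Rightarrow> (('a::ab_group_add, 'k) tensor \<Rightarrow> ('a, 'k) tensor)
    \<Rightarrow> (('a, 'k) tensor \<Rightarrow> ('a, 'k) tensor) \<Rightarrow> ('a, 'k) tensor \<Rightarrow> ('a, 'k) tensor" where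
  "tmap s C p q f g = lift s C fscale (\<lambda>xs.
     if length xs = p + q
     then cat s C (f (ptensor s C (take p xs))) (g (ptensor s C (drop p xs))) else 0)"

definition linear_on ::
  "('k \<Rightarrow> 'a \<Rightarrow> 'a) \<Rightarrow> 'a::plus set \<Rightarrow> ('k \<Rightarrow> 'b \<Rightarrow> 'b) \<Rightarrow> 'b::plus set \<Rightarrow> ('a \<Rightarrow> 'b) \<Rightarrow> bool" where
  "linear_on s A w B f \<longleftrightarrow> (\<forall>x\<in>A. f x \<in> B) \<and>
    (\<forall>x\<in>A. \<forall>y\<in>A. f (x + y) = f x + f y) \<and> (\<forall>c. \<forall>x\<in>A. f (s c x) = w c (f x))"


section \<open>Braidings and braided algebras\<close>

definition braiding ::
  "('k::field \<Rightarrow> 'a \<Rightarrow> 'a) \<Rightarrow> 'a set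
    \<Rightarrow> (('a::ab_group_add, 'k) tensor \<Rightarrow> ('a, 'k) tensor) \<Rightarrow> bool" where
  "braiding s A \<sigma> \<longleftrightarrow>
    (let \<sigma>1 = tmap s A 2 1 \<sigma> id; \<sigma>2 = tmap s A 1 2 id \<sigma> in
      linear_on fscale (tensor_power s A 2) fscale (tensor_power s A 2) \<sigma> \<and>
      bij_betw \<sigma> (tensor_power s A 2) (tensor_power s A 2) \<and>
      (\<forall>t\<in>tensor_power s A 3. \<sigma>1 (\<sigma>2 (\<sigma>1 t)) = \<sigma>2 (\<sigma>1 (\<sigma>2 t))))"

text \<open>
  Maps with values in \<open>A\<close> are composed with \<open>a \<mapsto> ptensor s A [a]\<close>, the identification of \<open>A\<close>
  with \<open>A\<^bsup>\<otimes>1\<^esup>\<close>, before they are tensored with other maps.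
\<close>

definition braided_algebra ::
  "('k::field \<Rightarrow> 'a \<Rightarrow> 'a) \<Rightarrow> 'a set \<Rightarrow> (('a::ab_group_add, 'k) tensor \<Rightarrow> 'a) \<Rightarrow> 'a
    \<Rightarrow> (('a, 'k) tensor \<Rightarrow> ('a, 'k) tensor) \<Rightarrow> bool" where
  "braided_algebra s A m u \<sigma> \<longleftrightarrow>
    (let P = ptensor s A; m' = (\<lambda>t. P [m t]);
         \<sigma>1 = tmap s A 2 1 \<sigma> id; \<sigma>2 = tmap s A 1 2 id \<sigma> in
      vector_space s \<and> module.subspace s A \<and>
      linear_on fscale (tensor_power s A 2) s A m \<and> u \<in> A \<and>
      (\<forall>a\<in>A. \<forall>b\<in>A. \<forall>c\<in>A. m (P [m (P [a, b]), c]) = m (P [a, m (P [b, c])])) \<and>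
      (\<forall>a\<in>A. m (P [u, a]) = a \<and> m (P [a, u]) = a) \<and>
      braiding s A \<sigma> \<and>
      (\<forall>t\<in>tensor_power s A 3. \<sigma> (tmap s A 2 1 m' id t) = tmap s A 1 2 id m' (\<sigma>1 (\<sigma>2 t))) \<and>
      (\<forall>t\<in>tensor_power s A 3. \<sigma> (tmap s A 1 2 id m' t) = tmap s A 2 1 m' id (\<sigma>2 (\<sigma>1 t))) \<and>
      (\<forall>a\<in>A. \<sigma> (P [u, a]) = P [a, u] \<and> \<sigma> (P [a, u]) = P [u, a]))"


section \<open>The operators \<open>T\<^sup>\<sigma>\<^sub>w\<close>\<close>

definition word_perm :: "nat list \<Rightarrow> nat \<Rightarrow> nat" where
  "word_perm js = foldr (\<lambda>j w. transpose j (Suc j) \<circ> w) js id"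

definition reduced_word :: "nat \<Rightarrow> (nat \<Rightarrow> nat) \<Rightarrow> nat list \<Rightarrow> bool" where
  "reduced_word n w js \<longleftrightarrow> set js \<subseteq> {1..<n} \<and> word_perm js = w \<and>
    (\<forall>ks. set ks \<subseteq> {1..<n} \<and> word_perm ks = w \<longrightarrow> length js \<le> length ks)"

definition chi :: "nat \<Rightarrow> nat \<Rightarrow> nat \<Rightarrow> nat" where
  "chi i j k = (if 1 \<le> k \<and> k \<le> i then j + k else if i < k \<and> k \<le> i + j then k - i else k)"

text \<open>\<open>\<sigma>\<^sub>j\<close> on \<open>V\<^bsup>\<otimes>n\<^esup>\<close>, for \<open>1 \<le> j < n\<close>.\<close>

definition sigma_at ::
  "('k::field \<Rightarrow> 'v \<Rightarrow> 'v) \<Rightarrow> (('v::ab_group_add, 'k) tensor \<Rightarrow> ('v, 'k) tensor) \<Rightarrow> nat \<Rightarrow> nat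
    \<Rightarrow> ('v, 'k) tensor \<Rightarrow> ('v, 'k) tensor" where
  "sigma_at s \<sigma> n j = tmap s UNIV (j + 1) (n - j - 1) (tmap s UNIV (j - 1) 2 id \<sigma>) id"

text \<open>The result does not depend on the reduced word, since \<open>\<sigma>\<close> satisfies the braid relation.\<close>

definition T_perm ::
  "('k::field \<Rightarrow> 'v \<Rightarrow> 'v) \<Rightarrow> (('v::ab_group_add, 'k) tensor \<Rightarrow> ('v, 'k) tensor)
    \<Rightarrow> nat \<Rightarrow> (nat \<Rightarrow> nat) \<Rightarrow> ('v, 'k) tensor \<Rightarrow> ('v, 'k) tensor" where
  "T_perm s \<sigma> n w =
    foldr (\<lambda>j f. sigma_at s \<sigma> n j \<circ> f) (SOME js. reduced_word n w js) id"


section \<open>The braiding and the coproducts on \<open>T(V)\<close>\<close>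

text \<open>\<open>T(V)\<close>, and pure tensors \<open>t\<^sub>1 \<otimes> \<dots> \<otimes> t\<^sub>n\<close> of elements of \<open>T(V)\<close> (the underlined tensor product).\<close>

abbreviation TV :: "('k::field \<Rightarrow> 'v \<Rightarrow> 'v) \<Rightarrow> ('v::ab_group_add, 'k) tensor set" where
  "TV s \<equiv> tensor_algebra s UNIV"

abbreviation tensorT ::
  "('k::field \<Rightarrow> 'v \<Rightarrow> 'v) \<Rightarrow> ('v::ab_group_add, 'k) tensor list \<Rightarrow> (('v, 'k) tensor, 'k) tensor" where
  "tensorT s ts \<equiv> ptensor fscale (TV s) ts"

abbreviation liftTT ::
  "('k::field \<Rightarrow> 'v \<Rightarrow> 'v) \<Rightarrow> ('k \<Rightarrow> 'w \<Rightarrow> 'w)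
    \<Rightarrow> (('v::ab_group_add, 'k) tensor \<Rightarrow> ('v, 'k) tensor \<Rightarrow> 'w::ab_group_add)
    \<Rightarrow> (('v, 'k) tensor, 'k) tensor \<Rightarrow> 'w" where
  "liftTT s w g \<equiv> lift fscale (TV s) w (\<lambda>ts. if length ts = 2 then g (ts ! 0) (ts ! 1) else 0)"

abbreviation unitT :: "('k::field \<Rightarrow> 'v \<Rightarrow> 'v) \<Rightarrow> ('v::ab_group_add, 'k) tensor" where
  "unitT s \<equiv> ptensor s UNIV []"

text \<open>\<open>\<beta>\<^sub>i\<^sub>j\<close> as an endomorphism of \<open>V\<^bsup>\<otimes>(i+j)\<^esup>\<close>.\<close>

definition beta_comp ::
  "('k::field \<Rightarrow> 'v \<Rightarrow> 'v) \<Rightarrow> (('v::ab_group_add, 'k) tensor \<Rightarrow> ('v, 'k) tensor)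
    \<Rightarrow> nat \<Rightarrow> nat \<Rightarrow> ('v, 'k) tensor \<Rightarrow> ('v, 'k) tensor" where
  "beta_comp s \<sigma> i j = T_perm s \<sigma> (i + j) (chi i j)"

text \<open>The identification of \<open>V\<^bsup>\<otimes>(i+j)\<^esup>\<close> with the summand \<open>V\<^bsup>\<otimes>i\<^esup> \<otimes> V\<^bsup>\<otimes>j\<^esup>\<close> of \<open>T(V) \<otimes> T(V)\<close>.\<close>

definition split_at ::
  "('k::field \<Rightarrow> 'v \<Rightarrow> 'v) \<Rightarrow> nat \<Rightarrow> nat
    \<Rightarrow> ('v::ab_group_add, 'k) tensor \<Rightarrow> (('v, 'k) tensor, 'k) tensor" where
  "split_at s i j = lift s UNIV fscale (\<lambda>zs. if length zs = i + j
     then tensorT s [ptensor s UNIV (take i zs), ptensor s UNIV (drop i zs)] else 0)"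

text \<open>
  The components with \<open>i = 0\<close> or \<open>j = 0\<close> need no separate clause: then \<open>chi i j = id\<close>, whose only
  reduced word is empty, and the formula below gives the flip.
\<close>

definition beta ::
  "('k::field \<Rightarrow> 'v \<Rightarrow> 'v) \<Rightarrow> (('v::ab_group_add, 'k) tensor \<Rightarrow> ('v, 'k) tensor)
    \<Rightarrow> (('v, 'k) tensor, 'k) tensor \<Rightarrow> (('v, 'k) tensor, 'k) tensor" where
  "beta s \<sigma> = liftTT s fscale (bilift s UNIV fscale (\<lambda>xs ys.
     split_at s (length ys) (length xs)
       (beta_comp s \<sigma> (length xs) (length ys) (ptensor s UNIV (xs @ ys)))))"

definition deconc ::
  "('k::field \<Rightarrow> 'v \<Rightarrow> 'v) \<Rightarrow> ('v::ab_group_add, 'k) tensor \<Rightarrow> (('v, 'k) tensor, 'k) tensor" where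
  "deconc s = lift s UNIV fscale (\<lambda>xs.
     \<Sum>i\<le>length xs. tensorT s [ptensor s UNIV (take i xs), ptensor s UNIV (drop i xs)])"

definition counit :: "('k::field \<Rightarrow> 'v \<Rightarrow> 'v) \<Rightarrow> ('v::ab_group_add, 'k) tensor \<Rightarrow> 'k" where
  "counit s = lift s UNIV (*) (\<lambda>xs. if xs = [] then 1 else 0)"

text \<open>
  \<open>(T(V) \<otimes> T(V))\<^bsup>\<otimes>n\<^esup>\<close> is identified with \<open>T(V)\<^bsup>\<otimes>2n\<^esup>\<close>. Thus \<open>\<delta> \<otimes> \<delta>\<close> and \<open>coprod\<close> have values
  in \<open>T(V)\<^bsup>\<otimes>4\<^esup>\<close>, and \<open>coprod_iter s \<sigma> n\<close> has values in \<open>T(V)\<^bsup>\<otimes>2(n+1)\<^esup>\<close>.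
\<close>

definition coprod ::
  "('k::field \<Rightarrow> 'v \<Rightarrow> 'v) \<Rightarrow> (('v::ab_group_add, 'k) tensor \<Rightarrow> ('v, 'k) tensor)
    \<Rightarrow> (('v, 'k) tensor, 'k) tensor \<Rightarrow> (('v, 'k) tensor, 'k) tensor" where
  "coprod s \<sigma> =
     tmap fscale (TV s) 3 1 (tmap fscale (TV s) 1 2 id (beta s \<sigma>)) id
     \<circ> liftTT s fscale (\<lambda>x y. cat fscale (TV s) (deconc s x) (deconc s y))"

primrec coprod_iter ::
  "('k::field \<Rightarrow> 'v \<Rightarrow> 'v) \<Rightarrow> (('v::ab_group_add, 'k) tensor \<Rightarrow> ('v, 'k) tensor) \<Rightarrow> nat
    \<Rightarrow> (('v, 'k) tensor, 'k) tensor \<Rightarrow> (('v, 'k) tensor, 'k) tensor" where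
  "coprod_iter s \<sigma> 0 = id"
| "coprod_iter s \<sigma> (Suc n) = tmap fscale (TV s) 2 2 (coprod_iter s \<sigma> n) id \<circ> coprod s \<sigma>"


section \<open>Quantum multi-brace algebras\<close>

text \<open>
  The maps \<open>M\<^sub>p\<^sub>q : V\<^bsup>\<otimes>p\<^esup> \<otimes> V\<^bsup>\<otimes>q\<^esup> \<rightarrow> V\<close> are given as a family \<open>M p q\<close> of linear maps on
  \<open>V\<^bsup>\<otimes>(p+q)\<^esup>\<close>; \<open>brace_total s M\<close> is their sum \<open>M : T(V) \<otimes> T(V) \<rightarrow> V\<close>.
\<close>

definition brace_total ::
  "('k::field \<Rightarrow> 'v \<Rightarrow> 'v) \<Rightarrow> (nat \<Rightarrow> nat \<Rightarrow> ('v::ab_group_add, 'k) tensor \<Rightarrow> 'v)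
    \<Rightarrow> (('v, 'k) tensor, 'k) tensor \<Rightarrow> 'v" where
  "brace_total s M = liftTT s s (bilift s UNIV s (\<lambda>xs ys.
     M (length xs) (length ys) (ptensor s UNIV (xs @ ys))))"

text \<open>\<open>M\<^bsup>\<otimes>r\<^esup> : (T(V) \<otimes> T(V))\<^bsup>\<otimes>r\<^esup> \<rightarrow> V\<^bsup>\<otimes>r\<^esup>\<close>, on \<open>T(V)\<^bsup>\<otimes>2r\<^esup>\<close>.\<close>

definition brace_power ::
  "('k::field \<Rightarrow> 'v \<Rightarrow> 'v) \<Rightarrow> (nat \<Rightarrow> nat \<Rightarrow> ('v::ab_group_add, 'k) tensor \<Rightarrow> 'v) \<Rightarrow> nat
    \<Rightarrow> (('v, 'k) tensor, 'k) tensor \<Rightarrow> ('v, 'k) tensor" where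
  "brace_power s M r = lift fscale (TV s) fscale (\<lambda>ts. if length ts = 2 * r
     then ptensor s UNIV
       (map (\<lambda>k. brace_total s M (tensorT s [ts ! (2 * k), ts ! (2 * k + 1)])) [0..<r])
     else 0)"

definition quantum_multibrace ::
  "('k::field \<Rightarrow> 'v \<Rightarrow> 'v) \<Rightarrow> (nat \<Rightarrow> nat \<Rightarrow> ('v::ab_group_add, 'k) tensor \<Rightarrow> 'v)
    \<Rightarrow> (('v, 'k) tensor \<Rightarrow> ('v, 'k) tensor) \<Rightarrow> bool" where
  "quantum_multibrace s M \<sigma> \<longleftrightarrow>
    (let P = ptensor s UNIV; V = tensor_power s UNIV; \<beta> = beta_comp s \<sigma>;
         M' = (\<lambda>p q t. P [M p q t]);
         N = (\<lambda>r x y. brace_power s M r (coprod_iter s \<sigma> (r - 1) (tensorT s [x, y]))) in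
      vector_space s \<and> braiding s UNIV \<sigma> \<and>
      (\<forall>p q. linear_on fscale (V (p + q)) s UNIV (M p q)) \<and>
      (\<forall>t\<in>V 0. M 0 0 t = 0) \<and>
      (\<forall>v. M 1 0 (P [v]) = v \<and> M 0 1 (P [v]) = v) \<and>
      (\<forall>n\<ge>2. \<forall>t\<in>V n. M n 0 t = 0 \<and> M 0 n t = 0) \<and>
      (\<forall>i\<ge>1. \<forall>j\<ge>1. \<forall>k\<ge>1. \<forall>t\<in>V (i + j + k).
         \<beta> 1 k (tmap s UNIV (i + j) k (M' i j) id t)
           = tmap s UNIV k (i + j) id (M' i j) (\<beta> (i + j) k t)) \<and>
      (\<forall>i\<ge>1. \<forall>j\<ge>1. \<forall>k\<ge>1. \<forall>t\<in>V (i + j + k).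
         \<beta> i 1 (tmap s UNIV i (j + k) id (M' j k) t)
           = tmap s UNIV (j + k) i (M' j k) id (\<beta> i (j + k) t)) \<and>
      (\<forall>i\<ge>1. \<forall>j\<ge>1. \<forall>k\<ge>1. \<forall>x\<in>V i. \<forall>y\<in>V j. \<forall>z\<in>V k.
         (\<Sum>r = 1..i + j. M r k (cat s UNIV (N r x y) z))
           = (\<Sum>l = 1..j + k. M i l (cat s UNIV x (N l y z)))))"

text \<open>
  \<open>\<ast> = \<epsilon> \<otimes> \<epsilon> + \<Sum>r\<ge>1. M\<^bsup>\<otimes>r\<^esup> \<circ> \<Delta>\<^bsup>(r-1)\<^esup>\<close>, with \<open>r\<close> shifted by one. On each element only finitely many
  terms are nonzero because \<open>M\<^sub>0\<^sub>0 = 0\<close>; \<open>Sum_any\<close> is the sum of a finitely supported family.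
\<close>

definition star ::
  "('k::field \<Rightarrow> 'v \<Rightarrow> 'v) \<Rightarrow> (nat \<Rightarrow> nat \<Rightarrow> ('v::ab_group_add, 'k) tensor \<Rightarrow> 'v)
    \<Rightarrow> (('v, 'k) tensor \<Rightarrow> ('v, 'k) tensor)
    \<Rightarrow> (('v, 'k) tensor, 'k) tensor \<Rightarrow> ('v, 'k) tensor" where
  "star s M \<sigma> t =
     liftTT s fscale (\<lambda>x y. fscale (counit s x * counit s y) (unitT s)) t
     + Sum_any (\<lambda>r. brace_power s M (Suc r) (coprod_iter s \<sigma> r t))"

end

theory Submission
  imports Defs "HOL-Combinatorics.Permutations"
begin

text \<open>
  Operators on \<open>T(V)\<close> form a ring under composition in which \<open>L a f = id\<^sub>a \<otimes> f\<close> and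
  \<open>R b f = f \<otimes> id\<^sub>b\<close> are the two whiskerings. In this calculus the component
  \<open>V\<^bsup>\<otimes>i\<^esup> \<otimes> V\<^bsup>\<otimes>j\<^esup> \<rightarrow> V\<^bsup>\<otimes>r\<^esup>\<close> of \<open>\<ast>\<close> is \<open>st r i j\<close>, with
  \<open>st (r + 1) i j = \<Sum> (st r i\<^sub>1 j\<^sub>1 \<otimes> M\<^sub>i\<^sub>2\<^sub>j\<^sub>2) (id \<otimes> \<beta>\<^sub>i\<^sub>2\<^sub>j\<^sub>1 \<otimes> id)\<close>. Since \<open>\<sigma>\<close> is natural with
  respect to \<open>\<beta>\<close> (this is the braid relation) and so are the \<open>M\<^sub>p\<^sub>q\<close>, every \<open>st r i j\<close> is natural, which gives
  the compatibility of \<open>\<ast>\<close> with \<open>\<beta>\<close>. Moreover \<open>st (r\<^sub>1 + r\<^sub>2)\<close> splits like \<open>st (r + 1)\<close>, that is, \<open>\<ast>\<close> is a map of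
  coalgebras; associativity in the component with values in \<open>V\<^bsup>\<otimes>n\<^esup>\<close> then follows by induction on
  \<open>n\<close>, condition (3) being the case \<open>n = 1\<close>. Matsumoto's theorem identifies \<open>T\<^sup>\<sigma>\<close> of \<open>\<chi>\<^sub>i\<^sub>j\<close> with the
  braiding built recursively from \<open>\<sigma>\<close>.
\<close>

section \<open>Sums over decompositions\<close>

text \<open>Iterated tensor products of \<open>T(V)\<close> with itself would turn every identity
  into a statement about nested tensors. The summand of bidegree (i, j) is a copy of the tensor
  power of degree i + j, so all maps are treated as operators on one space. The block structure
  survives in the indices only, and \<open>split_at\<close> and \<open>split3\<close> translate
  back. Identifying the powers in this way makes the monoidal structure strict, at the price of the
  side conditions \<open>hom m n f\<close>. Associativity is usually read off from cofreeness: a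
  coalgebra map into the tensor coalgebra is determined by its projection onto V. Here the universal
  property is unfolded into a recursion on the number of output factors, and naturality is what
  brings the crossings of both bracketings to the same place. The conditions on \<open>M\<close>
  with three indices cover positive indices only, whereas the recursion splits words arbitrarily.
  The cases with an empty word therefore have to be added, from the values of \<open>M\<close> with
  a zero index. All ranges of summation are extended to one bound \<open>N\<close>, since components
  with more outputs than letters vanish.\<close>

definition dec :: "nat \<Rightarrow> (nat \<times> nat) set" where
  "dec n = {(a, b). a + b = n}"

lemma finite_dec [simp]: "finite (dec n)"
proof (rule finite_subset)
  show "dec n \<subseteq> {..n} \<times> {..n}" by (auto simp: dec_def)
qed simp

lemma dec_0 [simp]: "dec 0 = {(0, 0)}" by (auto simp: dec_def)

lemma in_dec [simp]: "(a, b) \<in> dec n \<longleftrightarrow> a + b = n" by (simp add: dec_def)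

text \<open>Both sides run over all triples with c + d + b = n and differ only in which pair is
  summed first. Indexing by pairs, not by an index and its complement, keeps truncated subtraction
  out of the bijection.\<close>

lemma sum_dec_assoc:
  "(\<Sum>(a, b)\<in>dec n. \<Sum>(c, d)\<in>dec a. F c d b) =
   (\<Sum>(c, x)\<in>dec n. \<Sum>(d, b)\<in>dec x. F c d (b::nat) :: 'a::comm_monoid_add)"
proof -
  have "(\<Sum>(a, b)\<in>dec n. \<Sum>(c, d)\<in>dec a. F c d b)
      = (\<Sum>p\<in>Sigma (dec n) (\<lambda>p. dec (fst p)). F (fst (snd p)) (snd (snd p)) (snd (fst p)))"
    by (simp add: case_prod_beta' sum.Sigma)
  also have "\<dots> = (\<Sum>p\<in>Sigma (dec n) (\<lambda>p. dec (snd p)). F (fst (fst p)) (fst (snd p)) (snd (snd p)))"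
    by (rule sum.reindex_bij_witness
        [where j = "\<lambda>((a, b), (c, d)). ((c, d + b), (d, b))"
           and i = "\<lambda>((c, x), (d, b)). ((c + d, b), (c, d))"]) (auto simp: algebra_simps)
  also have "\<dots> = (\<Sum>(c, x)\<in>dec n. \<Sum>(d, b)\<in>dec x. F c d b)"
    by (simp add: case_prod_beta' sum.Sigma)
  finally show ?thesis .
qed

text \<open>The summand vanishes beyond the diagonal a + b = N, so the triangle may be enlarged to a
  square. There the two indices are independent, which later lets a double sum factor into a product
  of two sums.\<close>

lemma sum_dec_triangle:
  assumes "\<And>a b. a + b > N \<Longrightarrow> F a b = (0 :: 'a::comm_monoid_add)"
  shows "(\<Sum>n\<le>N. \<Sum>(a, b)\<in>dec n. F a b) = (\<Sum>a\<le>N. \<Sum>b\<le>N. F a b)"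
proof -
  have "(\<Sum>n\<le>N. \<Sum>(a, b)\<in>dec n. F a b) = (\<Sum>p\<in>Sigma {..N} dec. F (fst (snd p)) (snd (snd p)))"
    by (simp add: case_prod_beta' sum.Sigma)
  also have "\<dots> = (\<Sum>p\<in>{p \<in> {..N} \<times> {..N}. fst p + snd p \<le> N}. F (fst p) (snd p))"
    by (rule sum.reindex_bij_witness[where j = snd and i = "\<lambda>p. (fst p + snd p, p)"]) auto
  also have "\<dots> = (\<Sum>p\<in>{..N} \<times> {..N}. F (fst p) (snd p))"
    by (rule sum.mono_neutral_left) (use assms in \<open>force simp: not_le\<close>)+
  also have "\<dots> = (\<Sum>a\<le>N. \<Sum>b\<le>N. F a b)"
    by (simp add: sum.cartesian_product case_prod_beta')
  finally show ?thesis .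
qed

text \<open>The index set of the coproduct on words of lengths i and j: the first word is cut as a +
  c, the second as b + d. The order a, b, c, d is that of the blocks after c has been moved past
  b.\<close>

definition dsum :: "nat \<Rightarrow> nat \<Rightarrow> (nat \<Rightarrow> nat \<Rightarrow> nat \<Rightarrow> nat \<Rightarrow> 'a::comm_monoid_add) \<Rightarrow> 'a" where
  "dsum i j F = (\<Sum>(a, c)\<in>dec i. \<Sum>(b, d)\<in>dec j. F a b c d)"

lemma dsum_cong:
  assumes "\<And>a b c d. a + c = i \<Longrightarrow> b + d = j \<Longrightarrow> F a b c d = G a b c d"
  shows "dsum i j F = dsum i j G"
  unfolding dsum_def by (intro sum.cong) (auto intro!: sum.cong assms)

lemma dsum_zero:
  assumes "\<And>a b c d. a + c = i \<Longrightarrow> b + d = j \<Longrightarrow> F a b c d = 0"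
  shows "dsum i j F = 0"
  unfolding dsum_def by (auto intro!: sum.neutral simp: assms)

lemma dsum_single:
  assumes "\<And>a b c d. a + c = i \<Longrightarrow> b + d = j \<Longrightarrow> (a, b) \<noteq> (p, q) \<Longrightarrow> F a b c d = 0"
    and "p \<le> i" "q \<le> j"
  shows "dsum i j F = F p q (i - p) (j - q)"
proof -
  have "dsum i j F = (\<Sum>x\<in>dec i. if x = (p, i - p) then F p q (i - p) (j - q) else 0)"
    unfolding dsum_def
  proof (intro sum.cong refl)
    fix x assume "x \<in> dec i"
    then obtain a c where x: "x = (a, c)" "a + c = i" by (cases x) auto
    have "(\<Sum>(b, d)\<in>dec j. F a b c d)
        = (\<Sum>y\<in>dec j. if y = (q, j - q) then (if a = p then F a q c (j - q) else 0) else 0)"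
    proof (intro sum.cong refl)
      fix y assume "y \<in> dec j"
      then obtain b d where y: "y = (b, d)" "b + d = j" by (cases y) auto
      show "(case y of (b, d) \<Rightarrow> F a b c d)
          = (if y = (q, j - q) then (if a = p then F a q c (j - q) else 0) else 0)"
        using assms(1)[OF x(2) y(2)] y by auto
    qed
    also have "\<dots> = (if x = (p, i - p) then F p q (i - p) (j - q) else 0)"
      using x assms(2,3) by (auto simp: sum.delta)
    finally show "(case x of (a, c) \<Rightarrow> \<Sum>(b, d)\<in>dec j. F a b c d) =
        (if x = (p, i - p) then F p q (i - p) (j - q) else 0)" by (simp add: x)
  qed
  then show ?thesis using assms(2) by (simp add: sum.delta)
qed

text \<open>Coassociativity at the level of indices: either way the two words are cut into the
  pieces p, u, c and q, v, d.\<close>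

lemma dsum_assoc:
  "dsum i j (\<lambda>a b c d. dsum a b (\<lambda>p q u v. G p q u v c d)) =
   dsum i j (\<lambda>p q x y. dsum x y (\<lambda>u v c d. G p q u v c d))"
proof -
  have "dsum i j (\<lambda>a b c d. dsum a b (\<lambda>p q u v. G p q u v c d))
     = (\<Sum>(a, c)\<in>dec i. \<Sum>(p, u)\<in>dec a. \<Sum>(b, d)\<in>dec j. \<Sum>(q, v)\<in>dec b. G p q u v c d)"
    unfolding dsum_def case_prod_beta' by (rule sum.cong[OF refl], subst sum.swap) rule
  also have "\<dots> = (\<Sum>(a, c)\<in>dec i. \<Sum>(p, u)\<in>dec a. \<Sum>(q, y)\<in>dec j. \<Sum>(v, d)\<in>dec y. G p q u v c d)"
    by (simp only: sum_dec_assoc[of _ j])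
  also have "\<dots> = (\<Sum>(p, x)\<in>dec i. \<Sum>(u, c)\<in>dec x. \<Sum>(q, y)\<in>dec j. \<Sum>(v, d)\<in>dec y. G p q u v c d)"
    by (rule sum_dec_assoc)
  also have "\<dots> = dsum i j (\<lambda>p q x y. dsum x y (\<lambda>u v c d. G p q u v c d))"
    unfolding dsum_def case_prod_beta' by (rule sum.cong[OF refl], subst sum.swap) rule
  finally show ?thesis .
qed

lemma dsum_mult_left: "x * dsum i j F = dsum i j (\<lambda>a b c d. x * F a b c d)" for x :: "'a::semiring_0"
  by (simp add: dsum_def sum_distrib_left case_prod_beta')

lemma dsum_mult_right: "dsum i j F * x = dsum i j (\<lambda>a b c d. F a b c d * x)" for x :: "'a::semiring_0"
  by (simp add: dsum_def sum_distrib_right case_prod_beta')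

lemma sum_dsum: "(\<Sum>x\<in>X. dsum i j (F x)) = dsum i j (\<lambda>a b c d. \<Sum>x\<in>X. F x a b c d)"
  unfolding dsum_def case_prod_beta'
  by (subst sum.swap, rule sum.cong[OF refl], subst sum.swap) rule

section \<open>Whiskering and braidings in a ring of operators\<close>

text \<open>Pasting of two commuting squares, bracketed as the naturality proofs need it.\<close>

lemma mult_slide_left: "p * x = q * t \<Longrightarrow> x * y = z * w \<Longrightarrow> p * (z * w) = q * (t * y)"
  for p :: "'a::semigroup_mult"
  by (metis mult.assoc)

lemma mult_slide_right: "p * x = y * t \<Longrightarrow> r * y = z * u \<Longrightarrow> r * (p * x) = z * (u * t)"
  for p :: "'a::semigroup_mult"
  by (metis mult.assoc)

text \<open>
  \<open>e n\<close> is the identity of \<open>V\<^bsup>\<otimes>n\<^esup>\<close>, extended by zero to the other degrees. The predicate \<open>A\<close> singles out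
  the operators that live on \<open>T(V)\<close>: the tensor algebra is a proper subspace of the type that carries it,
  and only operators determined by their restriction to \<open>T(V)\<close> can satisfy these equations.
\<close>

locale strict_tensor =
  fixes e :: "nat \<Rightarrow> 'f::ring" and A :: "'f \<Rightarrow> bool" and L R :: "nat \<Rightarrow> 'f \<Rightarrow> 'f"
  assumes A_zero [simp]: "A 0"
    and A_add [simp]: "A f \<Longrightarrow> A g \<Longrightarrow> A (f + g)"
    and A_mult [simp]: "A f \<Longrightarrow> A g \<Longrightarrow> A (f * g)"
    and A_e [simp]: "A (e m)"
    and A_L [simp]: "A f \<Longrightarrow> A (L a f)"
    and A_R [simp]: "A f \<Longrightarrow> A (R a f)"
    and e_idem [simp]: "e m * e m = e m"
    and L_add [simp]: "A f \<Longrightarrow> A g \<Longrightarrow> L a (f + g) = L a f + L a g"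
    and R_add [simp]: "A f \<Longrightarrow> A g \<Longrightarrow> R a (f + g) = R a f + R a g"
    and L_mult [simp]: "A f \<Longrightarrow> A g \<Longrightarrow> L a (f * g) = L a f * L a g"
    and R_mult [simp]: "A f \<Longrightarrow> A g \<Longrightarrow> R a (f * g) = R a f * R a g"
    and L_e [simp]: "L a (e m) = e (a + m)"
    and R_e [simp]: "R a (e m) = e (m + a)"
    and L_L [simp]: "A f \<Longrightarrow> L a (L b f) = L (a + b) f"
    and R_R [simp]: "A f \<Longrightarrow> R a (R b f) = R (b + a) f"
    and L_R [simp]: "A f \<Longrightarrow> L a (R b f) = R b (L a f)"
    and L_0 [simp]: "A f \<Longrightarrow> L 0 f = f"
    and R_0 [simp]: "A f \<Longrightarrow> R 0 f = f"
    and slide_e: "A f \<Longrightarrow> A g \<Longrightarrow> e n * f = f \<Longrightarrow> f * e m = f \<Longrightarrow> e q * g = g \<Longrightarrow> g * e p = g \<Longrightarrow>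
      R q f * L m g = L n g * R p f"
begin

text \<open>Elements of the ring carry no source or target. Absorbing \<open>e n\<close> on the left
  and \<open>e m\<close> on the right says that f is a map from degree m to degree n, extended by
  zero; the interchange law is available for such f.\<close>

definition hom :: "nat \<Rightarrow> nat \<Rightarrow> 'f \<Rightarrow> bool" where
  "hom m n f \<longleftrightarrow> A f \<and> e n * f = f \<and> f * e m = f"

lemma hom_A: "hom m n f \<Longrightarrow> A f" by (simp add: hom_def)

lemma hom_left: "hom m n f \<Longrightarrow> e n * f = f" by (simp add: hom_def)

lemma hom_right: "hom m n f \<Longrightarrow> f * e m = f" by (simp add: hom_def)

text \<open>The interchange law: operators on disjoint blocks commute. The amounts of whiskering
  differ on the two sides because each operator may change the length of its own block.\<close>

lemma slide: "hom m n f \<Longrightarrow> hom p q g \<Longrightarrow> R q f * L m g = L n g * R p f"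
  by (rule slide_e) (auto simp: hom_def)

lemma slide': "hom m n f \<Longrightarrow> hom p q g \<Longrightarrow> R q f * (L m g * x) = L n g * (R p f * x)"
  by (simp add: slide mult.assoc[symmetric])

lemma L_zero [simp]: "L a 0 = 0"
  using L_add[of 0 0 a] by simp

lemma R_zero [simp]: "R a 0 = 0"
  using R_add[of 0 0 a] by simp

lemma A_sum: "(\<And>x. x \<in> X \<Longrightarrow> A (f x)) \<Longrightarrow> A (\<Sum>x\<in>X. f x)"
  by (induction X rule: infinite_finite_induct) auto

lemma L_sum: "(\<And>x. x \<in> X \<Longrightarrow> A (f x)) \<Longrightarrow> L a (\<Sum>x\<in>X. f x) = (\<Sum>x\<in>X. L a (f x))"
  by (induction X rule: infinite_finite_induct) (auto simp: A_sum)

lemma R_sum: "(\<And>x. x \<in> X \<Longrightarrow> A (f x)) \<Longrightarrow> R a (\<Sum>x\<in>X. f x) = (\<Sum>x\<in>X. R a (f x))"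
  by (induction X rule: infinite_finite_induct) (auto simp: A_sum)

lemma L_dsum: "(\<And>a b c d. A (F a b c d)) \<Longrightarrow> L x (dsum i j F) = dsum i j (\<lambda>a b c d. L x (F a b c d))"
  unfolding dsum_def by (simp add: L_sum A_sum case_prod_beta')

lemma R_dsum: "(\<And>a b c d. A (F a b c d)) \<Longrightarrow> R x (dsum i j F) = dsum i j (\<lambda>a b c d. R x (F a b c d))"
  unfolding dsum_def by (simp add: R_sum A_sum case_prod_beta')

lemma hom_cast: "hom m n f \<Longrightarrow> m = m' \<Longrightarrow> n = n' \<Longrightarrow> hom m' n' f" by simp

lemma hom_e [simp]: "hom m m (e m)" by (simp add: hom_def)

lemma hom_zero [simp]: "hom m n 0" by (simp add: hom_def)

lemma hom_add: "hom m n f \<Longrightarrow> hom m n g \<Longrightarrow> hom m n (f + g)"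
  by (simp add: hom_def algebra_simps)

lemma hom_mult: "hom n p g \<Longrightarrow> hom m n f \<Longrightarrow> hom m p (g * f)"
  unfolding hom_def by (metis A_mult mult.assoc)

lemma hom_L: "hom m n f \<Longrightarrow> hom (a + m) (a + n) (L a f)"
  unfolding hom_def by (metis A_L A_e L_e L_mult)

lemma hom_R: "hom m n f \<Longrightarrow> hom (m + a) (n + a) (R a f)"
  unfolding hom_def by (metis A_R A_e R_e R_mult)

lemma hom_sum: "(\<And>x. x \<in> X \<Longrightarrow> hom m n (f x)) \<Longrightarrow> hom m n (\<Sum>x\<in>X. f x)"
  by (induction X rule: infinite_finite_induct) (auto intro: hom_add)

end

text \<open>\<open>R 1 S\<close> and \<open>L 1 S\<close> are \<sigma> on the factors 1, 2 and on
  the factors 2, 3 of the third tensor power. Invertibility is measured against \<open>e 2\<close>,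
  the identity of that degree, which is not meant to be a unit of the ring.\<close>

locale strict_braided = strict_tensor +
  fixes S :: 'a
  assumes hom_S: "hom 2 2 S"
    and braid: "R 1 S * L 1 S * R 1 S = L 1 S * R 1 S * L 1 S"
    and S_inv: "\<exists>S'. hom 2 2 S' \<and> S * S' = e 2 \<and> S' * S = e 2"
begin

lemma A_S [simp]: "A S" using hom_S by (rule hom_A)

text \<open>\<open>b1 i\<close> is the product of \<sigma> at the positions 1, ..., i and carries
  the last of i + 1 letters to the front. \<open>b i j\<close> carries the j letters of the right
  block past the left block one by one, beginning with the first of them.\<close>

primrec b1 :: "nat \<Rightarrow> 'a" where
  "b1 0 = e 1"
| "b1 (Suc i) = R i S * L 1 (b1 i)"

primrec b :: "nat \<Rightarrow> nat \<Rightarrow> 'a" where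
  "b i 0 = e i"
| "b i (Suc j) = L j (b1 i) * R 1 (b i j)"

lemma hom_b1: "hom (i + 1) (i + 1) (b1 i)"
proof (induction i)
  case (Suc i)
  have "hom (i + 2) (i + 2) (L 1 (b1 i))" by (rule hom_cast[OF hom_L[OF Suc, of 1]]) auto
  moreover have "hom (i + 2) (i + 2) (R i S)" by (rule hom_cast[OF hom_R[OF hom_S, of i]]) auto
  ultimately show ?case by (simp add: hom_mult)
qed (use hom_e[of 1] in simp)

lemma A_b1 [simp]: "A (b1 i)" using hom_b1 by (rule hom_A)

lemma hom_b0: "hom (i + j) (i + j) (b i j)"
proof (induction j)
  case (Suc j)
  have "hom (i + j + 1) (i + j + 1) (L j (b1 i))" by (rule hom_cast[OF hom_L[OF hom_b1]]) auto
  moreover have "hom (i + j + 1) (i + j + 1) (R 1 (b i j))" by (rule hom_cast[OF hom_R[OF Suc]]) auto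
  ultimately show ?case by (simp add: hom_mult)
qed auto

lemma hom_b: "hom (i + j) (j + i) (b i j)"
  using hom_b0[of i j] by (simp add: add.commute)

lemma A_b [simp]: "A (b i j)" using hom_b by (rule hom_A)

lemma b_0_left [simp]: "b 0 j = e j"
  by (induction j) auto

lemma b_1_right: "b i 1 = b1 i"
  using hom_right[OF hom_b1[of i]] by simp

lemma b_1_1: "b 1 1 = S"
  unfolding b_1_right using hom_right[OF hom_S] by (simp flip: one_add_one)

text \<open>One of the two hexagon identities; it iterates the recursion of
  \<open>b\<close>.\<close>

lemma b_add_right: "b i (j + k) = L j (b i k) * R k (b i j)"
proof (induction k)
  case 0
  then show ?case using hom_left[OF hom_b0[of i j]] by (simp add: add.commute)
next
  case (Suc k)
  then show ?case by (simp add: mult.assoc add.commute)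
qed

lemma b1_add: "b1 (i + j) = R j (b1 i) * L i (b1 j)"
proof (induction i)
  case 0
  then show ?case using hom_left[OF hom_b1[of j]] by (simp add: add.commute)
next
  case (Suc i)
  then show ?case by (simp add: mult.assoc)
qed

text \<open>The other hexagon identity. The recursion of \<open>b\<close> peels the right block, so
  the crossing of j with the last letter must be interchanged with the crossing of i with the
  preceding k letters.\<close>

lemma b_add_left: "b (i + j) k = R j (b i k) * L i (b j k)"
proof (induction k)
  case (Suc k)
  have "L (k + i) (b1 j) * R (j + 1) (b i k) = R (j + 1) (b i k) * L (i + k) (b1 j)"
    using slide[OF hom_b[of i k] hom_b1[of j]] by simp
  then have *: "L (k + i) (b1 j) * (R (j + 1) (b i k) * x) = R (j + 1) (b i k) * (L (i + k) (b1 j) * x)" for x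
    by (simp only: mult.assoc[symmetric])
  show ?case using * by (simp add: Suc b1_add mult.assoc add.commute)
qed auto

text \<open>Naturality of the braiding with respect to \<open>f\<close>, for \<open>f\<close> in the right (\<open>natl\<close>) or the left (\<open>natr\<close>) factor.\<close>

definition natl :: "nat \<Rightarrow> nat \<Rightarrow> 'a \<Rightarrow> bool" where
  "natl m n f \<longleftrightarrow> hom m n f \<and> (\<forall>k. b k n * L k f = R k f * b k m)"

definition natr :: "nat \<Rightarrow> nat \<Rightarrow> 'a \<Rightarrow> bool" where
  "natr m n f \<longleftrightarrow> hom m n f \<and> (\<forall>k. b n k * R k f = L k f * b m k)"

lemma natlD: "natl m n f \<Longrightarrow> b k n * L k f = R k f * b k m" by (simp add: natl_def)
lemma natrD: "natr m n f \<Longrightarrow> b n k * R k f = L k f * b m k" by (simp add: natr_def)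
lemma natlD': "natl m n f \<Longrightarrow> b k n * (L k f * x) = R k f * (b k m * x)"
  by (simp add: natlD mult.assoc[symmetric])
lemma natrD': "natr m n f \<Longrightarrow> b n k * (R k f * x) = L k f * (b m k * x)"
  by (simp add: natrD mult.assoc[symmetric])

lemma natl_hom: "natl m n f \<Longrightarrow> hom m n f" and natr_hom: "natr m n f \<Longrightarrow> hom m n f"
  by (simp_all add: natl_def natr_def)

lemma natl_A: "natl m n f \<Longrightarrow> A f" and natr_A: "natr m n f \<Longrightarrow> A f"
  by (simp_all add: natl_def natr_def hom_def)

text \<open>By \<open>b_add_left\<close> a bundle of k strands is crossed one strand at a time, so f
  has to be pulled past a single strand only. The case k = 0 says that f has source m and target
  n.\<close>

lemma natlI1:
  assumes f: "hom m n f" and 1: "b 1 n * L 1 f = R 1 f * b 1 m"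
  shows "natl m n f"
proof -
  have A: "A f" using f by (rule hom_A)
  have "b k n * L k f = R k f * b k m" for k
  proof (induction k)
    case 0
    then show ?case using f by (simp add: A hom_left hom_right)
  next
    case (Suc k)
    have "b (k + 1) n * L (k + 1) f = R 1 (b k n) * L k (b 1 n * L 1 f)"
      unfolding b_add_left by (simp add: A mult.assoc)
    also have "\<dots> = R 1 (b k n * L k f) * L k (b 1 m)"
      unfolding 1 by (simp add: A mult.assoc)
    also have "\<dots> = R (k + 1) f * b (k + 1) m"
      unfolding Suc b_add_left by (simp add: A mult.assoc)
    finally show ?case by simp
  qed
  with f show ?thesis by (simp add: natl_def)
qed

lemma natrI1:
  assumes f: "hom m n f" and 1: "b n 1 * R 1 f = L 1 f * b m 1"
  shows "natr m n f"
proof -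
  have A: "A f" using f by (rule hom_A)
  have "b n k * R k f = L k f * b m k" for k
  proof (induction k)
    case 0
    then show ?case using f by (simp add: A hom_left hom_right)
  next
    case (Suc k)
    have "b n (k + 1) * R (k + 1) f = L k (b n 1) * R 1 (b n k * R k f)"
      unfolding b_add_right by (simp add: A mult.assoc del: b.simps)
    also have "\<dots> = L k (b n 1 * R 1 f) * R 1 (b m k)"
      unfolding Suc by (simp add: A mult.assoc del: b.simps)
    also have "\<dots> = L (k + 1) f * b m (k + 1)"
      unfolding 1 b_add_right by (simp add: A mult.assoc del: b.simps)
    finally show ?case by simp
  qed
  with f show ?thesis by (simp add: natr_def)
qed

text \<open>\<open>b 1 2\<close> is \<sigma> at position 1 followed by \<sigma> at position 2, so
  naturality past one strand is literally the braid relation.\<close>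

lemma natl_S: "natl 2 2 S"
proof (rule natlI1[OF hom_S])
  have "b 1 2 = L 1 S * R 1 S"
    using b_add_right[of 1 1 1] by (simp only: b_1_1 one_add_one)
  then show "b 1 2 * L 1 S = R 1 S * b 1 2"
    using braid by (simp add: mult.assoc)
qed

lemma natr_S: "natr 2 2 S"
proof (rule natrI1[OF hom_S])
  have "b 2 1 = R 1 S * L 1 S"
    using b_add_left[of 1 1 1] by (simp only: b_1_1 one_add_one)
  then show "b 2 1 * R 1 S = L 1 S * b 2 1"
    using braid by (simp add: mult.assoc)
qed

lemma natl_e: "natl m m (e m)"
  using hom_left[OF hom_b0] hom_right[OF hom_b0] by (simp add: natl_def add.commute[of m])

lemma natr_e: "natr m m (e m)"
  using hom_left[OF hom_b0] hom_right[OF hom_b0] by (simp add: natr_def add.commute[of _ m])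

lemma natl_zero: "natl m n 0" and natr_zero: "natr m n 0"
  by (simp_all add: natl_def natr_def)

lemma natl_add: "natl m n f \<Longrightarrow> natl m n g \<Longrightarrow> natl m n (f + g)"
  by (auto simp: natl_def hom_add hom_A algebra_simps)

lemma natr_add: "natr m n f \<Longrightarrow> natr m n g \<Longrightarrow> natr m n (f + g)"
  by (auto simp: natr_def hom_add hom_A algebra_simps)

lemma natl_mult: assumes g: "natl n p g" and f: "natl m n f" shows "natl m p (g * f)"
  unfolding natl_def
  using hom_mult[OF natl_hom[OF g] natl_hom[OF f]]
  by (simp add: natl_A[OF f] natl_A[OF g] mult.assoc natlD'[OF g] natlD[OF f])

lemma natr_mult: assumes g: "natr n p g" and f: "natr m n f" shows "natr m p (g * f)"
  unfolding natr_def
  using hom_mult[OF natr_hom[OF g] natr_hom[OF f]]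
  by (simp add: natr_A[OF f] natr_A[OF g] mult.assoc natrD'[OF g] natrD[OF f])

text \<open>A hexagon identity separates the crossing with the \<open>a\<close> untouched factors
  from the crossing with f. The former commutes with f by interchange, the latter is the naturality
  of f, and the two squares are pasted. The next three lemmas vary the side of the whiskering and of
  the strands.\<close>

lemma natl_L: assumes f: "natl m n f" shows "natl (a + m) (a + n) (L a f)"
proof -
  have "b k (a + n) * L k (L a f) = R k (L a f) * b k (a + m)" for k
  proof -
    have 1: "L (a + k) f * R m (b k a) = R n (b k a) * L (a + k) f"
      using slide[OF hom_b[of k a] natl_hom[OF f]] by (simp add: add.commute[of k a])
    have 2: "L a (b k n) * L (a + k) f = R k (L a f) * L a (b k m)"
      using arg_cong[OF natlD[OF f, of k], of "L a"] by (simp add: natl_A[OF f] add.commute[of k a])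
    have "L a (b k n) * (R n (b k a) * L (a + k) f) = R k (L a f) * (L a (b k m) * R m (b k a))"
      by (rule mult_slide_left[OF 2 1])
    then show ?thesis by (simp add: b_add_right natl_A[OF f] mult.assoc add.commute[of k a])
  qed
  then show ?thesis using f by (simp add: natl_def hom_L)
qed

lemma natl_R: assumes f: "natl m n f" shows "natl (m + a) (n + a) (R a f)"
proof -
  have "b k (n + a) * L k (R a f) = R k (R a f) * b k (m + a)" for k
  proof -
    have 1: "L n (b k a) * R (a + k) f = R (a + k) f * L m (b k a)"
      using slide[OF natl_hom[OF f] hom_b[of k a]] by (simp add: add.commute[of k a])
    have 2: "R a (b k n) * R a (L k f) = R (a + k) f * R a (b k m)"
      using arg_cong[OF natlD[OF f, of k], of "R a"] by (simp add: natl_A[OF f] add.commute[of k a])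
    have "L n (b k a) * (R a (b k n) * R a (L k f)) = R (a + k) f * (L m (b k a) * R a (b k m))"
      by (rule mult_slide_right[OF 2 1])
    then show ?thesis by (simp add: b_add_right natl_A[OF f] mult.assoc add.commute[of k a])
  qed
  then show ?thesis using f by (simp add: natl_def hom_R)
qed

lemma natr_L: assumes f: "natr m n f" shows "natr (a + m) (a + n) (L a f)"
proof -
  have "b (a + n) k * R k (L a f) = L k (L a f) * b (a + m) k" for k
  proof -
    have 1: "R n (b a k) * L (a + k) f = L (a + k) f * R m (b a k)"
      using slide[OF hom_b[of a k] natr_hom[OF f]] by (simp add: add.commute[of k a])
    have 2: "L a (b n k) * R k (L a f) = L (a + k) f * L a (b m k)"
      using arg_cong[OF natrD[OF f, of k], of "L a"] by (simp add: natr_A[OF f] add.commute[of k a])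
    have "R n (b a k) * (L a (b n k) * R k (L a f)) = L (a + k) f * (R m (b a k) * L a (b m k))"
      by (rule mult_slide_right[OF 2 1])
    then show ?thesis by (simp add: b_add_left natr_A[OF f] mult.assoc add.commute[of k a])
  qed
  then show ?thesis using f by (simp add: natr_def hom_L)
qed

lemma natr_R: assumes f: "natr m n f" shows "natr (m + a) (n + a) (R a f)"
proof -
  have "b (n + a) k * R k (R a f) = L k (R a f) * b (m + a) k" for k
  proof -
    have 1: "L n (b a k) * R (a + k) f = R (a + k) f * L m (b a k)"
      using slide[OF natr_hom[OF f] hom_b[of a k]] by (simp add: add.commute[of k a])
    have 2: "R a (b n k) * R (a + k) f = R a (L k f) * R a (b m k)"
      using arg_cong[OF natrD[OF f, of k], of "R a"] by (simp add: natr_A[OF f] add.commute[of k a])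
    have "R a (b n k) * (L n (b a k) * R (a + k) f) = R a (L k f) * (R a (b m k) * L m (b a k))"
      unfolding 1 by (rule mult_slide_left[OF 2 refl])
    then show ?thesis by (simp add: b_add_left natr_A[OF f] mult.assoc add.commute[of k a])
  qed
  then show ?thesis using f by (simp add: natr_def hom_R)
qed

definition nat2 :: "nat \<Rightarrow> nat \<Rightarrow> 'a \<Rightarrow> bool" where
  "nat2 m n f \<longleftrightarrow> natl m n f \<and> natr m n f"

lemma nat2_cast: "nat2 m n f \<Longrightarrow> m = m' \<Longrightarrow> n = n' \<Longrightarrow> nat2 m' n' f" by simp

lemma nat2_hom: "nat2 m n f \<Longrightarrow> hom m n f" by (simp add: nat2_def natl_hom)

text \<open>Natural operators are closed under everything from which the product is assembled, so
  naturality of a composite never has to be verified by hand.\<close>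

lemma nat2_closed:
  "nat2 2 2 S" "nat2 m m (e m)" "nat2 m n 0"
  "nat2 m n f \<Longrightarrow> nat2 m n g \<Longrightarrow> nat2 m n (f + g)"
  "nat2 n p g \<Longrightarrow> nat2 m n f \<Longrightarrow> nat2 m p (g * f)"
  "nat2 m n f \<Longrightarrow> nat2 (a + m) (a + n) (L a f)"
  "nat2 m n f \<Longrightarrow> nat2 (m + a) (n + a) (R a f)"
  by (simp_all add: nat2_def natl_S natr_S natl_e natr_e natl_zero natr_zero natl_add natr_add
      natl_L natr_L natl_R natr_R)
    (blast intro: natl_mult natr_mult)

lemma nat2_sum: "(\<And>x. x \<in> X \<Longrightarrow> nat2 m n (f x)) \<Longrightarrow> nat2 m n (\<Sum>x\<in>X. f x)"
  by (induction X rule: infinite_finite_induct) (auto intro: nat2_closed)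

lemma nat2_dsum:
  assumes "\<And>a b c d. a + c = i \<Longrightarrow> b + d = j \<Longrightarrow> nat2 m n (F a b c d)"
  shows "nat2 m n (dsum i j F)"
  unfolding dsum_def by (auto intro!: nat2_sum assms)

lemma nat2_b1: "nat2 (i + 1) (i + 1) (b1 i)"
proof (induction i)
  case (Suc i)
  have "nat2 (i + 2) (i + 2) (L 1 (b1 i))" by (rule nat2_cast[OF nat2_closed(6)[OF Suc]]) auto
  moreover have "nat2 (i + 2) (i + 2) (R i S)"
    by (rule nat2_cast[OF nat2_closed(7)[OF nat2_closed(1)]]) auto
  ultimately show ?case by (simp add: nat2_closed(5))
qed (use nat2_closed(2)[of 1] in simp)

lemma nat2_b: "nat2 (i + j) (j + i) (b i j)"
proof (induction j)
  case (Suc j)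
  have "nat2 (i + j + 1) (i + j + 1) (L j (b1 i))"
    by (rule nat2_cast[OF nat2_closed(6)[OF nat2_b1]]) auto
  moreover have "nat2 (i + j + 1) (i + j + 1) (R 1 (b i j))"
    by (rule nat2_cast[OF nat2_closed(7)[OF Suc]]) auto
  ultimately show ?case by (simp add: nat2_closed(5) add.commute)
qed (simp add: nat2_closed(2))

text \<open>The braiding is itself natural, being composed of whiskered copies of \<sigma>. The
  equation is this naturality for the operator \<open>b j k\<close>, with both sides opened by a
  hexagon identity.\<close>

lemma yang_baxter:
  "R i (b j k) * L j (b i k) * R k (b i j) = L k (b i j) * R j (b i k) * L i (b j k)"
  using natlD[of "j + k" "k + j" "b j k" i] nat2_b[of j k]
  by (simp add: nat2_def b_add_right mult.assoc)

section \<open>Invertibility of the braiding\<close>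

definition iso :: "nat \<Rightarrow> nat \<Rightarrow> 'a \<Rightarrow> bool" where
  "iso m n f \<longleftrightarrow> hom m n f \<and> (\<exists>g. hom n m g \<and> f * g = e n \<and> g * f = e m)"

lemma iso_mult: assumes "iso n p g" "iso m n f" shows "iso m p (g * f)"
proof -
  obtain g' f' where *: "hom p n g'" "g * g' = e p" "g' * g = e n"
      "hom n m f'" "f * f' = e n" "f' * f = e m" "hom n p g" "hom m n f"
    using assms by (auto simp: iso_def)
  have "(g * f) * (f' * g') = e p" "(f' * g') * (g * f) = e m"
    using * hom_left[OF *(1)] hom_left[OF *(8)] by (metis mult.assoc)+
  with * show ?thesis unfolding iso_def by (blast intro: hom_mult)
qed

lemma iso_L: assumes "iso m n f" shows "iso (a + m) (a + n) (L a f)"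
proof -
  obtain f' where *: "hom m n f" "hom n m f'" "f * f' = e n" "f' * f = e m"
    using assms by (auto simp: iso_def)
  have "L a f * L a f' = e (a + n)" "L a f' * L a f = e (a + m)"
    using * by (metis L_mult L_e hom_A)+
  with * show ?thesis unfolding iso_def by (blast intro: hom_L)
qed

lemma iso_R: assumes "iso m n f" shows "iso (m + a) (n + a) (R a f)"
proof -
  obtain f' where *: "hom m n f" "hom n m f'" "f * f' = e n" "f' * f = e m"
    using assms by (auto simp: iso_def)
  have "R a f * R a f' = e (n + a)" "R a f' * R a f = e (m + a)"
    using * by (metis R_mult R_e hom_A)+
  with * show ?thesis unfolding iso_def by (blast intro: hom_R)
qed

lemma iso_e: "iso m m (e m)"
  unfolding iso_def using hom_e[of m] e_idem[of m] by blast

lemma iso_b1: "iso (i + 1) (i + 1) (b1 i)"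
proof (induction i)
  case (Suc i)
  have "iso 2 2 S" using hom_S S_inv by (simp add: iso_def)
  from iso_R[OF this, of i] iso_L[OF Suc, of 1] show ?case by (auto intro: iso_mult)
qed (use iso_e[of 1] in simp)

lemma iso_b: "iso (i + j) (j + i) (b i j)"
proof (induction j)
  case (Suc j)
  from iso_L[OF iso_b1, of j i] iso_R[OF Suc, of 1] show ?case
    by (auto intro: iso_mult simp: add.commute add.left_commute)
qed (simp add: iso_e)

end

section \<open>The product on graded components\<close>

text \<open>The associativity condition on \<open>M\<close> is left to a later locale because it is
  phrased with \<open>st\<close>, which is only defined once \<open>m\<close> and the braiding are
  available.\<close>

locale multibrace_core = strict_braided +
  fixes m :: "nat \<Rightarrow> nat \<Rightarrow> 'a"
  assumes hom_m: "hom (i + j) 1 (m i j)"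
    and m_0_0: "m 0 0 = 0"
    and m_1_0: "m 1 0 = e 1" and m_0_1: "m 0 1 = e 1"
    and m_n_0: "n \<ge> 2 \<Longrightarrow> m n 0 = 0" and m_0_n: "n \<ge> 2 \<Longrightarrow> m 0 n = 0"
    and m_natr: "i \<ge> 1 \<Longrightarrow> j \<ge> 1 \<Longrightarrow> k \<ge> 1 \<Longrightarrow> b 1 k * R k (m i j) = L k (m i j) * b (i + j) k"
    and m_natl: "i \<ge> 1 \<Longrightarrow> j \<ge> 1 \<Longrightarrow> k \<ge> 1 \<Longrightarrow> b i 1 * L i (m j k) = R i (m j k) * b i (j + k)"
begin

lemma A_m [simp]: "A (m i j)" using hom_m by (rule hom_A)

lemma m_left_0: "m 0 n = (if n = 1 then e 1 else 0)"
  using m_0_0 m_0_1 m_0_n[of n] by (cases "n = 0"; cases "n = 1") auto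

lemma m_right_0: "m n 0 = (if n = 1 then e 1 else 0)"
  using m_0_0 m_1_0 m_n_0[of n] by (cases "n = 0"; cases "n = 1") auto

text \<open>The naturality conditions cover positive indices. With a zero index \<open>m\<close> is
  \<open>e 1\<close> or zero, and both are natural.\<close>

lemma nat2_m: "nat2 (i + j) 1 (m i j)"
proof (cases "i = 0 \<or> j = 0")
  case True
  then show ?thesis
    by (auto simp: m_left_0 m_right_0 nat2_closed)
next
  case False
  then have "natl (i + j) 1 (m i j)"
    using m_natl[of 1 i j] by (intro natlI1[OF hom_m]) auto
  moreover have "natr (i + j) 1 (m i j)"
    using m_natr[of i j 1] False by (intro natrI1[OF hom_m]) auto
  ultimately show ?thesis by (simp add: nat2_def)
qed

text \<open>\<open>b i2 j1\<close>, whiskered by \<open>i1\<close> and \<open>j2\<close>, is the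
  middle braiding of the coproduct. The recursion takes off the last output factor, in accordance
  with the left-nested iteration of the coproduct. \<open>st 0\<close> is the summand \<epsilon>
  \<otimes> \<epsilon>, which lives on two empty words only.\<close>

primrec st :: "nat \<Rightarrow> nat \<Rightarrow> nat \<Rightarrow> 'a" where
  "st 0 i j = (if i = 0 \<and> j = 0 then e 0 else 0)"
| "st (Suc r) i j = dsum i j (\<lambda>i1 j1 i2 j2.
     R 1 (st r i1 j1) * (L (i1 + j1) (m i2 j2) * R j2 (L i1 (b i2 j1))))"

lemma nat2_shuffle:
  assumes "i1 + i2 = i" "j1 + j2 = j"
  shows "nat2 (i + j) (i1 + j1 + i2 + j2) (R j2 (L i1 (b i2 j1)))"
  using nat2_cast[OF nat2_closed(7)[OF nat2_closed(6)[OF nat2_b[of i2 j1], of i1], of j2],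
      of "i + j" "i1 + j1 + i2 + j2"] assms by simp

lemma nat2_st: "nat2 (i + j) r (st r i j)"
proof (induction r arbitrary: i j)
  case 0
  then show ?case by (simp add: nat2_closed)
next
  case (Suc r)
  have "nat2 (i + j) (Suc r) (R 1 (st r i1 j1) * (L (i1 + j1) (m i2 j2) * R j2 (L i1 (b i2 j1))))"
    if "i1 + i2 = i" "j1 + j2 = j" for i1 j1 i2 j2
  proof -
    have "nat2 (i + j) (i1 + j1 + 1) (L (i1 + j1) (m i2 j2) * R j2 (L i1 (b i2 j1)))"
      by (rule nat2_closed(5)[OF nat2_cast[OF nat2_closed(6)[OF nat2_m]] nat2_shuffle[OF that]]) auto
    from nat2_closed(5)[OF nat2_closed(7)[OF Suc.IH] this] show ?thesis by simp
  qed
  then show ?case by (simp add: nat2_dsum)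
qed

lemma hom_st: "hom (i + j) r (st r i j)"
  by (rule nat2_hom[OF nat2_st])

lemma A_st [simp]: "A (st r i j)"
  using hom_st by (rule hom_A)

lemma st_eq_0: "i + j < r \<Longrightarrow> st r i j = 0"
proof (induction r arbitrary: i j)
  case (Suc r)
  have "R 1 (st r i1 j1) * (L (i1 + j1) (m i2 j2) * R j2 (L i1 (b i2 j1))) = 0"
    if "i1 + i2 = i" "j1 + j2 = j" for i1 j1 i2 j2
  proof (cases "i2 = 0 \<and> j2 = 0")
    case True
    then show ?thesis by (simp add: m_0_0)
  next
    case False
    then have "i1 + j1 < r" using that Suc.prems by auto
    then show ?thesis by (simp add: Suc.IH)
  qed
  then show ?case by (simp add: dsum_zero)
qed simp

lemma st_1: "st 1 i j = m i j"
proof -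
  have "st 1 i j = R 1 (e 0) * (L 0 (m i j) * R j (L 0 (b i 0)))"
    unfolding One_nat_def st.simps by (subst dsum_single[where p = 0 and q = 0]) auto
  also have "\<dots> = m i j" using hom_left[OF hom_m] hom_right[OF hom_m] by simp
  finally show ?thesis .
qed

text \<open>With an empty left word the only surviving splitting takes off a single letter, and
  \<open>m 0 1\<close> is the identity. This makes the empty word a left unit.\<close>

lemma st_left_0: "st r 0 j = (if r = j then e j else 0)"
proof (induction r arbitrary: j)
  case (Suc r)
  show ?case
  proof (cases "j = 0")
    case True
    then show ?thesis by (simp add: st_eq_0 del: st.simps)
  next
    case False
    have "st (Suc r) 0 j = R 1 (st r 0 (j - 1)) * (L (0 + (j - 1)) (m (0 - 0) (j - (j - 1)))
        * R (j - (j - 1)) (L 0 (b (0 - 0) (j - 1))))"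
      unfolding st.simps by (subst dsum_single[where p = 0 and q = "j - 1"]) (auto simp: m_left_0)
    also have "\<dots> = (if Suc r = j then e j else 0)"
      using False by (auto simp: Suc.IH m_0_1[unfolded One_nat_def])
    finally show ?thesis .
  qed
qed simp

lemma st_right_0: "st r i 0 = (if r = i then e i else 0)"
proof (induction r arbitrary: i)
  case (Suc r)
  show ?case
  proof (cases "i = 0")
    case True
    then show ?thesis by (simp add: st_eq_0 del: st.simps)
  next
    case False
    have "st (Suc r) i 0 = R 1 (st r (i - 1) 0) * (L (i - 1 + 0) (m (i - (i - 1)) (0 - 0))
        * R (0 - 0) (L (i - 1) (b (i - (i - 1)) 0)))"
      unfolding st.simps by (subst dsum_single[where q = 0 and p = "i - 1"]) (auto simp: m_right_0)
    also have "\<dots> = (if Suc r = i then e i else 0)"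
      using False by (auto simp: Suc.IH m_1_0[unfolded One_nat_def])
    finally show ?thesis .
  qed
qed simp

text \<open>Both sides carry the blocks u, c, q, v to the order q, u, v, c and differ by one
  interchange of disjoint crossings. This is the braid part of the coassociativity of the
  coproduct.\<close>

lemma shuffle_assoc:
  "R (v + c) (b u q) * L u (b c (q + v)) = L (q + u) (b c v) * R v (b (u + c) q)"
proof -
  have "R (v + c) (b u q) * L (u + q) (b c v) = L (q + u) (b c v) * R (v + c) (b u q)"
    using slide[OF hom_b[of u q] hom_b[of c v]] by (simp add: add.commute)
  then have "R (v + c) (b u q) * (L (u + q) (b c v) * x) = L (q + u) (b c v) * (R (v + c) (b u q) * x)" for x
    by (simp only: mult.assoc[symmetric])
  then show ?thesis by (simp add: b_add_right b_add_left mult.assoc add.commute[of c v])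
qed

lemma shuffle_assoc_at:
  "R (d + v + c) (L p (b u q)) * R d (L (p + u) (b c (q + v)))
     = R d (L (p + q + u) (b c v)) * R (v + d) (L p (b (u + c) q))"
  using arg_cong[OF shuffle_assoc[of v c u q], of "\<lambda>x. R d (L p x)"]
  by (simp add: add.assoc add.commute add.left_commute)

text \<open>The recursion is the case \<open>r2 = 1\<close>, and the general case is coassociativity
  of the coproduct. In the induction step the last bracket is moved out of the way of the inner
  shuffle; then the index sets and the shuffles are reassociated separately.\<close>

lemma st_add:
  "st (r1 + r2) i j = dsum i j (\<lambda>i1 j1 i2 j2.
     R r2 (st r1 i1 j1) * (L (i1 + j1) (st r2 i2 j2) * R j2 (L i1 (b i2 j1))))"
proof (induction r2 arbitrary: i j)
  case 0
  have "dsum i j (\<lambda>i1 j1 i2 j2. R 0 (st r1 i1 j1) * (L (i1 + j1) (st 0 i2 j2) * R j2 (L i1 (b i2 j1))))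
     = R 0 (st r1 i j) * (L (i + j) (st 0 (i - i) (j - j)) * R (j - j) (L i (b (i - i) j)))"
    by (rule dsum_single) auto
  also have "\<dots> = st r1 i j" using hom_right[OF hom_st] by simp
  finally show ?case by simp
next
  case (Suc r)
  have "st (r1 + Suc r) i j = dsum i j (\<lambda>a b' c d. dsum a b' (\<lambda>p q u v.
      R (r + 1) (st r1 p q) * (R 1 (L (p + q) (st r u v)) * (R 1 (R v (L p (b u q))) *
       (L (a + b') (m c d) * R d (L a (b c b')))))))"
    by (simp add: Suc R_dsum dsum_mult_right mult.assoc)
  also have "\<dots> = dsum i j (\<lambda>a b' c d. dsum a b' (\<lambda>p q u v.
      R (r + 1) (st r1 p q) * (R 1 (L (p + q) (st r u v)) * (L (p + q + u + v) (m c d) *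
       (R (c + d + v) (L p (b u q)) * R d (L (p + u) (b c (q + v))))))))"
  proof (intro dsum_cong)
    fix a b' c d p q u v :: nat assume *: "p + u = a" "q + v = b'"
    \<comment> \<open>The inner shuffle permutes the first a + b' factors only, so it slides past
      the bracket \<open>m c d\<close>, which acts on the blocks behind them.\<close>
    have "hom (a + b') (p + q + u + v) (R v (L p (b u q)))"
      by (rule nat2_hom[OF nat2_shuffle[OF *]])
    from slide'[OF this hom_m[of c d]]
    show "R (r + 1) (st r1 p q) * (R 1 (L (p + q) (st r u v)) * (R 1 (R v (L p (b u q))) *
       (L (a + b') (m c d) * R d (L a (b c b')))))
      = R (r + 1) (st r1 p q) * (R 1 (L (p + q) (st r u v)) * (L (p + q + u + v) (m c d) *
       (R (c + d + v) (L p (b u q)) * R d (L (p + u) (b c (q + v))))))"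
      using * by (simp add: add.commute add.left_commute)
  qed
  also have "\<dots> = dsum i j (\<lambda>p q x y. dsum x y (\<lambda>u v c d.
      R (r + 1) (st r1 p q) * (R 1 (L (p + q) (st r u v)) * (L (p + q + u + v) (m c d) *
       (R (c + d + v) (L p (b u q)) * R d (L (p + u) (b c (q + v))))))))"
    by (rule dsum_assoc)
  also have "\<dots> = dsum i j (\<lambda>p q x y. dsum x y (\<lambda>u v c d.
      R (r + 1) (st r1 p q) * (L (p + q) (R 1 (st r u v) * (L (u + v) (m c d) * R d (L u (b c v)))) *
        R y (L p (b x q)))))"
  proof (intro dsum_cong)
    fix p q x y u v c d :: nat assume *: "u + c = x" "v + d = y"
    show "R (r + 1) (st r1 p q) * (R 1 (L (p + q) (st r u v)) * (L (p + q + u + v) (m c d) *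
       (R (c + d + v) (L p (b u q)) * R d (L (p + u) (b c (q + v))))))
      = R (r + 1) (st r1 p q) * (L (p + q) (R 1 (st r u v) * (L (u + v) (m c d) * R d (L u (b c v)))) *
        R y (L p (b x q)))"
      using shuffle_assoc_at[of d v c p u q] *
      by (simp add: mult.assoc add.assoc add.commute add.left_commute)
  qed
  also have "\<dots> = dsum i j (\<lambda>i1 j1 i2 j2.
     R (Suc r) (st r1 i1 j1) * (L (i1 + j1) (st (Suc r) i2 j2) * R j2 (L i1 (b i2 j1))))"
    by (simp add: L_dsum dsum_mult_left dsum_mult_right mult.assoc)
  finally show ?case .
qed

end

section \<open>Associativity on graded components\<close>

locale multibrace_assoc = multibrace_core +
  assumes m_assoc: "i \<ge> 1 \<Longrightarrow> j \<ge> 1 \<Longrightarrow> k \<ge> 1 \<Longrightarrow>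
    (\<Sum>r=1..i+j. m r k * R k (st r i j)) = (\<Sum>l=1..j+k. m i l * L i (st l j k))"
begin

text \<open>For positive indices the added terms vanish: nonempty words have no component with zero
  outputs, and there are too few letters for large r. If a word is empty, \<open>st\<close> with a
  zero index is an identity or zero, and so is \<open>m\<close>; both sides collapse to the same
  single bracket.\<close>

lemma m_assoc_all:
  assumes N: "N \<ge> i + j + k"
  shows "(\<Sum>r\<le>N. m r k * R k (st r i j)) = (\<Sum>l\<le>N. m i l * L i (st l j k))"
proof (cases "i \<ge> 1 \<and> j \<ge> 1 \<and> k \<ge> 1")
  case True
  have "(\<Sum>r\<le>N. m r k * R k (st r i j)) = (\<Sum>r=1..i+j. m r k * R k (st r i j))"
  proof (rule sum.mono_neutral_right, use N in \<open>simp_all del: st.simps, fastforce?\<close>)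
    show "\<forall>r\<in>{..N} - {Suc 0..i + j}. m r k * R k (st r i j) = 0"
    proof
      fix r assume "r \<in> {..N} - {Suc 0..i + j}"
      then have "r = 0 \<or> r > i + j" by auto
      then show "m r k * R k (st r i j) = 0" using True by (auto simp: st_eq_0)
    qed
  qed
  moreover have "(\<Sum>r\<le>N. m i r * L i (st r j k)) = (\<Sum>r=1..j+k. m i r * L i (st r j k))"
  proof (rule sum.mono_neutral_right, use N in \<open>simp_all del: st.simps, fastforce?\<close>)
    show "\<forall>r\<in>{..N} - {Suc 0..j + k}. m i r * L i (st r j k) = 0"
    proof
      fix r assume "r \<in> {..N} - {Suc 0..j + k}"
      then have "r = 0 \<or> r > j + k" by auto
      then show "m i r * L i (st r j k) = 0" using True by (auto simp: st_eq_0)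
    qed
  qed
  ultimately show ?thesis using m_assoc True by simp
next
  case False
  then consider "i = 0" | "j = 0" | "k = 0" by linarith
  then show ?thesis
  proof cases
    case 1
    have "(\<Sum>r\<le>N. m r k * R k (st r i j)) = m j k * e (j + k)"
      using N by (simp add: 1 st_left_0 if_distrib[of "\<lambda>x. _ * R _ x"] sum.delta cong: if_cong)
    moreover have "(\<Sum>l\<le>N. m i l * L i (st l j k)) = e 1 * m j k"
    proof -
      have "(\<Sum>l\<le>N. m i l * L i (st l j k)) = (\<Sum>l\<le>N. if l = 1 then e 1 * m j k else 0)"
        unfolding 1 by (intro sum.cong refl) (auto simp: m_left_0 st_1[simplified])
      also have "\<dots> = e 1 * m j k"
        using N m_0_0 by (cases "N = 0") (auto simp: sum.delta 1)
      finally show ?thesis .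
    qed
    ultimately show ?thesis by (simp add: hom_left[OF hom_m, simplified] hom_right[OF hom_m])
  next
    case 2
    have "(\<Sum>r\<le>N. m r k * R k (st r i j)) = m i k * e (i + k)"
      using N by (simp add: 2 st_right_0 if_distrib[of "\<lambda>x. _ * R _ x"] sum.delta cong: if_cong)
    moreover have "(\<Sum>l\<le>N. m i l * L i (st l j k)) = m i k * e (i + k)"
      using N by (simp add: 2 st_left_0 if_distrib[of "\<lambda>x. _ * L _ x"] sum.delta cong: if_cong)
    ultimately show ?thesis by simp
  next
    case 3
    have "(\<Sum>l\<le>N. m i l * L i (st l j k)) = m i j * e (i + j)"
      using N by (simp add: 3 st_right_0 if_distrib[of "\<lambda>x. _ * L _ x"] sum.delta cong: if_cong)
    moreover have "(\<Sum>r\<le>N. m r k * R k (st r i j)) = e 1 * m i j"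
    proof -
      have "(\<Sum>r\<le>N. m r k * R k (st r i j)) = (\<Sum>l\<le>N. if l = 1 then e 1 * m i j else 0)"
        unfolding 3 by (intro sum.cong refl) (auto simp: m_right_0 st_1[simplified])
      also have "\<dots> = e 1 * m i j"
        using N m_0_0 by (cases "N = 0") (auto simp: sum.delta 3)
      finally show ?thesis .
    qed
    ultimately show ?thesis by (simp add: hom_left[OF hom_m, simplified] hom_right[OF hom_m])
  qed
qed

text \<open>Cuts the inner product where the outer one is cut. \<open>G a c\<close> stands for an
  outer term whose first n outputs use a letters and whose last output uses c. The map \<phi> is the
  whiskering \<open>R k\<close> or \<open>L i\<close> by the remaining word, so that one lemma
  serves both bracketings.\<close>

lemma sum_st_add:
  fixes G :: "nat \<Rightarrow> nat \<Rightarrow> 'a"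
  assumes N: "N \<ge> i + j"
    and \<phi>0: "\<phi> 0 = 0"
    and \<phi>: "\<And>F. (\<And>p q u v. A (F p q u v)) \<Longrightarrow> \<phi> (dsum i j F) = dsum i j (\<lambda>p q u v. \<phi> (F p q u v))"
  shows "(\<Sum>r\<le>N. \<Sum>(a, c)\<in>dec r. G a c * \<phi> (st r i j)) =
    dsum i j (\<lambda>i1 j1 i2 j2. \<Sum>a\<le>N. \<Sum>c\<le>N.
       G a c * \<phi> (R c (st a i1 j1) * (L (i1 + j1) (st c i2 j2) * R j2 (L i1 (b i2 j1)))))"
proof -
  have "(\<Sum>r\<le>N. \<Sum>(a, c)\<in>dec r. G a c * \<phi> (st r i j))
      = (\<Sum>r\<le>N. \<Sum>(a, c)\<in>dec r. G a c * \<phi> (st (a + c) i j))"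
    by (intro sum.cong refl) (auto simp: dec_def intro!: sum.cong)
  also have "\<dots> = (\<Sum>a\<le>N. \<Sum>c\<le>N. G a c * \<phi> (st (a + c) i j))"
    by (rule sum_dec_triangle) (use N in \<open>simp add: st_eq_0 \<phi>0\<close>)
  also have "\<dots> = dsum i j (\<lambda>i1 j1 i2 j2. \<Sum>a\<le>N. \<Sum>c\<le>N.
       G a c * \<phi> (R c (st a i1 j1) * (L (i1 + j1) (st c i2 j2) * R j2 (L i1 (b i2 j1)))))"
    unfolding st_add by (subst \<phi>) (simp_all add: dsum_mult_left sum_dsum)
  finally show ?thesis .
qed

text \<open>Sorts the operators into those producing the first n outputs and those producing the
  last one. \<open>st a\<close> slides past the crossing and past \<open>m c k2\<close>;
  \<open>st c\<close> has to be pulled through the crossing with k1, which is its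
  naturality.\<close>

lemma st_assoc_left:
  assumes "i1 + i2 = i" "j1 + j2 = j" "k1 + k2 = k"
  shows "R 1 (st n a k1) * (L (a + k1) (m c k2) * R k2 (L a (b c k1))) *
      R k (R c (st a i1 j1) * (L (i1 + j1) (st c i2 j2) * R j2 (L i1 (b i2 j1))))
    = R 1 (st n a k1 * R k1 (st a i1 j1)) * (L (i1 + j1 + k1) (m c k2 * R k2 (st c i2 j2)) *
      (R k2 (L (i1 + j1) (b (i2 + j2) k1)) * R (j2 + k) (L i1 (b i2 j1))))"
proof -
  have 1: "R k2 (L a (b c k1)) * (R (c + (k1 + k2)) (st a i1 j1) * x)
      = R (c + (k1 + k2)) (st a i1 j1) * (R k2 (L (i1 + j1) (b c k1)) * x)" for x
    using slide'[OF hom_st[of i1 j1 a] hom_R[OF hom_b[of c k1], of k2], of x, symmetric]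
    by (simp add: ac_simps)
  have 2: "R k2 (L (i1 + j1) (b c k1)) * (R (k1 + k2) (L (i1 + j1) (st c i2 j2)) * x)
      = L (i1 + j1 + k1) (R k2 (st c i2 j2)) * (R k2 (L (i1 + j1) (b (i2 + j2) k1)) * x)" for x
    using arg_cong[OF natrD[of "i2 + j2" c "st c i2 j2" k1], of "\<lambda>y. R k2 (L (i1 + j1) y) * x"]
      nat2_st[of i2 j2 c]
    by (simp add: nat2_def ac_simps)
  have 3: "L (a + k1) (m c k2) * (R (c + (k1 + k2)) (st a i1 j1) * x)
      = R (k1 + 1) (st a i1 j1) * (L (i1 + j1 + k1) (m c k2) * x)" for x
    using slide'[OF hom_R[OF hom_st[of i1 j1 a], of k1] hom_m[of c k2], of x]
    by (simp add: ac_simps)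
  show ?thesis unfolding assms[symmetric] using 1 2 3 by (simp add: mult.assoc)
qed

text \<open>The mirror image: now \<open>st a\<close> is pulled through the crossing with i2 by
  naturality, while \<open>st c\<close> slides past it.\<close>

lemma st_assoc_right:
  assumes "i1 + i2 = i" "j1 + j2 = j" "k1 + k2 = k"
  shows "R 1 (st n i1 a) * (L (i1 + a) (m i2 c) * R c (L i1 (b i2 a))) *
      L i (R c (st a j1 k1) * (L (j1 + k1) (st c j2 k2) * R k2 (L j1 (b j2 k1))))
    = R 1 (st n i1 a * L i1 (st a j1 k1)) * (L (i1 + j1 + k1) (m i2 c * L i2 (st c j2 k2)) *
      (R (j2 + k2) (L i1 (b i2 (j1 + k1))) * L i (R k2 (L j1 (b j2 k1)))))"
proof -
  have 1: "R c (L i1 (b i2 a)) * (L (i1 + i2) (R c (st a j1 k1)) * x)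
      = R c (L i1 (R i2 (st a j1 k1))) * (R c (L i1 (b i2 (j1 + k1))) * x)" for x
    using arg_cong[OF natlD[of "j1 + k1" a "st a j1 k1" i2], of "\<lambda>y. R c (L i1 y) * x"]
      nat2_st[of j1 k1 a]
    by (simp add: nat2_def ac_simps)
  have 2: "R c (L i1 (b i2 (j1 + k1))) * (L (i1 + i2 + (j1 + k1)) (st c j2 k2) * x)
      = L (i1 + j1 + k1) (L i2 (st c j2 k2)) * (R (j2 + k2) (L i1 (b i2 (j1 + k1))) * x)" for x
    using slide'[OF hom_L[OF hom_b[of i2 "j1 + k1"], of i1] hom_st[of j2 k2 c], of x]
    by (simp add: ac_simps)
  have 3: "L (i1 + a) (m i2 c) * (R c (L i1 (R i2 (st a j1 k1))) * x)
      = R 1 (L i1 (st a j1 k1)) * (L (i1 + j1 + k1) (m i2 c) * x)" for x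
    using slide'[OF hom_L[OF hom_st[of j1 k1 a], of i1] hom_m[of i2 c], of x]
    by (simp add: ac_simps)
  show ?thesis unfolding assms[symmetric] using 1 2 3 by (simp add: mult.assoc)
qed

text \<open>Both bracketings bring the six blocks to the order i1, j1, k1, i2, j2, k2. They differ
  by the interchange of two disjoint crossings, that of i2 with j1 and that of j2 with k1.\<close>

lemma st_assoc_shuffle:
  assumes "i1 + i2 = i" "j1 + j2 = j" "k1 + k2 = k"
  shows "R k2 (L (i1 + j1) (b (i2 + j2) k1)) * R (j2 + k) (L i1 (b i2 j1))
    = R (j2 + k2) (L i1 (b i2 (j1 + k1))) * L i (R k2 (L j1 (b j2 k1)))"
proof -
  have "L (i2 + j1) (b j2 k1) * R (j2 + k1) (b i2 j1) = R (j2 + k1) (b i2 j1) * L (i2 + j1) (b j2 k1)"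
    using slide[OF hom_b[of i2 j1] hom_b[of j2 k1]] by (simp add: ac_simps)
  then have "L j1 (b (i2 + j2) k1) * R (j2 + k1) (b i2 j1) = R j2 (b i2 (j1 + k1)) * L i2 (L j1 (b j2 k1))"
    by (simp add: b_add_left b_add_right ac_simps)
  from arg_cong[OF this, of "\<lambda>y. R k2 (L i1 y)"] show ?thesis unfolding assms[symmetric]
    by (simp add: ac_simps)
qed

text \<open>Cutting off the last output of the outer product forces, by \<open>st_add\<close>, a cut
  of the inner product. The double sum then factors: the first n outputs are the induction
  hypothesis, the last one is \<open>m_assoc_all\<close>. \<open>N\<close> stays fixed throughout,
  since it also bounds the total length of all triples of subwords.\<close>

theorem st_assoc:
  assumes N: "N \<ge> i + j + k"
  shows "(\<Sum>r\<le>N. st n r k * R k (st r i j)) = (\<Sum>l\<le>N. st n i l * L i (st l j k))"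
  using N
proof (induction n arbitrary: i j k)
  case 0
  have "(\<Sum>r\<le>N. st 0 r k * R k (st r i j)) = (\<Sum>r\<le>N. if r = 0 then (if i = 0 \<and> j = 0 \<and> k = 0 then e 0 else 0) else 0)"
    by (intro sum.cong refl) auto
  moreover have "(\<Sum>l\<le>N. st 0 i l * L i (st l j k)) = (\<Sum>r\<le>N. if r = 0 then (if i = 0 \<and> j = 0 \<and> k = 0 then e 0 else 0) else 0)"
    by (intro sum.cong refl) auto
  ultimately show ?case by simp
next
  case (Suc n)
  \<comment> \<open>The common value of both sides for one splitting of the three words, written in
    the form belonging to the left bracketing.\<close>
  define T where "T = (\<lambda>i1 i2 j1 j2 k1 k2.
     R 1 (\<Sum>a\<le>N. st n a k1 * R k1 (st a i1 j1)) *
     (L (i1 + j1 + k1) (\<Sum>c\<le>N. m c k2 * R k2 (st c i2 j2)) *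
      (R k2 (L (i1 + j1) (b (i2 + j2) k1)) * R (j2 + k) (L i1 (b i2 j1)))))"
  have "(\<Sum>r\<le>N. st (Suc n) r k * R k (st r i j))
      = (\<Sum>r\<le>N. \<Sum>(a, c)\<in>dec r. (\<Sum>(k1, k2)\<in>dec k.
          R 1 (st n a k1) * (L (a + k1) (m c k2) * R k2 (L a (b c k1)))) * R k (st r i j))"
    by (simp add: dsum_def sum_distrib_right case_prod_beta')
  also have "\<dots> = dsum i j (\<lambda>i1 j1 i2 j2. \<Sum>a\<le>N. \<Sum>c\<le>N. (\<Sum>(k1, k2)\<in>dec k.
          R 1 (st n a k1) * (L (a + k1) (m c k2) * R k2 (L a (b c k1)))) *
      R k (R c (st a i1 j1) * (L (i1 + j1) (st c i2 j2) * R j2 (L i1 (b i2 j1)))))"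
    by (rule sum_st_add) (use Suc.prems R_dsum in auto)
  also have "\<dots> = (\<Sum>(i1, i2)\<in>dec i. \<Sum>(j1, j2)\<in>dec j. \<Sum>(k1, k2)\<in>dec k. \<Sum>a\<le>N. \<Sum>c\<le>N.
      R 1 (st n a k1) * (L (a + k1) (m c k2) * R k2 (L a (b c k1))) *
      R k (R c (st a i1 j1) * (L (i1 + j1) (st c i2 j2) * R j2 (L i1 (b i2 j1)))))"
    unfolding dsum_def case_prod_beta' sum_distrib_right
    by (intro sum.cong[OF refl], subst sum.swap[of _ "{..N}" "dec k"] , subst sum.swap[of _ "dec k" "{..N}"]) rule
  also have "\<dots> = (\<Sum>(i1, i2)\<in>dec i. \<Sum>(j1, j2)\<in>dec j. \<Sum>(k1, k2)\<in>dec k. T i1 i2 j1 j2 k1 k2)"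
  proof (intro sum.cong refl, clarify, intro sum.cong refl, clarify, intro sum.cong refl, clarify)
    fix i1 i2 j1 j2 k1 k2
    assume *: "(i1, i2) \<in> dec i" "(j1, j2) \<in> dec j" "(k1, k2) \<in> dec k"
    show "(\<Sum>a\<le>N. \<Sum>c\<le>N. R 1 (st n a k1) * (L (a + k1) (m c k2) * R k2 (L a (b c k1))) *
      R k (R c (st a i1 j1) * (L (i1 + j1) (st c i2 j2) * R j2 (L i1 (b i2 j1))))) = T i1 i2 j1 j2 k1 k2"
      using * by (simp only: T_def in_dec st_assoc_left R_sum L_sum A_mult A_R A_L A_m A_st
          sum_distrib_left sum_distrib_right) (subst sum.swap, simp)
  qed
  finally have left: "(\<Sum>r\<le>N. st (Suc n) r k * R k (st r i j)) = \<dots>" .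
  have "(\<Sum>l\<le>N. st (Suc n) i l * L i (st l j k))
      = (\<Sum>r\<le>N. \<Sum>(a, c)\<in>dec r. (\<Sum>(i1, i2)\<in>dec i.
          R 1 (st n i1 a) * (L (i1 + a) (m i2 c) * R c (L i1 (b i2 a)))) * L i (st r j k))"
    unfolding st.simps dsum_def case_prod_beta' sum_distrib_right
    by (rule sum.cong[OF refl], subst sum.swap) rule
  also have "\<dots> = dsum j k (\<lambda>j1 k1 j2 k2. \<Sum>a\<le>N. \<Sum>c\<le>N. (\<Sum>(i1, i2)\<in>dec i.
          R 1 (st n i1 a) * (L (i1 + a) (m i2 c) * R c (L i1 (b i2 a)))) *
      L i (R c (st a j1 k1) * (L (j1 + k1) (st c j2 k2) * R k2 (L j1 (b j2 k1)))))"
    by (rule sum_st_add) (use Suc.prems L_dsum in auto)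
  also have "\<dots> = (\<Sum>(j1, j2)\<in>dec j. \<Sum>(k1, k2)\<in>dec k. \<Sum>(i1, i2)\<in>dec i. \<Sum>a\<le>N. \<Sum>c\<le>N.
      R 1 (st n i1 a) * (L (i1 + a) (m i2 c) * R c (L i1 (b i2 a))) *
      L i (R c (st a j1 k1) * (L (j1 + k1) (st c j2 k2) * R k2 (L j1 (b j2 k1)))))"
    unfolding dsum_def case_prod_beta' sum_distrib_right
    by (intro sum.cong[OF refl], subst sum.swap[of _ "{..N}" "dec i"] , subst sum.swap[of _ "dec i" "{..N}"]) rule
  also have "\<dots> = (\<Sum>(i1, i2)\<in>dec i. \<Sum>(j1, j2)\<in>dec j. \<Sum>(k1, k2)\<in>dec k. \<Sum>a\<le>N. \<Sum>c\<le>N.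
      R 1 (st n i1 a) * (L (i1 + a) (m i2 c) * R c (L i1 (b i2 a))) *
      L i (R c (st a j1 k1) * (L (j1 + k1) (st c j2 k2) * R k2 (L j1 (b j2 k1)))))"
    unfolding case_prod_beta'
    by (subst (2) sum.swap, subst sum.swap) rule
  also have "\<dots> = (\<Sum>(i1, i2)\<in>dec i. \<Sum>(j1, j2)\<in>dec j. \<Sum>(k1, k2)\<in>dec k. T i1 i2 j1 j2 k1 k2)"
  proof (intro sum.cong refl, clarify, intro sum.cong refl, clarify, intro sum.cong refl, clarify)
    fix i1 i2 j1 j2 k1 k2
    assume *: "(i1, i2) \<in> dec i" "(j1, j2) \<in> dec j" "(k1, k2) \<in> dec k"
    \<comment> \<open>The induction hypothesis, the bracket condition and the shuffle identity
      replace the three factors of \<open>T\<close> by their counterparts for the right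
      bracketing.\<close>
    have "T i1 i2 j1 j2 k1 k2 = R 1 (\<Sum>a\<le>N. st n i1 a * L i1 (st a j1 k1)) *
     (L (i1 + j1 + k1) (\<Sum>c\<le>N. m i2 c * L i2 (st c j2 k2)) *
      (R (j2 + k2) (L i1 (b i2 (j1 + k1))) * L i (R k2 (L j1 (b j2 k1)))))"
      using * Suc.prems Suc.IH[of i1 j1 k1] m_assoc_all[of i2 j2 k2 N] st_assoc_shuffle[of i1 i2 i j1 j2 j k1 k2 k]
      unfolding T_def by simp
    moreover have "(\<Sum>a\<le>N. \<Sum>c\<le>N. R 1 (st n i1 a) * (L (i1 + a) (m i2 c) * R c (L i1 (b i2 a))) *
      L i (R c (st a j1 k1) * (L (j1 + k1) (st c j2 k2) * R k2 (L j1 (b j2 k1)))))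
      = R 1 (\<Sum>a\<le>N. st n i1 a * L i1 (st a j1 k1)) *
     (L (i1 + j1 + k1) (\<Sum>c\<le>N. m i2 c * L i2 (st c j2 k2)) *
      (R (j2 + k2) (L i1 (b i2 (j1 + k1))) * L i (R k2 (L j1 (b j2 k1)))))"
      using * by (simp only: in_dec st_assoc_right R_sum L_sum A_mult A_R A_L A_m A_st
          sum_distrib_left sum_distrib_right) (subst sum.swap, simp)
    ultimately show "(\<Sum>a\<le>N. \<Sum>c\<le>N. R 1 (st n i1 a) * (L (i1 + a) (m i2 c) * R c (L i1 (b i2 a))) *
      L i (R c (st a j1 k1) * (L (j1 + k1) (st c j2 k2) * R k2 (L j1 (b j2 k1))))) = T i1 i2 j1 j2 k1 k2"
      by simp
  qed
  finally show ?case using left by simp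
qed

end

section \<open>Reduced words\<close>

definition inversions :: "nat \<Rightarrow> (nat \<Rightarrow> nat) \<Rightarrow> (nat \<times> nat) set" where
  "inversions n w = {(a, b). 1 \<le> a \<and> a < b \<and> b \<le> n \<and> w b < w a}"

lemma finite_inversions [simp]: "finite (inversions n w)"
  by (rule finite_subset[of _ "{..n} \<times> {..n}"]) (auto simp: inversions_def)

lemma permutes_transpose_comp:
  assumes "w permutes {1..n}" "j \<in> {1..<n}"
  shows "transpose j (Suc j) \<circ> w permutes {1..n}"
  using assms by (intro permutes_compose permutes_swap_id) auto

lemma transpose_comp_transpose: "transpose j (Suc j) \<circ> (transpose j (Suc j) \<circ> w) = w"
  by (simp add: fun_eq_iff)

lemma inv_transpose_comp:
  assumes "w permutes {1..n}"
  shows "inv (transpose j (Suc j) \<circ> w) x = inv w (transpose j (Suc j) x)"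
proof -
  have "inv (transpose j (Suc j) \<circ> w) = inv w \<circ> inv (transpose j (Suc j))"
    using assms by (intro o_inv_distrib) (auto simp: permutes_bij)
  then show ?thesis by simp
qed

text \<open>Composing with the transposition on the left exchanges the values j and j + 1. Only the
  pair of positions carrying these values changes its status, and for an ascent it becomes an
  inversion.\<close>

lemma card_inversions_ascent:
  assumes w: "w permutes {1..n}" and j: "j \<in> {1..<n}" and asc: "inv w j < inv w (Suc j)"
  shows "card (inversions n (transpose j (Suc j) \<circ> w)) = Suc (card (inversions n w))"
proof -
  define p q where "p = inv w j" and "q = inv w (Suc j)"
  have pq: "w p = j" "w q = Suc j"
    unfolding p_def q_def using permutes_inverses(1)[OF w] by auto
  have in1: "p \<in> {1..n}" "q \<in> {1..n}"
    unfolding p_def q_def using permutes_in_image[OF permutes_inv[OF w]] j by auto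
  have inj: "w x = w y \<longleftrightarrow> x = y" for x y
    using permutes_inj[OF w] by (auto dest: injD)
  have x: "w x = j \<longleftrightarrow> x = p" "w x = Suc j \<longleftrightarrow> x = q" for x
    using inj[of x p] inj[of x q] pq by auto
  have "p < q" using asc by (simp add: p_def q_def)
  have "inversions n (transpose j (Suc j) \<circ> w) = insert (p, q) (inversions n w)"
  proof (intro equalityI subsetI; clarify)
    fix a b assume "(a, b) \<in> inversions n (transpose j (Suc j) \<circ> w)" "(a, b) \<notin> inversions n w"
    then show "a = p \<and> b = q"
      using x[of a] x[of b] \<open>p < q\<close>
      by (auto simp: inversions_def transpose_def split: if_splits)
  next
    fix a b assume *: "(a, b) \<in> insert (p, q) (inversions n w)"
    show "(a, b) \<in> inversions n (transpose j (Suc j) \<circ> w)"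
    proof (cases "(a, b) = (p, q)")
      case True
      then show ?thesis using \<open>p < q\<close> pq in1 by (auto simp: inversions_def)
    next
      case False
      then have "1 \<le> a" "a < b" "b \<le> n" "w b < w a" using * by (auto simp: inversions_def)
      moreover from this have "\<not> (w b = j \<and> w a = Suc j)"
        using x[of a] x[of b] \<open>p < q\<close> by auto
      ultimately show ?thesis
        by (auto simp: inversions_def transpose_def)
    qed
  qed
  moreover have "(p, q) \<notin> inversions n w" using pq by (auto simp: inversions_def)
  ultimately show ?thesis by simp
qed

lemma card_inversions_descent:
  assumes w: "w permutes {1..n}" and j: "j \<in> {1..<n}" and desc: "inv w (Suc j) < inv w j"
  shows "card (inversions n w) = Suc (card (inversions n (transpose j (Suc j) \<circ> w)))"
  using card_inversions_ascent[OF permutes_transpose_comp[OF w j] j] desc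
  by (simp add: inv_transpose_comp[OF w] transpose_comp_transpose del: o_apply)

lemma card_inversions_cases:
  assumes w: "w permutes {1..n}" and j: "j \<in> {1..<n}"
  obtains "inv w j < inv w (Suc j)"
      "card (inversions n (transpose j (Suc j) \<circ> w)) = Suc (card (inversions n w))"
    | "inv w (Suc j) < inv w j"
      "card (inversions n w) = Suc (card (inversions n (transpose j (Suc j) \<circ> w)))"
proof -
  have "inv w j \<noteq> inv w (Suc j)"
    using permutes_inj[OF permutes_inv[OF w]] by (simp add: inj_eq)
  then show thesis
    using card_inversions_ascent[OF w j] card_inversions_descent[OF w j] that by linarith
qed

section \<open>Words in adjacent transpositions and their inversions\<close>

lemma word_perm_simps [simp]:
  "word_perm [] = id" "word_perm (j # js) = transpose j (Suc j) \<circ> word_perm js"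
  by (simp_all add: word_perm_def)

lemma word_perm_append: "word_perm (js @ ks) = word_perm js \<circ> word_perm ks"
  by (induction js) (simp_all add: comp_assoc)

lemma word_perm_permutes: "set js \<subseteq> {1..<n} \<Longrightarrow> word_perm js permutes {1..n}"
proof (induction js)
  case (Cons j js)
  then show ?case unfolding word_perm_simps by (intro permutes_transpose_comp) auto
qed (simp add: permutes_id)

lemma inversions_id: "inversions n id = {}"
  by (auto simp: inversions_def)

lemma card_inversions_le_length:
  "set js \<subseteq> {1..<n} \<Longrightarrow> card (inversions n (word_perm js)) \<le> length js"
proof (induction js)
  case Nil
  then show ?case by (simp only: word_perm_simps inversions_id card.empty)
next
  case (Cons j js)
  have p: "word_perm js permutes {1..n}" "j \<in> {1..<n}"
    using Cons.prems word_perm_permutes[of js n] by auto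
  show ?case
    by (rule card_inversions_cases[OF p]) (use Cons in \<open>simp_all del: o_apply\<close>)
qed

text \<open>Going up from 1 gives x \<le> f x, going down from n gives the converse. It is applied
  to the inverse of a permutation without descents.\<close>

lemma ascending_permutes_id:
  assumes f: "f permutes {1..n}" and asc: "\<And>j. j \<in> {1..<n} \<Longrightarrow> f j < f (Suc j)"
  shows "f = id"
proof
  fix x
  have ge: "x \<le> f x" if "1 \<le> x" "x \<le> n" for x
    using that
  proof (induction x)
    case (Suc x)
    show ?case
    proof (cases "x = 0")
      case True
      then show ?thesis using permutes_in_image[OF f, of 1] Suc.prems by auto
    next
      case False
      then show ?thesis using Suc asc[of x] by auto
    qed
  qed simp
  have le: "f x \<le> x" if "1 \<le> x" "x \<le> n" for x
    using that(2,1)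
  proof (induction x rule: inc_induct)
    case base
    then show ?case using permutes_in_image[OF f, of n] by auto
  next
    case (step x)
    then show ?case using asc[of x] by auto
  qed
  show "f x = id x"
  proof (cases "x \<in> {1..n}")
    case True
    then show ?thesis using ge[of x] le[of x] by auto
  next
    case False
    then show ?thesis using permutes_not_in[OF f] by simp
  qed
qed

text \<open>Length is compared with the number of inversions, not minimised over all words as in
  \<open>reduced_word\<close>; this form passes easily to the tail of a word. For \<open>chi\<close>
  the two notions are reconciled separately.\<close>

definition reduced :: "nat \<Rightarrow> nat list \<Rightarrow> bool" where
  "reduced n js \<longleftrightarrow> set js \<subseteq> {1..<n} \<and> length js = card (inversions n (word_perm js))"

text \<open>A descent can be split off, which lowers the number of inversions by one; a permutation
  without descents is the identity.\<close>

lemma ex_reduced: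
  assumes "w permutes {1..n}"
  shows "\<exists>js. reduced n js \<and> word_perm js = w"
  using assms
proof (induction "card (inversions n w)" arbitrary: w rule: less_induct)
  case less
  show ?case
  proof (cases "\<exists>j\<in>{1..<n}. inv w (Suc j) < inv w j")
    case True
    then obtain j where j: "j \<in> {1..<n}" "inv w (Suc j) < inv w j" by blast
    note c = card_inversions_descent[OF less.prems j]
    obtain js where js: "reduced n js" "word_perm js = transpose j (Suc j) \<circ> w"
      using less.hyps[of "transpose j (Suc j) \<circ> w"] c permutes_transpose_comp[OF less.prems j(1)] by auto
    have "word_perm (j # js) = w" by (simp only: word_perm_simps js transpose_comp_transpose)
    moreover from this have "reduced n (j # js)"
      using js j(1) c by (auto simp: reduced_def)
    ultimately show ?thesis by blast
  next
    case False
    have "inv w j < inv w (Suc j)" if "j \<in> {1..<n}" for j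
      using False that by (metis card_inversions_cases[OF less.prems that])
    then have "inv w = id"
      by (rule ascending_permutes_id[OF permutes_inv[OF less.prems]])
    then have "w = id" using inv_inv_eq[OF permutes_bij[OF less.prems]] by (metis inv_id)
    then show ?thesis by (intro exI[of _ "[]"]) (simp only: reduced_def inversions_id word_perm_simps, simp)
  qed
qed

text \<open>A letter adds at most one inversion, so equality of length and inversion number for the
  whole word forces it for the tail and makes the first letter a descent.\<close>

lemma reduced_Cons:
  assumes "reduced n (j # js)"
  shows "reduced n js" "j \<in> {1..<n}" "inv (word_perm (j # js)) (Suc j) < inv (word_perm (j # js)) j"
proof -
  have js: "set js \<subseteq> {1..<n}" and j: "j \<in> {1..<n}"
    and l: "Suc (length js) = card (inversions n (word_perm (j # js)))"
    using assms by (auto simp: reduced_def)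
  note p = word_perm_permutes[OF js]
  have le: "card (inversions n (word_perm js)) \<le> length js"
    by (rule card_inversions_le_length[OF js])
  show "j \<in> {1..<n}" by fact
  show "reduced n js"
    by (rule card_inversions_cases[OF p j]) (use l le js in \<open>simp_all add: reduced_def del: o_apply\<close>)
  show "inv (word_perm (j # js)) (Suc j) < inv (word_perm (j # js)) j"
    unfolding word_perm_simps inv_transpose_comp[OF p]
    by (rule card_inversions_cases[OF p j]) (use l le js in \<open>simp_all add: reduced_def del: o_apply\<close>)
qed

lemma reduced_ConsI:
  assumes "w permutes {1..n}" "j \<in> {1..<n}" "inv w (Suc j) < inv w j"
    and "reduced n js" "word_perm js = transpose j (Suc j) \<circ> w"
  shows "reduced n (j # js) \<and> word_perm (j # js) = w"
proof -
  have "word_perm (j # js) = w" by (simp only: word_perm_simps assms(5) transpose_comp_transpose)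
  then show ?thesis
    using assms card_inversions_descent[OF assms(1-3)] by (auto simp: reduced_def)
qed

text \<open>A semigroup has no empty product, so \<open>u\<close> stands at the end of every
  product. It will be \<open>e n\<close>, the identity of the degree in question.\<close>

definition word_prod :: "(nat \<Rightarrow> 'a::semigroup_mult) \<Rightarrow> 'a \<Rightarrow> nat list \<Rightarrow> 'a" where
  "word_prod f u js = foldr (\<lambda>j x. f j * x) js u"

lemma word_prod_simps [simp]:
  "word_prod f u [] = u" "word_prod f u (j # js) = f j * word_prod f u js"
  by (simp_all add: word_prod_def)

context
  fixes n :: nat and f :: "nat \<Rightarrow> 'a::semigroup_mult" and u :: 'a
  assumes far: "\<And>j k. 1 \<le> j \<Longrightarrow> j + 2 \<le> k \<Longrightarrow> k < n \<Longrightarrow> f j * f k = f k * f j"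
    and near: "\<And>j. 1 \<le> j \<Longrightarrow> j + 1 < n \<Longrightarrow> f j * f (j + 1) * f j = f (j + 1) * f j * f (j + 1)"
begin

text \<open>
  Two letters \<open>j < k\<close> that both start a reduced word of \<open>w\<close> also start reduced words of \<open>w\<close> that differ by a
  single braid move; the induction hypothesis connects these to the given ones.
\<close>

lemma word_prod_eq_less:
  assumes IH: "\<And>ls ms. length ls < Suc l \<Longrightarrow> reduced n ls \<Longrightarrow> reduced n ms \<Longrightarrow>
      word_perm ls = word_perm ms \<Longrightarrow> word_prod f u ls = word_prod f u ms"
    and js: "reduced n (j # js)" and ks: "reduced n (k # ks)"
    and eq: "word_perm (j # js) = word_perm (k # ks)"
    and len: "length js = l" and jk: "j < k"
  shows "word_prod f u (j # js) = word_prod f u (k # ks)"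
proof -
  define w where "w = word_perm (j # js)"
  have w: "w permutes {1..n}" unfolding w_def using js by (intro word_perm_permutes) (auto simp: reduced_def)
  have j: "j \<in> {1..<n}" "inv w (Suc j) < inv w j" and k: "k \<in> {1..<n}" "inv w (Suc k) < inv w k"
    using reduced_Cons[OF js] reduced_Cons[OF ks] eq by (simp_all add: w_def)
  have len': "length ks = l"
    using js ks len eq by (simp add: reduced_def)
  have js': "word_perm js = transpose j (Suc j) \<circ> w" and ks': "word_perm ks = transpose k (Suc k) \<circ> w"
    unfolding w_def using eq transpose_comp_transpose[of j "word_perm js"]
      transpose_comp_transpose[of k "word_perm ks"] by (simp_all only: word_perm_simps)
  let ?wj = "transpose j (Suc j) \<circ> w" and ?wk = "transpose k (Suc k) \<circ> w"
  note wj = permutes_transpose_comp[OF w j(1)] and wk = permutes_transpose_comp[OF w k(1)]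
  show ?thesis
  proof (cases "k = Suc j")
    case False
    \<comment> \<open>Both commuting letters can be removed from w. A word for the remainder extends
      to words of w beginning with either letter.\<close>
    let ?v = "transpose k (Suc k) \<circ> ?wj"
    have v: "?v = transpose j (Suc j) \<circ> ?wk"
      using False jk by (auto simp: fun_eq_iff transpose_def)
    obtain ls where ls: "reduced n ls" "word_perm ls = ?v"
      using ex_reduced[OF permutes_transpose_comp[OF wj k(1)]] by blast
    have 1: "reduced n (k # ls) \<and> word_perm (k # ls) = ?wj"
      by (rule reduced_ConsI[OF wj k(1) _ ls])
        (use k(2) jk False in \<open>simp add: inv_transpose_comp[OF w] transpose_def del: o_apply\<close>)
    have 2: "reduced n (j # ls) \<and> word_perm (j # ls) = ?wk"
      by (rule reduced_ConsI[OF wk j(1) _ ls(1)])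
        (use j(2) jk False ls(2) v in \<open>simp_all add: inv_transpose_comp[OF w] transpose_def del: o_apply\<close>)
    have "word_prod f u js = f k * word_prod f u ls"
      using IH[of js "k # ls"] reduced_Cons(1)[OF js] 1 js' len by simp
    moreover have "word_prod f u ks = f j * word_prod f u ls"
      using IH[of ks "j # ls"] reduced_Cons(1)[OF ks] 2 ks' len' by simp
    moreover have "f j * f k = f k * f j"
      using far[of j k] jk False j k by auto
    ultimately show ?thesis by (simp add: mult.assoc[symmetric])
  next
    case True
    have k1: "Suc j \<in> {1..<n}" using k True by simp
    let ?wkj = "transpose (Suc j) (Suc (Suc j)) \<circ> ?wj" and ?wjk = "transpose j (Suc j) \<circ> ?wk"
    \<comment> \<open>What remains of w after removing j, then j + 1, then j; by the braid relation
      of the transpositions also what remains after j + 1, j, j + 1.\<close>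
    let ?v = "transpose j (Suc j) \<circ> ?wkj"
    note wkj = permutes_transpose_comp[OF wj k1] and wjk = permutes_transpose_comp[OF wk j(1)]
    have v: "?v = transpose k (Suc k) \<circ> ?wjk"
      using True by (auto simp: fun_eq_iff transpose_def)
    obtain ls where ls: "reduced n ls" "word_perm ls = ?v"
      using ex_reduced[OF permutes_transpose_comp[OF wkj j(1)]] by blast
    \<comment> \<open>The positions of the values j, j + 1, j + 2 in w are decreasing, so each of
      the three removals, in either order, is a descent.\<close>
    have d: "inv w (Suc j) < inv w j" "inv w (Suc (Suc j)) < inv w (Suc j)"
      using j k True by auto
    have 1: "reduced n (j # ls) \<and> word_perm (j # ls) = ?wkj"
      by (rule reduced_ConsI[OF wkj j(1) _ ls])
        (use d in \<open>simp add: inv_transpose_comp[OF w] inv_transpose_comp[OF wj] transpose_def del: o_apply\<close>)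
    have 2: "reduced n (k # j # ls) \<and> word_perm (k # j # ls) = ?wj"
      unfolding True
      by (rule reduced_ConsI[OF wj k1 _ 1[THEN conjunct1] 1[THEN conjunct2]])
        (use d in \<open>simp add: inv_transpose_comp[OF w] transpose_def del: o_apply\<close>)
    have 3: "reduced n (k # ls) \<and> word_perm (k # ls) = ?wjk"
      by (rule reduced_ConsI[OF wjk k(1) _ ls(1)])
        (use d True ls(2) v in \<open>simp_all add: inv_transpose_comp[OF w] inv_transpose_comp[OF wk[unfolded True]] transpose_def del: o_apply\<close>)
    have 4: "reduced n (j # k # ls) \<and> word_perm (j # k # ls) = ?wk"
      by (rule reduced_ConsI[OF wk j(1) _ 3[THEN conjunct1] 3[THEN conjunct2]])
        (use d True in \<open>simp add: inv_transpose_comp[OF w] transpose_def del: o_apply\<close>)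
    have "word_prod f u js = f k * (f j * word_prod f u ls)"
      using IH[of js "k # j # ls"] reduced_Cons(1)[OF js] 2 js' len by simp
    moreover have "word_prod f u ks = f j * (f k * word_prod f u ls)"
      using IH[of ks "j # k # ls"] reduced_Cons(1)[OF ks] 4 ks' len' by simp
    moreover have "f j * f k * f j = f k * f j * f k"
      using near[of j] True j k by auto
    ultimately show ?thesis by (simp add: mult.assoc[symmetric])
  qed
qed

text \<open>Words with equal first letters are compared through their tails, and different first
  letters lead to a single braid move. This is Matsumoto's theorem for operators that satisfy only
  the braid relations.\<close>

theorem word_prod_reduced_eq:
  assumes "reduced n js" "reduced n ks" "word_perm js = word_perm ks"
  shows "word_prod f u js = word_prod f u ks"
  using assms
proof (induction "length js" arbitrary: js ks rule: less_induct)
  case less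
  have len: "length js = length ks" using less.prems by (simp add: reduced_def)
  show ?case
  proof (cases js)
    case Nil
    then show ?thesis using len by simp
  next
    case (Cons j js')
    with len obtain k ks' where ks: "ks = k # ks'" by (cases ks) auto
    have IH: "word_prod f u ls = word_prod f u ms"
      if "length ls < Suc (length js')" "reduced n ls" "reduced n ms" "word_perm ls = word_perm ms" for ls ms
      using less.hyps[of ls ms] that Cons by simp
    consider "j = k" | "j < k" | "k < j" by linarith
    then show ?thesis
    proof cases
      case 1
      have "word_perm js' = word_perm ks'"
        using less.prems(3) transpose_comp_transpose[of k "word_perm js'"]
          transpose_comp_transpose[of k "word_perm ks'"]
        unfolding Cons ks 1 word_perm_simps by metis
      then show ?thesis
        using IH[of js' ks'] less.prems reduced_Cons(1)[of n j js'] reduced_Cons(1)[of n k ks'] 1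
        by (simp add: Cons ks)
    next
      case 2
      show ?thesis
        unfolding Cons ks
        by (rule word_prod_eq_less[OF IH]) (use less.prems Cons ks 2 in simp_all)
    next
      case 3
      have "length ks' = length js'" using len Cons ks by simp
      then show ?thesis
        unfolding Cons ks
        by (intro word_prod_eq_less[OF IH, symmetric]) (use less.prems Cons ks 3 in simp_all)
    qed
  qed
qed

end

text \<open>Spelled along the recursion of \<open>b\<close>: the block j + 1, ..., j + i is the word
  of \<open>L j (b1 i)\<close>.\<close>

primrec chi_word :: "nat \<Rightarrow> nat \<Rightarrow> nat list" where
  "chi_word i 0 = []"
| "chi_word i (Suc j) = map (\<lambda>x. j + x) [1..<Suc i] @ chi_word i j"

lemma length_chi_word: "length (chi_word i j) = i * j"
  by (induction j) simp_all

lemma set_chi_word: "set (chi_word i j) \<subseteq> {1..<i + j}"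
  by (induction j) auto

lemma word_perm_cycle:
  "word_perm (map (\<lambda>x. j + x) [1..<Suc i]) k =
    (if j < k \<and> k \<le> j + i then k + 1 else if k = j + i + 1 then j + 1 else k)"
proof (induction i arbitrary: k)
  case (Suc i)
  have "word_perm (map (\<lambda>x. j + x) [1..<Suc (Suc i)]) k
     = word_perm (map (\<lambda>x. j + x) [1..<Suc i]) (transpose (j + Suc i) (Suc (j + Suc i)) k)"
  proof -
    have "[1..<Suc (Suc i)] = [1..<Suc i] @ [Suc i]" by simp
    then show ?thesis by (simp only: map_append word_perm_append) simp
  qed
  also have "\<dots> = (if j < k \<and> k \<le> j + Suc i then k + 1 else if k = j + Suc i + 1 then j + 1 else k)"
    unfolding Suc.IH by (auto simp: transpose_def)
  finally show ?case .
qed simp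

lemma word_perm_chi_word: "word_perm (chi_word i j) = chi i j"
proof (induction j)
  case 0
  show ?case by (auto simp: chi_def fun_eq_iff)
next
  case (Suc j)
  show ?case
    unfolding chi_word.simps word_perm_append Suc o_def word_perm_cycle
    by (auto simp: fun_eq_iff chi_def)
qed

text \<open>The length of \<open>chi_word\<close> gives the upper bound. For the lower bound, every
  pair of positions with one in each block is inverted.\<close>

lemma card_inversions_chi: "card (inversions (i + j) (chi i j)) = i * j"
proof (rule antisym)
  show "card (inversions (i + j) (chi i j)) \<le> i * j"
    using card_inversions_le_length[OF set_chi_word[of i j]]
    by (simp add: word_perm_chi_word length_chi_word)
  have "{1..i} \<times> {i + 1..i + j} \<subseteq> inversions (i + j) (chi i j)"
    by (auto simp: inversions_def chi_def)
  from card_mono[OF finite_inversions this] show "i * j \<le> card (inversions (i + j) (chi i j))"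
    by (simp add: card_cartesian_product)
qed

lemma reduced_chi_word: "reduced (i + j) (chi_word i j)"
  using set_chi_word by (simp add: reduced_def word_perm_chi_word card_inversions_chi length_chi_word)

text \<open>\<open>T_perm\<close> chooses some shortest word. Since \<open>chi_word\<close> attains
  the inversion number, every shortest word does, so Matsumoto's theorem applies to the chosen
  one.\<close>

lemma reduced_word_chi_some:
  fixes i j :: nat
  defines "js \<equiv> (SOME js. reduced_word (i + j) (chi i j) js)"
  shows "reduced (i + j) js" "word_perm js = chi i j"
proof -
  have le: "i * j \<le> length ks" if "set ks \<subseteq> {1..<i + j}" "word_perm ks = chi i j" for ks
    using card_inversions_le_length[OF that(1)] by (simp add: that(2) card_inversions_chi)
  then have "reduced_word (i + j) (chi i j) (chi_word i j)"
    using set_chi_word[of i j] unfolding reduced_word_def word_perm_chi_word length_chi_word by blast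
  then have js: "reduced_word (i + j) (chi i j) js"
    unfolding js_def by (rule someI)
  then show "word_perm js = chi i j" by (simp add: reduced_word_def)
  have "length js \<le> i * j"
    using js set_chi_word[of i j] word_perm_chi_word[of i j]
    unfolding reduced_word_def by (metis length_chi_word)
  moreover have "i * j \<le> length js"
    using card_inversions_le_length[of js "i + j"] js
    by (simp add: reduced_word_def card_inversions_chi)
  ultimately show "reduced (i + j) js"
    using js by (simp add: reduced_def reduced_word_def card_inversions_chi)
qed

context strict_braided
begin

definition sig :: "nat \<Rightarrow> nat \<Rightarrow> 'a" where
  "sig n j = R (n - j - 1) (L (j - 1) S)"

lemma hom_sig: "j \<in> {1..<n} \<Longrightarrow> hom n n (sig n j)"
  unfolding sig_def by (rule hom_cast[OF hom_R[OF hom_L[OF hom_S]]]) auto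

lemma A_sig [simp]: "A (sig n j)" by (simp add: sig_def)

lemma L_sig: "j \<in> {1..<n} \<Longrightarrow> L a (sig n j) = sig (a + n) (a + j)"
  by (simp add: sig_def)

lemma R_sig: "j \<in> {1..<n} \<Longrightarrow> R a (sig n j) = sig (n + a) j"
  by (simp add: sig_def add.commute)

text \<open>An instance of interchange, with q = k - j - 2 strands between the two
  crossings.\<close>

lemma sig_far:
  assumes "1 \<le> j" "j + 2 \<le> k" "k < n"
  shows "sig n j * sig n k = sig n k * sig n j"
proof -
  define p q r where "p = j - 1" and "q = k - j - 2" and "r = n - k - 1"
  have jk: "j = p + 1" "k = p + q + 3" "n = p + q + r + 4"
    using assms by (auto simp: p_def q_def r_def)
  have "R (2 + q) S * L (2 + q) S = L (2 + q) S * R (2 + q) S"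
    using slide[OF hom_S hom_L[OF hom_S, of q]] by (simp add: ac_simps)
  from arg_cong[OF this, of "\<lambda>x. R r (L p x)"] show ?thesis
    by (simp add: sig_def jk ac_simps)
qed

lemma sig_near:
  assumes "1 \<le> j" "j + 1 < n"
  shows "sig n j * sig n (j + 1) * sig n j = sig n (j + 1) * sig n j * sig n (j + 1)"
proof -
  define p r where "p = j - 1" and "r = n - j - 2"
  have jk: "j = p + 1" "n = p + r + 3"
    using assms by (auto simp: p_def r_def)
  from arg_cong[OF braid, of "\<lambda>x. R r (L p x)"] show ?thesis
    by (simp add: sig_def jk ac_simps)
qed

lemma A_word_prod [simp]: "A (word_prod (sig n) (e n) js)"
  by (induction js) auto

lemma word_prod_append_sig:
  "set ks \<subseteq> {1..<n} \<Longrightarrow> word_prod (sig n) (e n) (js @ ks)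
    = word_prod (sig n) (e n) js * word_prod (sig n) (e n) ks"
proof (induction js)
  case Nil
  then show ?case by (cases ks) (auto simp: hom_left[OF hom_sig] mult.assoc[symmetric])
qed (simp add: mult.assoc)

lemma L_word_prod: "set js \<subseteq> {1..<n} \<Longrightarrow>
    L a (word_prod (sig n) (e n) js) = word_prod (sig (a + n)) (e (a + n)) (map (\<lambda>x. a + x) js)"
  by (induction js) (simp_all add: L_sig)

lemma R_word_prod: "set js \<subseteq> {1..<n} \<Longrightarrow>
    R a (word_prod (sig n) (e n) js) = word_prod (sig (n + a)) (e (n + a)) js"
  by (induction js) (simp_all add: R_sig)

lemma b1_word: "b1 i = word_prod (sig (i + 1)) (e (i + 1)) [1..<Suc i]"
proof (induction i)
  case (Suc i)
  have "[1..<Suc (Suc i)] = 1 # map (\<lambda>x. 1 + x) [1..<Suc i]"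
    by (simp add: map_Suc_upt upt_conv_Cons)
  moreover have "L 1 (b1 i) = word_prod (sig (1 + (i + 1))) (e (1 + (i + 1))) (map (\<lambda>x. 1 + x) [1..<Suc i])"
    unfolding Suc by (rule L_word_prod) auto
  moreover have "sig (i + 2) 1 = R i S" by (simp add: sig_def)
  ultimately show ?case by (simp del: upt_Suc)
qed simp

lemma b_word: "b i j = word_prod (sig (i + j)) (e (i + j)) (chi_word i j)"
proof (induction j)
  case (Suc j)
  have 1: "L j (b1 i) = word_prod (sig (j + (i + 1))) (e (j + (i + 1))) (map (\<lambda>x. j + x) [1..<Suc i])"
    unfolding b1_word by (rule L_word_prod) auto
  have 2: "R 1 (b i j) = word_prod (sig (i + j + 1)) (e (i + j + 1)) (chi_word i j)"
    unfolding Suc by (rule R_word_prod) (rule set_chi_word)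
  have "set (chi_word i j) \<subseteq> {1..<i + Suc j}" using set_chi_word[of i j] by auto
  from word_prod_append_sig[OF this] show ?case
    using 1 2 by (simp add: ac_simps del: upt_Suc)
qed simp

theorem word_prod_chi:
  assumes "reduced (i + j) js" "word_perm js = chi i j"
  shows "word_prod (sig (i + j)) (e (i + j)) js = b i j"
  unfolding b_word
  by (rule word_prod_reduced_eq)
    (use assms reduced_chi_word word_perm_chi_word sig_far sig_near in auto)

end

section \<open>Multilinear maps and tensors\<close>

text \<open>Otherwise the simplifier expands sums of tensors, which are functions, pointwise.\<close>

declare plus_fun_apply [simp del] zero_fun_apply [simp del]

abbreviation flinear where
  "flinear A B f \<equiv> linear_on fscale A fscale B f"

lemma linear_onI:
  assumes "\<And>x. x \<in> A \<Longrightarrow> f x \<in> B" "\<And>x y. x \<in> A \<Longrightarrow> y \<in> A \<Longrightarrow> f (x + y) = f x + f y"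
    "\<And>c x. x \<in> A \<Longrightarrow> f (s c x) = w c (f x)"
  shows "linear_on s A w B f"
  using assms by (simp add: linear_on_def)

lemma linear_on_in: "linear_on s A w B f \<Longrightarrow> x \<in> A \<Longrightarrow> f x \<in> B"
  and linear_on_add: "linear_on s A w B f \<Longrightarrow> x \<in> A \<Longrightarrow> y \<in> A \<Longrightarrow> f (x + y) = f x + f y"
  and linear_on_scale: "linear_on s A w B f \<Longrightarrow> x \<in> A \<Longrightarrow> f (s c x) = w c (f x)"
  by (simp_all add: linear_on_def)

lemma linear_on_compose:
  "linear_on s A w B f \<Longrightarrow> linear_on w B u D g \<Longrightarrow> linear_on s A u D (\<lambda>x. g (f x))"
  by (simp add: linear_on_def)

lemma linear_on_compose':
  "linear_on s A w B' f \<Longrightarrow> (\<And>x. x \<in> A \<Longrightarrow> f x \<in> B) \<Longrightarrow> linear_on w B u D g \<Longrightarrow>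
    linear_on s A u D (\<lambda>x. g (f x))"
  by (simp add: linear_on_def)

lemma linear_on_mono:
  "linear_on s A w B f \<Longrightarrow> A' \<subseteq> A \<Longrightarrow> (\<And>x. x \<in> A' \<Longrightarrow> f x \<in> B') \<Longrightarrow> linear_on s A' w B' f"
  unfolding linear_on_def by (meson subsetD)

lemma linear_on_id: "linear_on s A s A (\<lambda>x. x)"
  by (simp add: linear_on_def)

lemma linear_on_linear: "Vector_Spaces.linear s w f \<Longrightarrow> linear_on s A w UNIV f"
  unfolding linear_on_def
  by (metis UNIV_I Vector_Spaces.linear.axioms(3) module_hom.add module_hom.scale
      Vector_Spaces.linear_iff)

lemma linear_on_sum:
  assumes "linear_on s A w B f" "\<And>x. x \<in> X \<Longrightarrow> g x \<in> A" "0 \<in> A" "f 0 = 0"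
    "\<And>x y. x \<in> A \<Longrightarrow> y \<in> A \<Longrightarrow> x + y \<in> A"
  shows "f (\<Sum>x\<in>X. g x) = (\<Sum>x\<in>X. f (g x))"
proof -
  have "f (\<Sum>x\<in>X. g x) = (\<Sum>x\<in>X. f (g x)) \<and> (\<Sum>x\<in>X. g x) \<in> A"
    using assms(2)
    by (induction X rule: infinite_finite_induct) (auto simp: assms linear_on_add[OF assms(1)])
  then show ?thesis ..
qed

lemma linear_on_span_eq:
  assumes V: "vector_space s"
    and f: "linear_on s (module.span s S) w B f" and g: "linear_on s (module.span s S) w B' g"
    and eq: "\<And>x. x \<in> S \<Longrightarrow> f x = g x" and x: "x \<in> module.span s S"
    and w: "vector_space w"
  shows "f x = g x"
proof -
  interpret vector_space s by (fact V)
  interpret W: vector_space w by (fact w)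
  have 0: "f 0 = 0" "g 0 = 0"
    using linear_on_scale[OF f, of 0 0] linear_on_scale[OF g, of 0 0] by (simp_all add: span_zero)
  have "x \<in> span S \<and> f x = g x"
    using x
  proof (induction rule: span_induct_alt)
    case base
    then show ?case by (simp add: 0 span_zero)
  next
    case (step c x y)
    then have *: "x \<in> span S" "s c x \<in> span S" "y \<in> span S" by (auto intro: span_base span_scale)
    then show ?case
      using step eq linear_on_add[OF f *(2,3)] linear_on_add[OF g *(2,3)]
        linear_on_scale[OF f *(1)] linear_on_scale[OF g *(1)]
      by (auto intro: span_add)
  qed
  then show ?thesis ..
qed

lemma linear_on_span_into:
  assumes V: "vector_space s" and w: "vector_space w"
    and f: "linear_on s (module.span s S) w B f"
    and U: "module.subspace w U" "\<And>x. x \<in> S \<Longrightarrow> f x \<in> U" and x: "x \<in> module.span s S"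
  shows "f x \<in> U"
proof -
  interpret vector_space s by (fact V)
  interpret W: vector_space w by (fact w)
  have f0: "f 0 = 0"
    using linear_on_scale[OF f, of 0 0] by (simp add: span_zero)
  have "x \<in> span S \<and> f x \<in> U"
    using x
  proof (induction rule: span_induct_alt)
    case base
    then show ?case using W.subspace_0[OF U(1)] by (simp add: f0 span_zero)
  next
    case (step c x y)
    then have *: "x \<in> span S" "s c x \<in> span S" "y \<in> span S" by (auto intro: span_base span_scale)
    then show ?case
      using step U linear_on_add[OF f *(2,3)] linear_on_scale[OF f *(1)]
      by (auto intro: span_add W.subspace_add W.subspace_scale)
  qed
  then show ?thesis ..
qed

text \<open>Instantiated twice: for V with carrier \<open>UNIV\<close>, and for T(V), a subspace of
  its type, as the base of a second tensor algebra.\<close>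

locale tensor_space = vector_space s for s :: "'k::field \<Rightarrow> 'a::ab_group_add \<Rightarrow> 'a" +
  fixes C :: "'a set"
  assumes subspace_C: "subspace C"
begin

abbreviation "P \<equiv> ptensor s C"
abbreviation "TC \<equiv> tensor_algebra s C"
abbreviation "Tn \<equiv> tensor_power s C"

sublocale F: vector_space "fscale :: 'k \<Rightarrow> ('a, 'k) tensor \<Rightarrow> ('a, 'k) tensor"
  by (rule vector_space_fscale)

lemma C_add: "a \<in> C \<Longrightarrow> b \<in> C \<Longrightarrow> a + b \<in> C" and C_scale: "a \<in> C \<Longrightarrow> s c a \<in> C" and C_0: "0 \<in> C"
  using subspace_C by (auto simp: subspace_add subspace_scale subspace_0)

lemma P_in_Tn: "xs \<in> lists C \<Longrightarrow> P xs \<in> Tn (length xs)"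
  unfolding tensor_power_def by (rule F.span_base) auto

lemma P_in_TC [simp]: "xs \<in> lists C \<Longrightarrow> P xs \<in> TC"
  unfolding tensor_algebra_def by (rule F.span_base) auto

lemma Tn_subset_TC: "Tn n \<subseteq> TC"
  unfolding tensor_power_def tensor_algebra_def by (rule F.span_mono) auto

lemma Tn_in_TC: "x \<in> Tn n \<Longrightarrow> x \<in> TC"
  using Tn_subset_TC by auto

lemma TC_add [simp]: "x \<in> TC \<Longrightarrow> y \<in> TC \<Longrightarrow> x + y \<in> TC"
  and TC_scale [simp]: "x \<in> TC \<Longrightarrow> fscale c x \<in> TC"
  and TC_0 [simp]: "0 \<in> TC"
  unfolding tensor_algebra_def by (auto intro: F.span_add F.span_scale F.span_zero)

lemma Tn_add [simp]: "x \<in> Tn n \<Longrightarrow> y \<in> Tn n \<Longrightarrow> x + y \<in> Tn n"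
  and Tn_scale [simp]: "x \<in> Tn n \<Longrightarrow> fscale c x \<in> Tn n"
  and Tn_0 [simp]: "0 \<in> Tn n"
  unfolding tensor_power_def by (auto intro: F.span_add F.span_scale F.span_zero)

lemma TC_sum: "(\<And>x. x \<in> X \<Longrightarrow> f x \<in> TC) \<Longrightarrow> (\<Sum>x\<in>X. f x) \<in> TC"
  unfolding tensor_algebra_def by (rule F.span_sum)

lemma Tn_sum: "(\<And>x. x \<in> X \<Longrightarrow> f x \<in> Tn n) \<Longrightarrow> (\<Sum>x\<in>X. f x) \<in> Tn n"
  unfolding tensor_power_def by (rule F.span_sum)

lemma subspace_TC: "F.subspace TC" and subspace_Tn: "F.subspace (Tn n)"
  unfolding tensor_algebra_def tensor_power_def by (rule F.subspace_span)+

lemma TC_eq: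
  assumes "linear_on fscale TC w B f" "linear_on fscale TC w B' g" "vector_space w"
    "\<And>xs. xs \<in> lists C \<Longrightarrow> f (P xs) = g (P xs)" "t \<in> TC"
  shows "f t = g t"
  by (rule linear_on_span_eq[OF vector_space_fscale assms(1,2)[unfolded tensor_algebra_def]
        _ assms(5)[unfolded tensor_algebra_def] assms(3)]) (use assms(4) in blast)

lemma Tn_eq:
  assumes "flinear (Tn n) B f" "flinear (Tn n) B' g"
    "\<And>xs. xs \<in> lists C \<Longrightarrow> length xs = n \<Longrightarrow> f (P xs) = g (P xs)" "t \<in> Tn n"
  shows "f t = g t"
  by (rule linear_on_span_eq[OF vector_space_fscale assms(1,2)[unfolded tensor_power_def]
        _ assms(4)[unfolded tensor_power_def] vector_space_fscale]) (use assms(3) in blast)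

lemma linear_on_into_Tn:
  assumes "flinear (Tn n) B f"
    "\<And>xs. xs \<in> lists C \<Longrightarrow> length xs = n \<Longrightarrow> f (P xs) \<in> U" "module.subspace fscale U" "t \<in> Tn n"
  shows "f t \<in> U"
  by (rule linear_on_span_into[OF vector_space_fscale vector_space_fscale assms(1)[unfolded tensor_power_def]
        assms(3) _ assms(4)[unfolded tensor_power_def]]) (use assms(2) in blast)

lemma linear_on_into_TC:
  assumes "flinear TC B f"
    "\<And>xs. xs \<in> lists C \<Longrightarrow> f (P xs) \<in> U" "module.subspace fscale U" "t \<in> TC"
  shows "f t \<in> U"
  by (rule linear_on_span_into[OF vector_space_fscale vector_space_fscale assms(1)[unfolded tensor_algebra_def]
        assms(3) _ assms(4)[unfolded tensor_algebra_def]]) (use assms(2) in blast)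

lemma multilinear_P: "multilinear s C fscale P"
  unfolding multilinear_def
proof (intro ballI conjI allI)
  fix xs ys a b c assume *: "xs \<in> lists C" "ys \<in> lists C" "a \<in> C"
  show "P (xs @ s c a # ys) = fscale c (P (xs @ a # ys))"
    using * by (auto simp: ptensor_def fscale_def fun_eq_iff multilinear_def)
  assume "b \<in> C"
  then show "P (xs @ (a + b) # ys) = P (xs @ a # ys) + P (xs @ b # ys)"
    using * by (auto simp: ptensor_def fun_eq_iff multilinear_def plus_fun_apply)
qed

lemma linear_on_lift:
  "vector_space w \<Longrightarrow> multilinear s C w g \<Longrightarrow> linear_on fscale A w UNIV (lift s C w g)"
  by (rule linear_on_linear, rule lift(1))

lemma lift_P: "vector_space w \<Longrightarrow> multilinear s C w g \<Longrightarrow> xs \<in> lists C \<Longrightarrow> lift s C w g (P xs) = g xs"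
  by (rule lift(2))

lemma multilinear_linear_on:
  assumes f: "linear_on w A w' B f" and g: "multilinear s C w g" "\<And>xs. xs \<in> lists C \<Longrightarrow> g xs \<in> A"
  shows "multilinear s C w' (\<lambda>xs. f (g xs))"
  unfolding multilinear_def
proof (intro ballI conjI allI)
  fix xs ys a b c assume *: "xs \<in> lists C" "ys \<in> lists C" "a \<in> C"
  then have a: "g (xs @ a # ys) \<in> A" by (intro g) auto
  show "f (g (xs @ s c a # ys)) = w' c (f (g (xs @ a # ys)))"
    using g(1) * linear_on_scale[OF f a] by (simp add: multilinear_def)
  assume b: "b \<in> C"
  with * have b': "g (xs @ b # ys) \<in> A" by (intro g) auto
  show "f (g (xs @ (a + b) # ys)) = f (g (xs @ a # ys)) + f (g (xs @ b # ys))"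
    using g(1) * b linear_on_add[OF f a b'] by (simp add: multilinear_def)
qed

text \<open>The cut depends on the length alone, so a slot stays on the same side of it whatever its
  entry. Linearity in the slot then comes from the corresponding argument of h.\<close>

lemma multilinear_split:
  assumes w: "vector_space w"
    and 1: "\<And>ys. ys \<in> lists C \<Longrightarrow> multilinear s C w (\<lambda>xs. h xs ys)"
    and 2: "\<And>xs. xs \<in> lists C \<Longrightarrow> multilinear s C w (h xs)"
  shows "multilinear s C w (\<lambda>zs. if D (length zs)
    then h (take (k (length zs)) zs) (drop (k (length zs)) zs) else 0)" (is "multilinear s C w ?g")
  unfolding multilinear_def
proof (intro ballI conjI allI)
  interpret W: vector_space w by (fact w)
  fix xs ys a b c assume *: "xs \<in> lists C" "ys \<in> lists C" "a \<in> C"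
  define n where "n = Suc (length xs + length ys)"
  have g: "?g (xs @ z # ys) = (if D n then
      (if k n \<le> length xs then h (take (k n) xs) (drop (k n) xs @ z # ys)
       else h (xs @ z # take (k n - length xs - 1) ys) (drop (k n - length xs - 1) ys)) else 0)" for z
    by (auto simp: n_def take_Cons' drop_Cons')
  have l: "take m zs \<in> lists C" "drop m zs \<in> lists C" if "zs \<in> lists C" for m zs
    using that by (auto dest: in_set_takeD in_set_dropD)
  show "?g (xs @ s c a # ys) = w c (?g (xs @ a # ys))"
    unfolding g using 1[OF l(2)[OF *(2)]] 2[OF l(1)[OF *(1)]] * l
    by (auto simp: multilinear_def)
  assume "b \<in> C"
  then show "?g (xs @ (a + b) # ys) = ?g (xs @ a # ys) + ?g (xs @ b # ys)"
    unfolding g using 1[OF l(2)[OF *(2)]] 2[OF l(1)[OF *(1)]] * l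
    by (auto simp: multilinear_def)
qed

lemma multilinear_cong:
  assumes "multilinear s C w f" "\<And>xs. xs \<in> lists C \<Longrightarrow> f xs = g xs"
  shows "multilinear s C w g"
  using assms C_add C_scale unfolding multilinear_def by simp

lemma multilinear_if_length:
  assumes w: "vector_space w" and g: "multilinear s C w g"
  shows "multilinear s C w (\<lambda>xs. if D (length xs) then g xs else 0)"
proof -
  interpret W: vector_space w by (fact w)
  show ?thesis using g by (auto simp: multilinear_def)
qed

lemma multilinear_append_left: "multilinear s C w g \<Longrightarrow> ys \<in> lists C \<Longrightarrow> multilinear s C w (\<lambda>xs. g (xs @ ys))"
  by (auto simp: multilinear_def)

lemma multilinear_append_right:
  assumes "multilinear s C w g" "ys \<in> lists C"
  shows "multilinear s C w (\<lambda>xs. g (ys @ xs))"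
  unfolding multilinear_def append_assoc[symmetric] using assms
  by (simp add: multilinear_def del: append_assoc)

text \<open>\<open>lift\<close> is a chosen extension, and the choices for different forms are
  unrelated. On the tensor algebra the values are forced, so there \<open>lift\<close> is additive
  in the form; bilinear maps made of nested lifts rest on this.\<close>

lemma lift_add:
  assumes w: "vector_space w" and f: "multilinear s C w f" and g: "multilinear s C w g" and t: "t \<in> TC"
    and h: "\<And>xs. xs \<in> lists C \<Longrightarrow> h xs = f xs + g xs" "multilinear s C w h"
  shows "lift s C w h t = lift s C w f t + lift s C w g t"
proof (rule TC_eq[OF linear_on_lift[OF w h(2)] _ w _ t])
  interpret W: vector_space w by (fact w)
  show "linear_on fscale TC w UNIV (\<lambda>t. lift s C w f t + lift s C w g t)"
    using linear_on_lift[OF w f, of TC] linear_on_lift[OF w g, of TC]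
    by (auto simp: linear_on_def W.scale_right_distrib)
qed (simp add: lift_P w f g h)

lemma lift_scale:
  assumes w: "vector_space w" and f: "multilinear s C w f" and t: "t \<in> TC"
    and h: "\<And>xs. xs \<in> lists C \<Longrightarrow> h xs = w c (f xs)" "multilinear s C w h"
  shows "lift s C w h t = w c (lift s C w f t)"
proof (rule TC_eq[OF linear_on_lift[OF w h(2)] _ w _ t])
  interpret W: vector_space w by (fact w)
  show "linear_on fscale TC w UNIV (\<lambda>t. w c (lift s C w f t))"
    using linear_on_lift[OF w f, of TC]
    by (auto simp: linear_on_def W.scale_right_distrib W.scale_left_commute)
qed (simp add: lift_P w f h)

section \<open>Bilinear maps on the tensor algebra and concatenation\<close>

definition bimultilinear where
  "bimultilinear w g \<longleftrightarrow> (\<forall>ys\<in>lists C. multilinear s C w (\<lambda>xs. g xs ys)) \<and>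
     (\<forall>xs\<in>lists C. multilinear s C w (g xs))"

lemma multilinear_bilift:
  assumes w: "vector_space w" and g: "bimultilinear w g" and u: "u \<in> TC"
  shows "multilinear s C w (\<lambda>xs. lift s C w (\<lambda>ys. g xs ys) u)"
  unfolding multilinear_def
proof (intro ballI conjI allI)
  fix xs ys a b c assume *: "xs \<in> lists C" "ys \<in> lists C" "a \<in> C"
  have m: "multilinear s C w (g (xs @ z # ys))" if "z \<in> C" for z
    using g * that by (auto simp: bimultilinear_def)
  have m1: "multilinear s C w (\<lambda>xs. g xs zs)" if "zs \<in> lists C" for zs
    using g that by (auto simp: bimultilinear_def)
  show "lift s C w (g (xs @ s c a # ys)) u = w c (lift s C w (g (xs @ a # ys)) u)"
    by (rule lift_scale[OF w m u _ m]) (use * m1 C_scale in \<open>auto simp: multilinear_def\<close>)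
  assume b: "b \<in> C"
  show "lift s C w (g (xs @ (a + b) # ys)) u = lift s C w (g (xs @ a # ys)) u + lift s C w (g (xs @ b # ys)) u"
    by (rule lift_add[OF w m m u _ m]) (use * b m1 C_add in \<open>auto simp: multilinear_def\<close>)
qed

lemma bilift_P:
  assumes w: "vector_space w" and g: "bimultilinear w g" and "xs \<in> lists C" "ys \<in> lists C"
  shows "bilift s C w g (P xs) (P ys) = g xs ys"
proof -
  have "bilift s C w g (P xs) (P ys) = lift s C w (g xs) (P ys)"
    unfolding bilift_def by (rule lift_P[OF w multilinear_bilift[OF w g]]) (use assms in auto)
  also have "\<dots> = g xs ys"
    by (rule lift_P[OF w]) (use assms in \<open>auto simp: bimultilinear_def\<close>)
  finally show ?thesis .
qed

lemma linear_on_bilift_left: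
  assumes w: "vector_space w" and g: "bimultilinear w g" and u: "u \<in> TC"
  shows "linear_on fscale A w UNIV (\<lambda>t. bilift s C w g t u)"
  unfolding bilift_def by (rule linear_on_lift[OF w multilinear_bilift[OF w g u]])

lemma linear_on_bilift_right:
  assumes w: "vector_space w" and g: "bimultilinear w g" and t: "t \<in> TC"
  shows "linear_on fscale TC w UNIV (bilift s C w g t)"
proof (rule linear_onI)
  interpret W: vector_space w by (fact w)
  have m: "multilinear s C w (g xs)" if "xs \<in> lists C" for xs
    using g that by (auto simp: bimultilinear_def)
  fix u v c assume u: "u \<in> TC"
  show "bilift s C w g t (fscale c u) = w c (bilift s C w g t u)"
    unfolding bilift_def
    by (rule lift_scale[OF w multilinear_bilift[OF w g u] t _ multilinear_bilift[OF w g]])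
      (use u linear_on_scale[OF linear_on_lift[OF w m]] in auto)
  assume v: "v \<in> TC"
  show "bilift s C w g t (u + v) = bilift s C w g t u + bilift s C w g t v"
    unfolding bilift_def
    by (rule lift_add[OF w multilinear_bilift[OF w g u] multilinear_bilift[OF w g v] t _ multilinear_bilift[OF w g]])
      (use u v linear_on_add[OF linear_on_lift[OF w m]] in auto)
qed simp

abbreviation "ct \<equiv> cat s C"

lemma bimultilinear_append: "bimultilinear fscale (\<lambda>xs ys. P (xs @ ys))"
  by (simp add: bimultilinear_def multilinear_append_left multilinear_append_right multilinear_P)

lemma cat_P: "xs \<in> lists C \<Longrightarrow> ys \<in> lists C \<Longrightarrow> ct (P xs) (P ys) = P (xs @ ys)"
  unfolding cat_def by (rule bilift_P[OF vector_space_fscale bimultilinear_append])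

lemma cat_left: "u \<in> TC \<Longrightarrow> flinear A UNIV (\<lambda>t. ct t u)"
  unfolding cat_def by (rule linear_on_bilift_left[OF vector_space_fscale bimultilinear_append])

lemma cat_right: "t \<in> TC \<Longrightarrow> flinear TC UNIV (ct t)"
  unfolding cat_def by (rule linear_on_bilift_right[OF vector_space_fscale bimultilinear_append])

lemma cat_right_Tn: "t \<in> TC \<Longrightarrow> flinear (Tn n) UNIV (ct t)"
  by (rule linear_on_mono[OF cat_right]) (auto simp: Tn_subset_TC)

lemma cat_in_Tn: assumes t: "t \<in> Tn m" and u: "u \<in> Tn n" shows "ct t u \<in> Tn (m + n)"
proof -
  have TC: "u \<in> TC" using u Tn_subset_TC by auto
  have "ct (P xs) u \<in> Tn (m + n)" if xs: "xs \<in> lists C" "length xs = m" for xs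
  proof (rule linear_on_into_Tn[OF cat_right_Tn _ subspace_Tn u])
    show "P xs \<in> TC" using xs by simp
    fix ys assume "ys \<in> lists C" "length ys = n"
    then show "ct (P xs) (P ys) \<in> Tn (m + n)"
      using xs P_in_Tn[of "xs @ ys"] cat_P[of xs ys] by simp
  qed
  then show ?thesis by (rule linear_on_into_Tn[OF cat_left[OF TC] _ subspace_Tn t])
qed

lemma cat_in_TC [simp]: assumes t: "t \<in> TC" and u: "u \<in> TC" shows "ct t u \<in> TC"
proof -
  have "ct (P xs) u \<in> TC" if xs: "xs \<in> lists C" for xs
    by (rule linear_on_into_TC[OF cat_right[OF P_in_TC[OF xs]] _ subspace_TC u])
      (use xs in \<open>simp add: cat_P\<close>)
  then show ?thesis by (rule linear_on_into_TC[OF cat_left[OF u] _ subspace_TC t])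
qed

lemma cat_Nil_left: "t \<in> TC \<Longrightarrow> ct (P []) t = t"
  by (rule TC_eq[OF cat_right linear_on_id vector_space_fscale]) (simp_all add: cat_P)

lemma cat_Nil_right: "t \<in> TC \<Longrightarrow> ct t (P []) = t"
  by (rule TC_eq[OF cat_left linear_on_id vector_space_fscale]) (simp_all add: cat_P)

lemma cat_assoc:
  assumes t: "t \<in> TC" and u: "u \<in> TC" and v: "v \<in> TC"
  shows "ct (ct t u) v = ct t (ct u v)"
proof -
  have 1: "ct (ct (P xs) (P ys)) v = ct (P xs) (ct (P ys) v)"
    if *: "xs \<in> lists C" "ys \<in> lists C" for xs ys
  proof (rule TC_eq[OF _ _ vector_space_fscale _ v])
    show "flinear TC UNIV (ct (ct (P xs) (P ys)))"
      using * by (intro cat_right) simp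
    show "flinear TC UNIV (\<lambda>v. ct (P xs) (ct (P ys) v))"
      by (rule linear_on_compose'[OF cat_right _ cat_right]) (use * in simp_all)
  qed (use * in \<open>simp add: cat_P\<close>)
  have 2: "ct (ct (P xs) u) v = ct (P xs) (ct u v)" if *: "xs \<in> lists C" for xs
  proof (rule TC_eq[OF _ _ vector_space_fscale _ u])
    show "flinear TC UNIV (\<lambda>u. ct (ct (P xs) u) v)"
      by (rule linear_on_compose'[OF cat_right _ cat_left, of _ TC]) (use * v in simp_all)
    show "flinear TC UNIV (\<lambda>u. ct (P xs) (ct u v))"
      by (rule linear_on_compose'[OF cat_left _ cat_right]) (use * v in simp_all)
  qed (use * 1 in simp)
  show ?thesis
  proof (rule TC_eq[OF _ _ vector_space_fscale _ t])
    show "flinear TC UNIV (\<lambda>t. ct (ct t u) v)"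
      by (rule linear_on_compose'[OF cat_left _ cat_left, of _ _ TC]) (use u v in simp_all)
    show "flinear TC UNIV (\<lambda>t. ct t (ct u v))"
      by (rule cat_left) (use u v in simp)
  qed (rule 2)
qed

lemma multilinear_cat:
  assumes "flinear TC TC f" "flinear TC TC g"
  shows "multilinear s C fscale (\<lambda>zs. if D (length zs)
    then ct (f (P (take (k (length zs)) zs))) (g (P (drop (k (length zs)) zs))) else 0)"
proof (rule multilinear_split[OF vector_space_fscale])
  fix xs assume xs: "xs \<in> lists C"
  show "multilinear s C fscale (\<lambda>ys. ct (f (P ys)) (g (P xs)))"
    by (rule multilinear_linear_on[OF linear_on_compose[OF assms(1) cat_left] multilinear_P])
      (use xs linear_on_in[OF assms(2)] in simp_all)
  show "multilinear s C fscale (\<lambda>ys. ct (f (P xs)) (g (P ys)))"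
    by (rule multilinear_linear_on[OF linear_on_compose[OF assms(2) cat_right] multilinear_P])
      (use xs linear_on_in[OF assms(1)] in simp_all)
qed

end

section \<open>Operators on a tensor algebra\<close>

text \<open>The operators act on the whole function type, since a type cannot depend on the subspace
  of tensors. A type is wanted because the operator calculus is stated for an instance of the class
  \<open>ring\<close>.\<close>

typedef (overloaded) ('b, 'k) endo =
  "{f :: ('b \<Rightarrow> 'k::field) \<Rightarrow> ('b \<Rightarrow> 'k). Vector_Spaces.linear fscale fscale f}"
  morphisms ap Abs_endo
proof
  show "(\<lambda>x. x) \<in> {f :: ('b \<Rightarrow> 'k) \<Rightarrow> ('b \<Rightarrow> 'k). Vector_Spaces.linear fscale fscale f}"
    by (simp add: Vector_Spaces.linear_iff vector_space_fscale)
qed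

lemma ap_linear: "Vector_Spaces.linear fscale fscale (ap f)"
  using ap[of f] by simp

lemma ap_plus_right: "ap f (x + y) = ap f x + ap f y"
  and ap_fscale: "ap f (fscale c x) = fscale c (ap f x)"
  using ap_linear[of f] by (auto simp: Vector_Spaces.linear_iff)

lemma ap_Abs: "(\<And>x y. f (x + y) = f x + f y) \<Longrightarrow> (\<And>c x. f (fscale c x) = fscale c (f x)) \<Longrightarrow>
    ap (Abs_endo f) = f"
  by (rule Abs_endo_inverse) (simp add: Vector_Spaces.linear_iff vector_space_fscale)

lemma endo_eqI: "(\<And>x. ap f x = ap g x) \<Longrightarrow> f = g"
  by (metis ap_inject ext)

lemma ap_0_right [simp]: "ap f 0 = 0"
  using ap_plus_right[of f 0 0] by simp

lemma fscale_add_right: "fscale c (x + y) = fscale c x + fscale c y"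
  and fscale_minus_right: "fscale c (- x) = - fscale c x"
  and fscale_diff_right: "fscale c (x - y) = fscale c x - fscale c y"
  and fscale_0_right: "fscale c 0 = 0"
  for c :: "'k::field"
  by (auto simp: fscale_def fun_eq_iff algebra_simps plus_fun_apply zero_fun_apply)

instantiation endo :: (type, field) ring
begin

definition "f + g = Abs_endo (\<lambda>x. ap f x + ap g x)"
definition "f - g = Abs_endo (\<lambda>x. ap f x - ap g x)"
definition "- f = Abs_endo (\<lambda>x. - ap f x)"
definition "0 = Abs_endo (\<lambda>x. 0)"
definition "f * g = Abs_endo (\<lambda>x. ap f (ap g x))"

lemma ap_plus: "ap (f + g) x = ap f x + ap g x"
  unfolding plus_endo_def
  by (subst ap_Abs) (simp_all add: ap_plus_right ap_fscale fscale_add_right)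

lemma ap_minus: "ap (f - g) x = ap f x - ap g x"
  unfolding minus_endo_def
  by (subst ap_Abs) (simp_all add: ap_plus_right ap_fscale fscale_diff_right)

lemma ap_uminus: "ap (- f) x = - ap f x"
  unfolding uminus_endo_def
  by (subst ap_Abs) (simp_all add: ap_plus_right ap_fscale fscale_minus_right)

lemma ap_0: "ap 0 x = 0"
  unfolding zero_endo_def by (subst ap_Abs) (simp_all add: fscale_0_right)

lemma ap_mult: "ap (f * g) x = ap f (ap g x)"
  unfolding times_endo_def by (subst ap_Abs) (simp_all add: ap_plus_right ap_fscale)

instance
  by intro_classes
    (rule endo_eqI, simp add: ap_plus ap_minus ap_uminus ap_0 ap_mult ap_plus_right algebra_simps)+

end

lemma ap_sum: "ap (\<Sum>i\<in>I. f i) x = (\<Sum>i\<in>I. ap (f i) x)"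
  by (induction I rule: infinite_finite_induct) (simp_all add: ap_plus ap_0)

context tensor_space
begin

text \<open>A basis of the tensor algebra is independent in the ambient space as well, so its
  identity map extends to a linear map whose range is the span of the basis.\<close>

lemma ex_projection:
  "\<exists>p :: ('a list \<Rightarrow> 'k, 'k) endo. (\<forall>x. ap p x \<in> TC) \<and> (\<forall>x\<in>TC. ap p x = x)"
proof -
  interpret FF: vector_space_pair "fscale :: 'k \<Rightarrow> ('a, 'k) tensor \<Rightarrow> ('a, 'k) tensor"
    "fscale :: 'k \<Rightarrow> ('a, 'k) tensor \<Rightarrow> ('a, 'k) tensor" ..
  obtain B where B: "B \<subseteq> P ` lists C" "F.independent B" "P ` lists C \<subseteq> F.span B"
    using F.maximal_independent_subset by blast
  have sp: "F.span B = TC"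
    unfolding tensor_algebra_def using B F.span_mono F.span_minimal[OF B(3) F.subspace_span] by blast
  obtain g where g: "Vector_Spaces.linear fscale fscale g" "\<forall>x\<in>B. g x = x" "range g = F.span B"
    using FF.linear_independent_extend_subspace[OF B(2), of "\<lambda>x. x"] by auto
  have "g x = x" if "x \<in> TC" for x
  proof (rule linear_on_span_eq[OF vector_space_fscale linear_on_linear[OF g(1)]])
    show "flinear (F.span B) (F.span B) (\<lambda>x. x)" by (rule linear_on_id)
  qed (use g(2) that sp vector_space_fscale in auto)
  then have "ap (Abs_endo g) x \<in> TC" "x \<in> TC \<Longrightarrow> ap (Abs_endo g) x = x" for x
    using g sp by (auto simp: Abs_endo_inverse)
  then show ?thesis by blast
qed

text \<open>
  \<open>lift\<close> is arbitrary outside the tensor algebra, so linear extensions are composed with a projection to make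
  them unique.
\<close>

definition pr :: "('a list \<Rightarrow> 'k, 'k) endo" where
  "pr = (SOME p. (\<forall>x. ap p x \<in> TC) \<and> (\<forall>x\<in>TC. ap p x = x))"

lemma pr_in_TC [simp]: "ap pr x \<in> TC" and pr_TC [simp]: "x \<in> TC \<Longrightarrow> ap pr x = x"
  using someI_ex[OF ex_projection] unfolding pr_def by auto

text \<open>The model of the predicate \<open>A\<close>. Such operators are determined by their
  values on words, as \<open>tame_eqI\<close> shows.\<close>

definition tame :: "('a list \<Rightarrow> 'k, 'k) endo \<Rightarrow> bool" where
  "tame f \<longleftrightarrow> pr * f = f \<and> f * pr = f"

lemma tame_in_TC: "tame f \<Longrightarrow> ap f x \<in> TC"
  unfolding tame_def by (metis ap_mult pr_in_TC)

lemma tame_pr: "tame f \<Longrightarrow> ap f (ap pr x) = ap f x"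
  unfolding tame_def by (metis ap_mult)

lemma tameI: "(\<And>x. ap f x \<in> TC) \<Longrightarrow> (\<And>x. ap f (ap pr x) = ap f x) \<Longrightarrow> tame f"
  unfolding tame_def by (auto intro!: endo_eqI simp: ap_mult)

lemma tame_linear_on: "tame f \<Longrightarrow> flinear A TC (ap f)"
  by (rule linear_onI) (simp_all add: tame_in_TC ap_plus_right ap_fscale)

lemma tame_eqI:
  assumes "tame f" "tame g" "\<And>xs. xs \<in> lists C \<Longrightarrow> ap f (P xs) = ap g (P xs)"
  shows "f = g"
proof (rule endo_eqI)
  fix x
  have "ap f (ap pr x) = ap g (ap pr x)"
    by (rule TC_eq[OF tame_linear_on tame_linear_on vector_space_fscale]) (use assms in auto)
  then show "ap f x = ap g x" by (simp add: tame_pr assms)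
qed

definition mk :: "('a list \<Rightarrow> ('a, 'k) tensor) \<Rightarrow> ('a list \<Rightarrow> 'k, 'k) endo" where
  "mk g = Abs_endo (\<lambda>t. lift s C fscale g (ap pr t))"

lemma ap_mk: "multilinear s C fscale g \<Longrightarrow> ap (mk g) t = lift s C fscale g (ap pr t)"
  unfolding mk_def using linear_on_lift[OF vector_space_fscale, of g UNIV]
  by (subst ap_Abs) (auto simp: ap_plus_right ap_fscale linear_on_def)

lemma ap_mk_P: "multilinear s C fscale g \<Longrightarrow> xs \<in> lists C \<Longrightarrow> ap (mk g) (P xs) = g xs"
  by (simp add: ap_mk lift_P vector_space_fscale)

lemma tame_mk:
  assumes g: "multilinear s C fscale g" "\<And>xs. xs \<in> lists C \<Longrightarrow> g xs \<in> TC"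
  shows "tame (mk g)"
proof (rule tameI)
  fix x
  show "ap (mk g) x \<in> TC"
    unfolding ap_mk[OF g(1)]
    by (rule linear_on_into_TC[OF linear_on_lift[OF vector_space_fscale g(1)] _ subspace_TC])
      (simp_all add: lift_P vector_space_fscale g)
qed (simp add: ap_mk g)

definition eT :: "nat \<Rightarrow> ('a list \<Rightarrow> 'k, 'k) endo" where
  "eT n = mk (\<lambda>xs. if length xs = n then P xs else 0)"

text \<open>The cut is counted from the left here and from the right in \<open>RT\<close>. The
  operator f receives whatever remains, so it may act in all degrees at once; shorter words go to
  zero.\<close>

definition LT :: "nat \<Rightarrow> ('a list \<Rightarrow> 'k, 'k) endo \<Rightarrow> ('a list \<Rightarrow> 'k, 'k) endo" where
  "LT a f = mk (\<lambda>zs. if a \<le> length zs then ct (P (take a zs)) (ap f (P (drop a zs))) else 0)"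

definition RT :: "nat \<Rightarrow> ('a list \<Rightarrow> 'k, 'k) endo \<Rightarrow> ('a list \<Rightarrow> 'k, 'k) endo" where
  "RT a f = mk (\<lambda>zs. if a \<le> length zs
     then ct (ap f (P (take (length zs - a) zs))) (P (drop (length zs - a) zs)) else 0)"

lemma lists_take_drop: "xs \<in> lists C \<Longrightarrow> take n xs \<in> lists C" "xs \<in> lists C \<Longrightarrow> drop n xs \<in> lists C"
  by (auto dest: in_set_takeD in_set_dropD)

lemma P_in_Tn': "xs \<in> lists C \<Longrightarrow> length xs = n \<Longrightarrow> P xs \<in> Tn n"
  using P_in_Tn by auto

lemma drop_take_append_drop: "k \<le> m \<Longrightarrow> drop k (take m xs) @ drop m xs = drop k xs"
  by (metis append_take_drop_id drop_drop drop_take le_add_diff_inverse2)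

lemma eT_ml: "multilinear s C fscale (\<lambda>xs. if length xs = n then P xs else 0)"
  by (rule multilinear_if_length[OF vector_space_fscale multilinear_P])

lemma LT_ml: "tame f \<Longrightarrow> multilinear s C fscale
    (\<lambda>zs. if a \<le> length zs then ct (P (take a zs)) (ap f (P (drop a zs))) else 0)"
  by (rule multilinear_cat[where k = "\<lambda>_. a"]) (auto simp: linear_on_id tame_linear_on)

lemma RT_ml: "tame f \<Longrightarrow> multilinear s C fscale
    (\<lambda>zs. if a \<le> length zs then ct (ap f (P (take (length zs - a) zs))) (P (drop (length zs - a) zs)) else 0)"
  by (rule multilinear_cat[where k = "\<lambda>n. n - a"]) (auto simp: linear_on_id tame_linear_on)

lemma eT_P: "xs \<in> lists C \<Longrightarrow> ap (eT n) (P xs) = (if length xs = n then P xs else 0)"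
  unfolding eT_def by (rule ap_mk_P[OF eT_ml])

lemma LT_P: "tame f \<Longrightarrow> xs \<in> lists C \<Longrightarrow> ap (LT a f) (P xs) =
    (if a \<le> length xs then ct (P (take a xs)) (ap f (P (drop a xs))) else 0)"
  unfolding LT_def by (rule ap_mk_P[OF LT_ml])

lemma RT_P: "tame f \<Longrightarrow> xs \<in> lists C \<Longrightarrow> ap (RT a f) (P xs) =
    (if a \<le> length xs then ct (ap f (P (take (length xs - a) xs))) (P (drop (length xs - a) xs)) else 0)"
  unfolding RT_def by (rule ap_mk_P[OF RT_ml])

lemma tame_eT [simp]: "tame (eT n)"
  unfolding eT_def by (rule tame_mk[OF eT_ml]) simp

lemma tame_LT [simp]: "tame f \<Longrightarrow> tame (LT a f)"
  unfolding LT_def by (rule tame_mk[OF LT_ml]) (simp_all add: lists_take_drop tame_in_TC)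

lemma tame_RT [simp]: "tame f \<Longrightarrow> tame (RT a f)"
  unfolding RT_def by (rule tame_mk[OF RT_ml]) (simp_all add: lists_take_drop tame_in_TC)

lemma tame_0 [simp]: "tame 0" and tame_add [simp]: "tame f \<Longrightarrow> tame g \<Longrightarrow> tame (f + g)"
  and tame_mult [simp]: "tame f \<Longrightarrow> tame g \<Longrightarrow> tame (f * g)"
  unfolding tame_def by (simp_all add: distrib_left distrib_right) (metis mult.assoc)

lemma eT_Tn: "t \<in> Tn n \<Longrightarrow> ap (eT n) t = t"
  by (rule Tn_eq[OF tame_linear_on linear_on_id]) (simp_all add: eT_P)

lemma eT_in_Tn: "t \<in> TC \<Longrightarrow> ap (eT n) t \<in> Tn n"
  by (rule linear_on_into_TC[OF tame_linear_on _ subspace_Tn]) (use P_in_Tn in \<open>auto simp: eT_P\<close>)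

lemma LT_cat:
  assumes f: "tame f" and u: "u \<in> Tn a" and t: "t \<in> TC"
  shows "ap (LT a f) (ct u t) = ct u (ap f t)"
proof -
  have 1: "ap (LT a f) (ct (P xs) t) = ct (P xs) (ap f t)" if xs: "xs \<in> lists C" "length xs = a" for xs
  proof (rule TC_eq[OF _ _ vector_space_fscale _ t])
    show "flinear TC TC (\<lambda>t. ap (LT a f) (ct (P xs) t))"
      by (rule linear_on_compose'[OF cat_right _ tame_linear_on, of _ TC]) (use f xs in simp_all)
    show "flinear TC UNIV (\<lambda>t. ct (P xs) (ap f t))"
      by (rule linear_on_compose[OF tame_linear_on[OF f] cat_right]) (use xs in simp_all)
  qed (use f xs in \<open>simp add: cat_P LT_P\<close>)
  show ?thesis
  proof (rule Tn_eq[OF _ _ _ u])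
    show "flinear (Tn a) TC (\<lambda>u. ap (LT a f) (ct u t))"
      by (rule linear_on_compose'[OF cat_left _ tame_linear_on, of _ _ TC])
        (use f t Tn_in_TC in auto)
    show "flinear (Tn a) UNIV (\<lambda>u. ct u (ap f t))"
      by (rule cat_left) (use f in \<open>simp add: tame_in_TC\<close>)
  qed (rule 1)
qed

lemma RT_cat:
  assumes f: "tame f" and t: "t \<in> TC" and u: "u \<in> Tn a"
  shows "ap (RT a f) (ct t u) = ct (ap f t) u"
proof -
  have 1: "ap (RT a f) (ct t (P xs)) = ct (ap f t) (P xs)" if xs: "xs \<in> lists C" "length xs = a" for xs
  proof (rule TC_eq[OF _ _ vector_space_fscale _ t])
    show "flinear TC TC (\<lambda>t. ap (RT a f) (ct t (P xs)))"
      by (rule linear_on_compose'[OF cat_left _ tame_linear_on, of _ _ TC]) (use f xs in simp_all)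
    show "flinear TC UNIV (\<lambda>t. ct (ap f t) (P xs))"
      by (rule linear_on_compose[OF tame_linear_on[OF f] cat_left]) (use xs in simp_all)
  qed (use f xs in \<open>simp add: cat_P RT_P\<close>)
  show ?thesis
  proof (rule Tn_eq[OF _ _ _ u])
    show "flinear (Tn a) TC (\<lambda>u. ap (RT a f) (ct t u))"
      by (rule linear_on_compose'[OF cat_right_Tn _ tame_linear_on, of _ _ TC])
        (use f t Tn_in_TC in auto)
    show "flinear (Tn a) UNIV (\<lambda>u. ct (ap f t) u)"
      by (rule cat_right_Tn) (use f in \<open>simp add: tame_in_TC\<close>)
  qed (rule 1)
qed

lemma P_take_Tn: "xs \<in> lists C \<Longrightarrow> a \<le> length xs \<Longrightarrow> P (take a xs) \<in> Tn a"
  using P_in_Tn[of "take a xs"] by (simp add: lists_take_drop)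

lemma P_drop_Tn: "xs \<in> lists C \<Longrightarrow> a \<le> length xs \<Longrightarrow> P (drop (length xs - a) xs) \<in> Tn a"
  using P_in_Tn[of "drop (length xs - a) xs"] by (simp add: lists_take_drop)

lemma cat_0_left [simp]: "u \<in> TC \<Longrightarrow> ct 0 u = 0"
  using linear_on_scale[OF cat_left[of u UNIV], of 0 0] by simp

lemma cat_0_right [simp]: "t \<in> TC \<Longrightarrow> ct t 0 = 0"
  using linear_on_scale[OF cat_right[of t], of 0 0] by simp

text \<open>By \<open>tame_eqI\<close> each law is tested on words. For composites this is not
  enough, because the inner operator need not return a word; \<open>LT_cat\<close> and
  \<open>RT_cat\<close> evaluate the whiskerings on arbitrary tensors next to a homogeneous
  block.\<close>

sublocale W: strict_tensor eT tame LT RT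
proof
  fix m n p q a b :: nat and f g :: "('a list \<Rightarrow> 'k, 'k) endo"
  note [simp] = eT_P LT_P RT_P lists_take_drop tame_in_TC ap_mult ap_plus
  show "eT m * eT m = eT m"
    by (rule tame_eqI) simp_all
  show "LT a (eT m) = eT (a + m)" "RT a (eT m) = eT (m + a)"
    by (rule tame_eqI; auto simp: cat_P)+
  assume f: "tame f"
  show "LT 0 f = f" "RT 0 f = f"
    by (rule tame_eqI; simp add: f cat_Nil_left cat_Nil_right)+
  show "LT a (LT b f) = LT (a + b) f"
    by (rule tame_eqI) (auto simp: f cat_assoc[symmetric] cat_P take_add[symmetric] add.commute)
  show "RT a (RT b f) = RT (b + a) f"
    by (rule tame_eqI) (auto simp: f cat_assoc cat_P drop_take_append_drop add.commute[of a b])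
  show "LT a (RT b f) = RT b (LT a f)"
    by (rule tame_eqI) (auto simp: f cat_assoc drop_take add.commute[of a b])
  assume g: "tame g"
  show "LT a (f + g) = LT a f + LT a g"
    by (rule tame_eqI) (auto simp: f g linear_on_add[OF cat_right])
  show "RT a (f + g) = RT a f + RT a g"
    by (rule tame_eqI) (auto simp: f g linear_on_add[OF cat_left[where A = TC]])
  show "LT a (f * g) = LT a f * LT a g"
    by (rule tame_eqI) (auto simp: f g LT_cat P_take_Tn)
  show "RT a (f * g) = RT a f * RT a g"
    by (rule tame_eqI) (auto simp: f g RT_cat P_drop_Tn)
  assume h: "eT n * f = f" "f * eT m = f" "eT q * g = g" "g * eT p = g"
  \<comment> \<open>The idempotents force f and g to vanish on words of any other length, so both
    sides of the interchange law are zero unless the word has length m + p.\<close>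
  have f0: "ap f (P xs) = 0" if "xs \<in> lists C" "length xs \<noteq> m" for xs
    using arg_cong[OF h(2), of "\<lambda>h. ap h (P xs)"] that by simp
  have g0: "ap g (P xs) = 0" if "xs \<in> lists C" "length xs \<noteq> p" for xs
    using arg_cong[OF h(4), of "\<lambda>h. ap h (P xs)"] that by simp
  have fT: "ap f t \<in> Tn n" for t
    using eT_in_Tn[of "ap f t" n] arg_cong[OF h(1), of "\<lambda>h. ap h t"] f by simp
  have gT: "ap g t \<in> Tn q" for t
    using eT_in_Tn[of "ap g t" q] arg_cong[OF h(3), of "\<lambda>h. ap h t"] g by simp
  show "RT q f * LT m g = LT n g * RT p f"
  proof (rule tame_eqI)
    fix xs assume xs: "xs \<in> lists C"
    show "ap (RT q f * LT m g) (P xs) = ap (LT n g * RT p f) (P xs)"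
    proof (cases "length xs = m + p")
      case True
      then show ?thesis using xs f g by (simp add: RT_cat gT LT_cat fT)
    next
      case False
      then have "m \<le> length xs \<Longrightarrow> length (drop m xs) \<noteq> p"
        "p \<le> length xs \<Longrightarrow> length (take (length xs - p) xs) \<noteq> m" by auto
      then show ?thesis using xs f g f0[of "take (length xs - p) xs"] g0[of "drop m xs"] by simp
    qed
  qed (use f g in simp_all)
qed (simp_all)

lemma hom_in_Tn: "W.hom m n f \<Longrightarrow> ap f t \<in> Tn n"
  by (metis W.hom_A W.hom_left ap_mult eT_in_Tn tame_in_TC)

lemma hom_eqI:
  assumes "W.hom m n f" "W.hom m n' g" "\<And>xs. xs \<in> lists C \<Longrightarrow> length xs = m \<Longrightarrow> ap f (P xs) = ap g (P xs)"
  shows "f = g"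
proof -
  have "f * eT m = g * eT m"
    by (rule tame_eqI) (use assms W.hom_A in \<open>auto simp: ap_mult eT_P\<close>)
  then show ?thesis using assms W.hom_right by metis
qed

text \<open>The way in which \<sigma> and the brackets, known to be linear on one tensor power only,
  enter the ring of operators.\<close>

definition op_of :: "nat \<Rightarrow> (('a, 'k) tensor \<Rightarrow> ('a, 'k) tensor) \<Rightarrow> ('a list \<Rightarrow> 'k, 'k) endo" where
  "op_of m f = mk (\<lambda>xs. if length xs = m then f (P xs) else 0)"

text \<open>Nothing is known about f outside degree m. Composing it with \<open>eT m\<close> gives a
  map that is linear on the whole tensor algebra and has the same values on words.\<close>

lemma op_of_ml:
  assumes f: "flinear (Tn m) TC f"
  shows "multilinear s C fscale (\<lambda>xs. if length xs = m then f (P xs) else 0)"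
proof -
  have f0: "f 0 = 0"
    using linear_on_scale[OF f, of 0 0] by (simp only: F.scale_zero_left F.scale_zero_right Tn_0)
  have "flinear TC TC (\<lambda>x. f (ap (eT m) x))"
    by (rule linear_on_compose'[OF tame_linear_on _ f]) (simp_all add: eT_in_Tn)
  from multilinear_linear_on[OF this multilinear_P]
  show ?thesis
  proof (rule multilinear_cong)
    show "f (ap (eT m) (P xs)) = (if length xs = m then f (P xs) else 0)" if "xs \<in> lists C" for xs
      using that by (simp add: eT_P f0)
  qed simp
qed

lemma op_of_P: "flinear (Tn m) TC f \<Longrightarrow> xs \<in> lists C \<Longrightarrow>
    ap (op_of m f) (P xs) = (if length xs = m then f (P xs) else 0)"
  unfolding op_of_def by (rule ap_mk_P[OF op_of_ml])

lemma tame_op_of [simp]: "flinear (Tn m) TC f \<Longrightarrow> tame (op_of m f)"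
  unfolding op_of_def
  by (rule tame_mk[OF op_of_ml]) (auto simp: P_in_Tn' linear_on_in[of fscale "Tn m" fscale TC f])

lemma op_of_Tn: "flinear (Tn m) TC f \<Longrightarrow> t \<in> Tn m \<Longrightarrow> ap (op_of m f) t = f t"
  by (rule Tn_eq[OF tame_linear_on _]) (simp_all add: op_of_P)

lemma linear_on_Tn_TC: "flinear A (Tn n) f \<Longrightarrow> flinear A TC f"
  using Tn_subset_TC by (auto simp: linear_on_def)

lemma hom_op_of:
  assumes f: "flinear (Tn m) (Tn n) f"
  shows "W.hom m n (op_of m f)"
proof -
  note f' = linear_on_Tn_TC[OF f]
  have "eT n * op_of m f = op_of m f"
    by (rule tame_eqI) (auto simp: f' ap_mult op_of_P eT_Tn P_in_Tn' linear_on_in[OF f])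
  moreover have "op_of m f * eT m = op_of m f"
    by (rule tame_eqI) (auto simp: f' ap_mult op_of_P eT_P)
  ultimately show ?thesis using f' by (simp add: W.hom_def)
qed

lemma tmap_ml:
  assumes f: "flinear (Tn p) TC f" and g: "flinear (Tn q) TC g"
  shows "multilinear s C fscale (\<lambda>xs. if length xs = p + q
     then ct (f (P (take p xs))) (g (P (drop p xs))) else 0)"
proof -
  have *: "multilinear s C fscale (\<lambda>xs. if length xs = p + q
     then ct (ap (op_of p f) (P (take p xs))) (ap (op_of q g) (P (drop p xs))) else 0)"
    by (rule multilinear_cat[where k = "\<lambda>_. p"]) (simp_all add: f g tame_linear_on)
  show ?thesis
  proof (rule multilinear_cong[OF *])
    show "(if length xs = p + q
     then ct (ap (op_of p f) (P (take p xs))) (ap (op_of q g) (P (drop p xs))) else 0)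
    = (if length xs = p + q then ct (f (P (take p xs))) (g (P (drop p xs))) else 0)"
    if "xs \<in> lists C" for xs
      using that f g by (simp add: op_of_P lists_take_drop)
  qed
qed

lemma tmap_P:
  assumes "flinear (Tn p) TC f" "flinear (Tn q) TC g"
    and "xs \<in> lists C" "length xs = p + q"
  shows "tmap s C p q f g (P xs) = ct (f (P (take p xs))) (g (P (drop p xs)))"
  unfolding tmap_def using assms by (simp add: lift_P vector_space_fscale tmap_ml)

lemma tmap_linear_on:
  assumes "flinear (Tn p) TC f" "flinear (Tn q) TC g"
  shows "flinear A UNIV (tmap s C p q f g)"
  unfolding tmap_def by (rule linear_on_lift[OF vector_space_fscale tmap_ml[OF assms]])

lemma tmap_in_Tn:
  assumes f: "flinear (Tn p) (Tn p') f" and g: "flinear (Tn q) (Tn q') g"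
    and t: "t \<in> Tn (p + q)"
  shows "tmap s C p q f g t \<in> Tn (p' + q')"
proof (rule linear_on_into_Tn[OF tmap_linear_on _ subspace_Tn t])
  fix xs assume xs: "xs \<in> lists C" "length xs = p + q"
  show "tmap s C p q f g (P xs) \<in> Tn (p' + q')"
    using xs P_in_Tn[of "take p xs"] P_in_Tn[of "drop p xs"]
    by (simp add: tmap_P linear_on_Tn_TC[OF f] linear_on_Tn_TC[OF g] lists_take_drop
        cat_in_Tn linear_on_in[OF f] linear_on_in[OF g])
qed (use f g linear_on_Tn_TC in auto)

lemma tmap_cat:
  assumes f: "flinear (Tn p) TC f" and g: "flinear (Tn q) TC g"
    and t: "t \<in> Tn p" and u: "u \<in> Tn q"
  shows "tmap s C p q f g (ct t u) = ct (f t) (g u)"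
proof -
  have 1: "tmap s C p q f g (ct (P xs) u) = ct (f (P xs)) (g u)" if xs: "xs \<in> lists C" "length xs = p" for xs
  proof (rule Tn_eq[OF _ _ _ u])
    show "flinear (Tn q) UNIV (\<lambda>u. tmap s C p q f g (ct (P xs) u))"
      by (rule linear_on_compose[OF cat_right_Tn tmap_linear_on]) (use f g xs in simp_all)
    show "flinear (Tn q) UNIV (\<lambda>u. ct (f (P xs)) (g u))"
      by (rule linear_on_compose[OF g cat_right]) (use linear_on_in[OF f] P_in_Tn xs in auto)
  qed (use f g xs in \<open>simp add: cat_P tmap_P\<close>)
  show ?thesis
  proof (rule Tn_eq[OF _ _ _ t])
    show "flinear (Tn p) UNIV (\<lambda>t. tmap s C p q f g (ct t u))"
      by (rule linear_on_compose[OF cat_left tmap_linear_on]) (use f g u Tn_subset_TC in auto)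
    show "flinear (Tn p) UNIV (\<lambda>t. ct (f t) (g u))"
      by (rule linear_on_compose[OF f cat_left]) (use linear_on_in[OF g] u in auto)
  qed (rule 1)
qed

lemma linear_on_id_Tn: "flinear (Tn n) (Tn n) id"
  by (simp add: linear_on_def)

lemma id_flinear: "flinear (Tn n) TC id"
  by (rule linear_on_Tn_TC[OF linear_on_id_Tn])

text \<open>Links the tensor product of maps, in which the definitions are phrased, to the
  whiskering of operators.\<close>

lemma tmap_left:
  assumes f: "flinear (Tn p) TC f" and t: "t \<in> Tn (p + q)"
  shows "tmap s C p q f id t = ap (RT q (op_of p f)) t"
  by (rule Tn_eq[OF tmap_linear_on tame_linear_on _ t])
    (use f in \<open>simp_all add: id_flinear tmap_P RT_P op_of_P lists_take_drop\<close>)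

lemma tmap_right:
  assumes f: "flinear (Tn q) TC f" and t: "t \<in> Tn (p + q)"
  shows "tmap s C p q id f t = ap (LT p (op_of q f)) t"
  by (rule Tn_eq[OF tmap_linear_on tame_linear_on _ t])
    (use f in \<open>simp_all add: id_flinear tmap_P LT_P op_of_P lists_take_drop\<close>)

end

section \<open>The braiding on \<open>T(V)\<close>\<close>

lemma linear_on_inv_into:
  assumes f: "linear_on s A w B f" and bij: "bij_betw f A B"
    and A: "\<And>x y. x \<in> A \<Longrightarrow> y \<in> A \<Longrightarrow> x + y \<in> A" "\<And>c x. x \<in> A \<Longrightarrow> s c x \<in> A"
  shows "linear_on w B s A (inv_into A f)"
proof (rule linear_onI)
  have inj: "inj_on f A" using bij by (simp add: bij_betw_def)
  have i: "inv_into A f x \<in> A" "f (inv_into A f x) = x" if "x \<in> B" for x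
    using that bij by (auto simp: bij_betw_def intro: inv_into_into f_inv_into_f)
  show "x \<in> B \<Longrightarrow> inv_into A f x \<in> A" for x by (rule i)
  fix x y c assume x: "x \<in> B"
  show "inv_into A f (w c x) = s c (inv_into A f x)"
    by (rule inv_into_f_eq[OF inj]) (use A i x linear_on_scale[OF f] in auto)
  assume y: "y \<in> B"
  show "inv_into A f (x + y) = inv_into A f x + inv_into A f y"
    by (rule inv_into_f_eq[OF inj]) (use A i x y linear_on_add[OF f] in auto)
qed

context tensor_space
begin

text \<open>The map may vary with the length of the word, since changing an entry does not change
  the length. The braiding and the brackets are given degree by degree in this way.\<close>

lemma multilinear_linear_on_length:
  assumes f: "\<And>n. linear_on w (A n) w' (B n) (f n)"
    and g: "multilinear s C w g" "\<And>xs. xs \<in> lists C \<Longrightarrow> g xs \<in> A (length xs)"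
  shows "multilinear s C w' (\<lambda>xs. f (length xs) (g xs))"
  unfolding multilinear_def
proof (intro ballI conjI allI)
  fix xs ys a b c assume *: "xs \<in> lists C" "ys \<in> lists C" "a \<in> C"
  define n where "n = Suc (length xs + length ys)"
  have a: "g (xs @ a # ys) \<in> A n" using g(2)[of "xs @ a # ys"] * by (simp add: n_def)
  show "f (length (xs @ s c a # ys)) (g (xs @ s c a # ys)) = w' c (f (length (xs @ a # ys)) (g (xs @ a # ys)))"
    using g(1) * linear_on_scale[OF f a] by (simp add: multilinear_def n_def)
  assume b: "b \<in> C"
  have b': "g (xs @ b # ys) \<in> A n" using g(2)[of "xs @ b # ys"] * b by (simp add: n_def)
  show "f (length (xs @ (a + b) # ys)) (g (xs @ (a + b) # ys))
      = f (length (xs @ a # ys)) (g (xs @ a # ys)) + f (length (xs @ b # ys)) (g (xs @ b # ys))"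
    using g(1) * b linear_on_add[OF f a b'] by (simp add: multilinear_def n_def)
qed

lemma P_slot: "xs \<in> lists C \<Longrightarrow> ys \<in> lists C \<Longrightarrow>
    linear_on s C fscale (Tn (Suc (length xs + length ys))) (\<lambda>a. P (xs @ a # ys))"
proof (rule linear_onI)
  assume *: "xs \<in> lists C" "ys \<in> lists C"
  fix a b c assume a: "a \<in> C"
  show "P (xs @ a # ys) \<in> Tn (Suc (length xs + length ys))"
    using * a by (intro P_in_Tn') auto
  show "P (xs @ s c a # ys) = fscale c (P (xs @ a # ys))"
    using multilinear_P * a by (simp add: multilinear_def)
  assume "b \<in> C"
  then show "P (xs @ (a + b) # ys) = P (xs @ a # ys) + P (xs @ b # ys)"
    using multilinear_P * a by (simp add: multilinear_def)
qed

lemma P_1_linear: "linear_on s C fscale (Tn 1) (\<lambda>a. P [a])"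
  using P_slot[of "[]" "[]"] by simp

lemma P_2_left: "b \<in> C \<Longrightarrow> linear_on s C fscale (Tn 2) (\<lambda>a. P [a, b])"
  using P_slot[of "[]" "[b]"] by (simp add: numeral_2_eq_2)

lemma P_2_right: "b \<in> C \<Longrightarrow> linear_on s C fscale (Tn 2) (\<lambda>a. P [b, a])"
  using P_slot[of "[b]" "[]"] by (simp add: numeral_2_eq_2)

lemma P_zero: "P [0] = 0"
  using linear_on_scale[OF P_1_linear C_0, of 0] by simp

lemma multilinear_pair:
  assumes w: "vector_space w"
    and 1: "\<And>b. b \<in> C \<Longrightarrow> linear_on s C w UNIV (\<lambda>a. G a b)"
    and 2: "\<And>a. a \<in> C \<Longrightarrow> linear_on s C w UNIV (G a)"
  shows "multilinear s C w (\<lambda>ts. if length ts = 2 then G (ts ! 0) (ts ! 1) else 0)"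
  unfolding multilinear_def
proof (intro ballI conjI allI)
  interpret W: vector_space w by (fact w)
  fix xs ys a b c assume *: "xs \<in> lists C" "ys \<in> lists C" "a \<in> C"
  have c: "length (xs @ x # ys) \<noteq> 2 \<or> (xs = [] \<and> (\<exists>y\<in>C. ys = [y])) \<or> (ys = [] \<and> (\<exists>y\<in>C. xs = [y]))" for x
    using *(1,2) by (cases xs; cases ys) (auto simp: length_Suc_conv numeral_2_eq_2)
  show "(if length (xs @ s c a # ys) = 2 then G ((xs @ s c a # ys) ! 0) ((xs @ s c a # ys) ! 1) else 0)
      = w c (if length (xs @ a # ys) = 2 then G ((xs @ a # ys) ! 0) ((xs @ a # ys) ! 1) else 0)"
    using c[of a] * linear_on_scale[OF 1] linear_on_scale[OF 2] by auto
  assume b: "b \<in> C"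
  show "(if length (xs @ (a + b) # ys) = 2 then G ((xs @ (a + b) # ys) ! 0) ((xs @ (a + b) # ys) ! 1) else 0)
      = (if length (xs @ a # ys) = 2 then G ((xs @ a # ys) ! 0) ((xs @ a # ys) ! 1) else 0)
      + (if length (xs @ b # ys) = 2 then G ((xs @ b # ys) ! 0) ((xs @ b # ys) ! 1) else 0)"
    using c[of a] * b linear_on_add[OF 1] linear_on_add[OF 2] by auto
qed

text \<open>Each axiom of a braiding is an equation on one tensor power, and operators between fixed
  degrees are determined there.\<close>

lemma strict_braided_op_of:
  assumes "braiding s C \<sigma>"
  shows "strict_braided eT tame LT RT (op_of 2 \<sigma>)"
proof
  have \<sigma>: "flinear (Tn 2) (Tn 2) \<sigma>" and bij: "bij_betw \<sigma> (Tn 2) (Tn 2)"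
    and braid: "\<And>t. t \<in> Tn 3 \<Longrightarrow> tmap s C 2 1 \<sigma> id (tmap s C 1 2 id \<sigma> (tmap s C 2 1 \<sigma> id t))
      = tmap s C 1 2 id \<sigma> (tmap s C 2 1 \<sigma> id (tmap s C 1 2 id \<sigma> t))"
    using assms by (auto simp: braiding_def Let_def)
  note \<sigma>' = linear_on_Tn_TC[OF \<sigma>]
  show S: "W.hom 2 2 (op_of 2 \<sigma>)" by (rule hom_op_of[OF \<sigma>])
  have R: "W.hom 3 3 (RT 1 (op_of 2 \<sigma>))" and L: "W.hom 3 3 (LT 1 (op_of 2 \<sigma>))"
    by (rule W.hom_cast[OF W.hom_R[OF S]] W.hom_cast[OF W.hom_L[OF S]]; simp)+
  have l: "tmap s C 2 1 \<sigma> id t = ap (RT 1 (op_of 2 \<sigma>)) t" and r: "tmap s C 1 2 id \<sigma> t = ap (LT 1 (op_of 2 \<sigma>)) t"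
    if "t \<in> Tn 3" for t
  proof -
    have "t \<in> Tn (2 + 1)" "t \<in> Tn (1 + 2)" using that by (simp_all add: numeral_3_eq_3)
    then show "tmap s C 2 1 \<sigma> id t = ap (RT 1 (op_of 2 \<sigma>)) t" "tmap s C 1 2 id \<sigma> t = ap (LT 1 (op_of 2 \<sigma>)) t"
      using tmap_left[OF \<sigma>'] tmap_right[OF \<sigma>'] by blast+
  qed
  show "RT 1 (op_of 2 \<sigma>) * LT 1 (op_of 2 \<sigma>) * RT 1 (op_of 2 \<sigma>) =
      LT 1 (op_of 2 \<sigma>) * RT 1 (op_of 2 \<sigma>) * LT 1 (op_of 2 \<sigma>)"
  proof (rule hom_eqI[OF W.hom_mult[OF W.hom_mult[OF R L] R] W.hom_mult[OF W.hom_mult[OF L R] L]])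
    fix xs assume "xs \<in> lists C" "length xs = 3"
    then have t: "P xs \<in> Tn 3" by (rule P_in_Tn')
    show "ap (RT 1 (op_of 2 \<sigma>) * LT 1 (op_of 2 \<sigma>) * RT 1 (op_of 2 \<sigma>)) (P xs)
        = ap (LT 1 (op_of 2 \<sigma>) * RT 1 (op_of 2 \<sigma>) * LT 1 (op_of 2 \<sigma>)) (P xs)"
      using braid[OF t] by (simp only: l r t hom_in_Tn[OF R] hom_in_Tn[OF L] ap_mult)
  qed
  let ?i = "inv_into (Tn 2) \<sigma>"
  have i: "flinear (Tn 2) (Tn 2) ?i"
    by (rule linear_on_inv_into[OF \<sigma> bij]) auto
  note S' = hom_op_of[OF i]
  have *: "ap (op_of 2 \<sigma>) t = \<sigma> t" "ap (op_of 2 ?i) t = ?i t" "\<sigma> t \<in> Tn 2" "?i t \<in> Tn 2"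
    "\<sigma> (?i t) = t" "?i (\<sigma> t) = t"
    if "t \<in> Tn 2" for t
    using that op_of_Tn[OF \<sigma>'] op_of_Tn[OF linear_on_Tn_TC[OF i]] linear_on_in[OF \<sigma>] linear_on_in[OF i] bij
    by (auto simp: bij_betw_def f_inv_into_f)
  have "op_of 2 \<sigma> * op_of 2 ?i = eT 2" "op_of 2 ?i * op_of 2 \<sigma> = eT 2"
    by (rule hom_eqI[OF W.hom_mult[OF S S'] W.hom_e] hom_eqI[OF W.hom_mult[OF S' S] W.hom_e],
        simp add: ap_mult eT_P P_in_Tn' *)+
  then show "\<exists>S'. W.hom 2 2 S' \<and> op_of 2 \<sigma> * S' = eT 2 \<and> S' * op_of 2 \<sigma> = eT 2"
    using S' by blast
qed

end

locale braided_space = V: tensor_space s UNIV for s :: "'k::field \<Rightarrow> 'v::ab_group_add \<Rightarrow> 'v" +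
  fixes \<sigma> :: "('v, 'k) tensor \<Rightarrow> ('v, 'k) tensor"
  assumes braiding: "braiding s UNIV \<sigma>"
begin

sublocale B: strict_braided V.eT V.tame V.LT V.RT "V.op_of 2 \<sigma>"
  by (rule V.strict_braided_op_of[OF braiding])

sublocale T: tensor_space "fscale :: 'k \<Rightarrow> ('v, 'k) tensor \<Rightarrow> ('v, 'k) tensor" "TV s"
proof
  show "V.F.subspace (TV s)" by (rule V.subspace_TC)
qed

lemma \<sigma>_linear: "flinear (V.Tn 2) (V.Tn 2) \<sigma>"
  using braiding by (auto simp: braiding_def Let_def)

lemma sigma_at_eq:
  assumes j: "j \<in> {1..<n}" and t: "t \<in> V.Tn n"
  shows "sigma_at s \<sigma> n j t = ap (B.sig n j) t"
proof -
  note \<sigma>' = V.linear_on_Tn_TC[OF \<sigma>_linear]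
  have j1: "j - 1 + 2 = j + 1" using j by simp
  have lin: "flinear (V.Tn (j + 1)) (V.Tn (j + 1)) (tmap s UNIV (j - 1) 2 id \<sigma>)"
    using V.tmap_in_Tn[OF V.linear_on_id_Tn \<sigma>_linear, of _ "j - 1"] unfolding j1
    by (intro linear_on_mono[OF V.tmap_linear_on[OF V.id_flinear \<sigma>', of UNIV]]) auto
  have eq: "V.op_of (j + 1) (tmap s UNIV (j - 1) 2 id \<sigma>) = V.LT (j - 1) (V.op_of 2 \<sigma>)"
  proof (rule V.hom_eqI[OF V.hom_op_of[OF lin]])
    show "V.W.hom (j + 1) (j + 1) (V.LT (j - 1) (V.op_of 2 \<sigma>))"
      using V.W.hom_L[OF B.hom_S, of "j - 1"] by (simp only: j1)
    fix xs :: "'v list" assume xs: "length xs = j + 1"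
    then have P: "V.P xs \<in> V.Tn (j - 1 + 2)" "V.P xs \<in> V.Tn (j + 1)" using j1 by (auto intro!: V.P_in_Tn')
    show "ap (V.op_of (j + 1) (tmap s UNIV (j - 1) 2 id \<sigma>)) (V.P xs) = ap (V.LT (j - 1) (V.op_of 2 \<sigma>)) (V.P xs)"
      using V.tmap_right[OF \<sigma>' P(1)] V.op_of_Tn[OF V.linear_on_Tn_TC[OF lin] P(2)] by simp
  qed
  have n: "j + 1 + (n - j - 1) = n" using j by auto
  show ?thesis
    unfolding sigma_at_def B.sig_def eq[symmetric]
    by (rule V.tmap_left[OF V.linear_on_Tn_TC[OF lin]]) (use t n in simp)
qed

lemma word_prod_sig_eq:
  assumes t: "t \<in> V.Tn n" and js: "set js \<subseteq> {1..<n}"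
  shows "foldr (\<lambda>j f. sigma_at s \<sigma> n j \<circ> f) js id t = ap (word_prod (B.sig n) (V.eT n) js) t
    \<and> ap (word_prod (B.sig n) (V.eT n) js) t \<in> V.Tn n"
  using js
proof (induction js)
  case Nil
  then show ?case using t by (simp add: V.eT_Tn)
next
  case (Cons j js)
  then show ?case using V.hom_in_Tn[OF B.hom_sig, of j n] by (simp add: sigma_at_eq ap_mult)
qed

text \<open>The word chosen in \<open>T_perm\<close> is reduced, so by Matsumoto's theorem the
  product along it equals the recursively built braiding.\<close>

lemma beta_comp_eq:
  assumes t: "t \<in> V.Tn (i + j)"
  shows "beta_comp s \<sigma> i j t = ap (B.b i j) t"
proof -
  let ?js = "SOME js. reduced_word (i + j) (chi i j) js"
  note r = reduced_word_chi_some[of i j]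
  have "set ?js \<subseteq> {1..<i + j}" using r(1) by (simp add: reduced_def)
  from word_prod_sig_eq[OF t this] show ?thesis
    by (simp add: beta_comp_def T_perm_def B.word_prod_chi[OF r])
qed

lemma liftTT_bilift:
  assumes w: "vector_space w" and g: "V.bimultilinear w g"
  shows "linear_on fscale A w UNIV (liftTT s w (bilift s UNIV w g))"
    and "x \<in> TV s \<Longrightarrow> y \<in> TV s \<Longrightarrow>
      liftTT s w (bilift s UNIV w g) (tensorT s [x, y]) = bilift s UNIV w g x y"
    and "liftTT s w (bilift s UNIV w g) (tensorT s [V.P xs, V.P ys]) = g xs ys"
proof -
  have ml: "multilinear fscale (TV s) w
      (\<lambda>ts. if length ts = 2 then bilift s UNIV w g (ts ! 0) (ts ! 1) else 0)"
    by (rule T.multilinear_pair[OF w])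
      (auto intro: V.linear_on_bilift_left[OF w g] V.linear_on_bilift_right[OF w g])
  show "linear_on fscale A w UNIV (liftTT s w (bilift s UNIV w g))"
    by (rule T.linear_on_lift[OF w ml])
  show 2: "liftTT s w (bilift s UNIV w g) (tensorT s [x, y]) = bilift s UNIV w g x y"
    if "x \<in> TV s" "y \<in> TV s" for x y
    using T.lift_P[OF w ml, of "[x, y]"] that by simp
  show "liftTT s w (bilift s UNIV w g) (tensorT s [V.P xs, V.P ys]) = g xs ys"
    by (subst 2) (simp_all add: V.bilift_P[OF w g])
qed

lemma T2_eq:
  assumes f: "flinear (T.Tn 2) UNIV f" and g: "flinear (T.Tn 2) UNIV g"
    and eq: "\<And>xs ys. f (tensorT s [V.P xs, V.P ys]) = g (tensorT s [V.P xs, V.P ys])"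
    and t: "t \<in> T.Tn 2"
  shows "f t = g t"
proof (rule T.Tn_eq[OF f g _ t])
  have 1: "f (tensorT s [V.P xs, y]) = g (tensorT s [V.P xs, y])" if y: "y \<in> TV s" for xs y
    by (rule V.TC_eq[OF linear_on_compose[OF T.P_2_right f] linear_on_compose[OF T.P_2_right g] vector_space_fscale _ y])
      (simp_all add: eq)
  have 2: "f (tensorT s [x, y]) = g (tensorT s [x, y])" if y: "y \<in> TV s" and x: "x \<in> TV s" for x y
    by (rule V.TC_eq[OF linear_on_compose[OF T.P_2_left f] linear_on_compose[OF T.P_2_left g] vector_space_fscale _ x])
      (simp_all add: 1 y)
  fix xs assume "xs \<in> lists (TV s)" "length xs = 2"
  then show "f (tensorT s xs) = g (tensorT s xs)"
    using 2 by (auto simp: length_Suc_conv numeral_2_eq_2)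
qed

lemma T3_eq:
  assumes f: "flinear (T.Tn 3) UNIV f" and g: "flinear (T.Tn 3) UNIV g"
    and eq: "\<And>xs ys zs. f (tensorT s [V.P xs, V.P ys, V.P zs]) = g (tensorT s [V.P xs, V.P ys, V.P zs])"
    and t: "t \<in> T.Tn 3"
  shows "f t = g t"
proof (rule T.Tn_eq[OF f g _ t])
  have s1: "flinear (TV s) (T.Tn 3) (\<lambda>z. tensorT s [x, y, z])"
    and s2: "flinear (TV s) (T.Tn 3) (\<lambda>z. tensorT s [x, z, y])"
    and s3: "flinear (TV s) (T.Tn 3) (\<lambda>z. tensorT s [z, x, y])"
    if "x \<in> TV s" "y \<in> TV s" for x y
    using T.P_slot[of "[x, y]" "[]"] T.P_slot[of "[x]" "[y]"] T.P_slot[of "[]" "[x, y]"] that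
    by (simp_all add: numeral_3_eq_3)
  have 1: "f (tensorT s [V.P xs, V.P ys, z]) = g (tensorT s [V.P xs, V.P ys, z])" if z: "z \<in> TV s" for xs ys z
    by (rule V.TC_eq[OF linear_on_compose[OF s1 f] linear_on_compose[OF s1 g] vector_space_fscale _ z]) (simp_all add: eq)
  have 2: "f (tensorT s [V.P xs, y, z]) = g (tensorT s [V.P xs, y, z])" if z: "z \<in> TV s" "y \<in> TV s" for xs y z
    by (rule V.TC_eq[OF linear_on_compose[OF s2 f] linear_on_compose[OF s2 g] vector_space_fscale _ z(2)]) (simp_all add: 1 z)
  have 3: "f (tensorT s [x, y, z]) = g (tensorT s [x, y, z])" if z: "z \<in> TV s" "y \<in> TV s" "x \<in> TV s" for x y z
    by (rule V.TC_eq[OF linear_on_compose[OF s3 f] linear_on_compose[OF s3 g] vector_space_fscale _ z(3)]) (simp_all add: 2 z)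
  fix xs assume "xs \<in> lists (TV s)" "length xs = 3"
  then show "f (tensorT s xs) = g (tensorT s xs)"
    using 3 by (auto simp: length_Suc_conv numeral_3_eq_3)
qed

lemma T2_into:
  assumes f: "flinear (T.Tn 2) UNIV f"
    and eq: "\<And>xs ys. f (tensorT s [V.P xs, V.P ys]) \<in> U"
    and U: "module.subspace fscale U" and t: "t \<in> T.Tn 2"
  shows "f t \<in> U"
proof (rule T.linear_on_into_Tn[OF f _ U t])
  have 1: "f (tensorT s [V.P xs, y]) \<in> U" if y: "y \<in> TV s" for xs y
    by (rule V.linear_on_into_TC[OF linear_on_compose[OF T.P_2_right f] _ U y]) (simp_all add: eq)
  have 2: "f (tensorT s [x, y]) \<in> U" if y: "y \<in> TV s" and x: "x \<in> TV s" for x y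
    by (rule V.linear_on_into_TC[OF linear_on_compose[OF T.P_2_left f] _ U x]) (simp_all add: 1 y)
  fix xs assume "xs \<in> lists (TV s)" "length xs = 2"
  then show "f (tensorT s xs) \<in> U"
    using 2 by (auto simp: length_Suc_conv numeral_2_eq_2)
qed

lemma split_at_ml: "multilinear s UNIV fscale (\<lambda>zs. if length zs = i + j
     then tensorT s [V.P (take i zs), V.P (drop i zs)] else 0)"
  by (rule V.multilinear_split[OF vector_space_fscale, where k = "\<lambda>_. i"])
    (auto intro!: V.multilinear_linear_on[OF T.P_2_left V.multilinear_P]
      V.multilinear_linear_on[OF T.P_2_right V.multilinear_P])

lemma split_at_P: "length zs = i + j \<Longrightarrow> split_at s i j (V.P zs) = tensorT s [V.P (take i zs), V.P (drop i zs)]"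
  unfolding split_at_def by (simp add: V.lift_P[OF vector_space_fscale split_at_ml])

lemma split_at_linear: "flinear A UNIV (split_at s i j)"
  unfolding split_at_def by (rule V.linear_on_lift[OF vector_space_fscale split_at_ml])

lemma split_at_in: "t \<in> V.Tn (i + j) \<Longrightarrow> split_at s i j t \<in> T.Tn 2"
  by (rule V.linear_on_into_Tn[OF split_at_linear _ T.subspace_Tn]) (auto simp: split_at_P intro!: T.P_in_Tn')

lemma split_at_in': "split_at s i j t \<in> T.Tn 2" if "t \<in> V.TC"
  by (rule V.linear_on_into_TC[OF split_at_linear _ T.subspace_Tn that])
    (auto simp: split_at_def V.lift_P[OF vector_space_fscale split_at_ml] intro!: T.P_in_Tn')

lemma split_at_linear': "flinear V.TC (T.Tn 2) (split_at s i j)"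
  by (rule linear_on_mono[OF split_at_linear[of UNIV]]) (auto intro: split_at_in')

text \<open>\<open>split_at\<close> undoes concatenation for all homogeneous tensors, not only for
  words. This is needed because values of \<open>st\<close> are in general not words.\<close>

lemma split_at_cat:
  assumes x: "x \<in> V.Tn i" and y: "y \<in> V.Tn j"
  shows "split_at s i j (V.ct x y) = tensorT s [x, y]"
proof -
  have 1: "split_at s i j (V.ct (V.P xs) y) = tensorT s [V.P xs, y]" if "length xs = i" for xs
    by (rule V.Tn_eq[OF linear_on_compose[OF V.cat_right_Tn split_at_linear]
          linear_on_mono[OF T.P_2_right, of _ _ UNIV] _ y])
      (use that V.Tn_subset_TC in \<open>auto simp: V.cat_P split_at_P\<close>)
  show ?thesis
    by (rule V.Tn_eq[OF linear_on_compose[OF V.cat_left split_at_linear]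
          linear_on_mono[OF T.P_2_left, of _ _ UNIV] _ x])
      (use 1 y V.Tn_subset_TC in auto)
qed

lemma bimultilinear_ap_split:
  assumes "\<And>i j. V.tame (F i j)"
  shows "V.bimultilinear fscale (\<lambda>xs ys. split_at s (length ys) (length xs)
       (ap (F (length xs) (length ys)) (V.P (xs @ ys))))"
proof -
  have "flinear V.TC (T.Tn 2) (\<lambda>t. split_at s a b (ap (F i j) t))" for a b i j
    by (rule linear_on_compose[OF V.tame_linear_on[OF assms] split_at_linear'])
  note lin = this
  have *: "multilinear s UNIV fscale (\<lambda>xs. split_at s (a (length xs)) (b (length xs))
      (ap (F (i (length xs)) (j (length xs))) (g xs)))"
    if "multilinear s UNIV fscale g" "\<And>xs. g xs \<in> V.TC" for a b i j g
    by (rule V.multilinear_linear_on_length[where A = "\<lambda>_. V.TC" and B = "\<lambda>_. T.Tn 2" and g = g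
          and f = "\<lambda>n t. split_at s (a n) (b n) (ap (F (i n) (j n)) t)", OF lin that])
  show ?thesis
    unfolding V.bimultilinear_def
  proof (intro conjI ballI)
    fix ys
    show "multilinear s UNIV fscale (\<lambda>xs. split_at s (length ys) (length xs)
       (ap (F (length xs) (length ys)) (V.P (xs @ ys))))"
      using *[of "\<lambda>xs. V.P (xs @ ys)" "\<lambda>_. length ys" "\<lambda>n. n" "\<lambda>n. n" "\<lambda>_. length ys"]
        V.multilinear_append_left[OF V.multilinear_P] by simp
    show "multilinear s UNIV fscale (\<lambda>xs. split_at s (length xs) (length ys)
       (ap (F (length ys) (length xs)) (V.P (ys @ xs))))"
      using *[of "\<lambda>xs. V.P (ys @ xs)" "\<lambda>n. n" "\<lambda>_. length ys" "\<lambda>_. length ys" "\<lambda>n. n"]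
        V.multilinear_append_right[OF V.multilinear_P] by simp
  qed
qed

abbreviation "bt \<equiv> beta s \<sigma>"

lemma beta_bml: "V.bimultilinear fscale (\<lambda>xs ys. split_at s (length ys) (length xs)
     (beta_comp s \<sigma> (length xs) (length ys) (V.P (xs @ ys))))"
proof -
  have "beta_comp s \<sigma> (length xs) (length ys) (V.P (xs @ ys)) = ap (B.b (length xs) (length ys)) (V.P (xs @ ys))"
    for xs ys by (simp add: beta_comp_eq V.P_in_Tn')
  then show ?thesis using bimultilinear_ap_split[of B.b] by simp
qed

lemma beta_linear: "flinear A UNIV bt"
  unfolding beta_def by (rule liftTT_bilift(1)[OF vector_space_fscale beta_bml])

lemma beta_P: "bt (tensorT s [V.P xs, V.P ys]) =
    split_at s (length ys) (length xs) (ap (B.b (length xs) (length ys)) (V.P (xs @ ys)))"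
  unfolding beta_def
  by (subst liftTT_bilift(3)[OF vector_space_fscale beta_bml]) (simp add: beta_comp_eq V.P_in_Tn')

text \<open>On each bidegree \<beta> is the operator \<open>b i j\<close> between two
  identifications. Identities about \<beta> are transferred to the ring of operators through this
  equation.\<close>

lemma beta_split:
  assumes "t \<in> V.Tn (i + j)"
  shows "bt (split_at s i j t) = split_at s j i (ap (B.b i j) t)"
  by (rule V.Tn_eq[OF linear_on_compose[OF split_at_linear beta_linear]
        linear_on_compose[OF V.tame_linear_on split_at_linear] _ assms])
    (simp_all add: split_at_P beta_P)

lemma beta_in_T2: "t \<in> T.Tn 2 \<Longrightarrow> bt t \<in> T.Tn 2"
  by (rule T2_into[OF beta_linear _ T.subspace_Tn])
    (auto simp: beta_P intro!: split_at_in' V.tame_in_TC)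

lemma beta_linear': "flinear (T.Tn 2) (T.Tn 2) bt"
  by (rule linear_on_mono[OF beta_linear[of UNIV]]) (auto intro: beta_in_T2)

end

section \<open>Threefold tensors, the Yang-Baxter equation and the inverse of \<beta>\<close>

context braided_space
begin

abbreviation "tml f \<equiv> tmap fscale (TV s) 2 1 f id"
abbreviation "tmr f \<equiv> tmap fscale (TV s) 1 2 id f"
abbreviation "PT ts \<equiv> tensorT s ts"

lemma PT_cat: "xs \<in> lists (TV s) \<Longrightarrow> ys \<in> lists (TV s) \<Longrightarrow> T.ct (PT xs) (PT ys) = PT (xs @ ys)"
  by (rule T.cat_P)

text \<open>The identification of degree i + j + k with the summand of tridegree (i, j, k), built
  from \<open>split_at\<close> so that multilinearity is inherited.\<close>

definition split3 :: "nat \<Rightarrow> nat \<Rightarrow> nat \<Rightarrow> ('v, 'k) tensor \<Rightarrow> (('v, 'k) tensor, 'k) tensor" where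
  "split3 i j k = lift s UNIV fscale (\<lambda>zs. if length zs = i + j + k
     then T.ct (split_at s i j (V.P (take (i + j) zs))) (PT [V.P (drop (i + j) zs)]) else 0)"

lemma PT_1_linear: "flinear V.TC T.TC (\<lambda>t. PT [t])"
  by (rule T.linear_on_Tn_TC[OF T.P_1_linear])

lemma split_at_TC: "flinear V.TC T.TC (split_at s i j)"
  by (rule T.linear_on_Tn_TC[OF split_at_linear'])

lemma split3_ml: "multilinear s UNIV fscale (\<lambda>zs. if length zs = i + j + k
     then T.ct (split_at s i j (V.P (take (i + j) zs))) (PT [V.P (drop (i + j) zs)]) else 0)"
proof (rule V.multilinear_split[OF vector_space_fscale, where k = "\<lambda>_. i + j"])
  fix xs
  have "split_at s i j (V.P xs) \<in> T.TC" using linear_on_in[OF split_at_TC] by simp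
  then show "multilinear s UNIV fscale (\<lambda>ys. T.ct (split_at s i j (V.P xs)) (PT [V.P ys]))"
    by (intro V.multilinear_linear_on[OF linear_on_compose[OF PT_1_linear T.cat_right] V.multilinear_P]) simp_all
  show "multilinear s UNIV fscale (\<lambda>ys. T.ct (split_at s i j (V.P ys)) (PT [V.P xs]))"
    by (rule V.multilinear_linear_on[OF linear_on_compose[OF split_at_TC T.cat_left] V.multilinear_P]) simp_all
qed

lemma split3_linear: "flinear A UNIV (split3 i j k)"
  unfolding split3_def by (rule V.linear_on_lift[OF vector_space_fscale split3_ml])

lemma split3_P: "length zs = i + j + k \<Longrightarrow> split3 i j k (V.P zs) =
    PT [V.P (take i zs), V.P (take j (drop i zs)), V.P (drop (i + j) zs)]"
  unfolding split3_def
  by (simp add: V.lift_P[OF vector_space_fscale split3_ml] split_at_P PT_cat drop_take min_def)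

lemma split3_cat_left:
  assumes t: "t \<in> V.Tn (i + j)" and z: "z \<in> V.Tn k"
  shows "split3 i j k (V.ct t z) = T.ct (split_at s i j t) (PT [z])"
proof -
  have 1: "split3 i j k (V.ct (V.P ts) z) = T.ct (split_at s i j (V.P ts)) (PT [z])"
    if ts: "length ts = i + j" for ts
    by (rule V.Tn_eq[OF linear_on_compose[OF V.cat_right_Tn split3_linear]
          linear_on_compose[OF linear_on_mono[OF PT_1_linear] T.cat_right] _ z])
      (use ts in \<open>auto simp: V.cat_P split3_P split_at_P PT_cat V.Tn_in_TC\<close>)
  show ?thesis
    by (rule V.Tn_eq[OF linear_on_compose[OF V.cat_left split3_linear]
          linear_on_compose[OF split_at_linear T.cat_left] _ t])
      (use 1 z V.Tn_in_TC in auto)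
qed

text \<open>\<open>split3\<close> groups the first two blocks by definition; that it can also be
  computed by grouping the last two is what maps acting on the right pair need.\<close>

lemma split3_cat_right:
  assumes x: "x \<in> V.Tn i" and t: "t \<in> V.Tn (j + k)"
  shows "split3 i j k (V.ct x t) = T.ct (PT [x]) (split_at s j k t)"
proof -
  have 1: "split3 i j k (V.ct (V.P xs) t) = T.ct (PT [V.P xs]) (split_at s j k t)"
    if xs: "length xs = i" for xs
    by (rule V.Tn_eq[OF linear_on_compose[OF V.cat_right_Tn split3_linear]
          linear_on_compose[OF linear_on_mono[OF split_at_TC] T.cat_right] _ t])
      (use xs linear_on_in[OF split_at_TC] in \<open>auto simp: V.cat_P split3_P split_at_P PT_cat V.Tn_in_TC add.commute\<close>)
  have "split_at s j k t \<in> T.TC" using linear_on_in[OF split_at_TC] t V.Tn_in_TC by blast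
  then show ?thesis
    by (intro V.Tn_eq[OF linear_on_compose[OF V.cat_left split3_linear]
          linear_on_compose[OF linear_on_mono[OF PT_1_linear] T.cat_left[where A = UNIV]] _ x])
      (use 1 t V.Tn_in_TC in auto)
qed

lemma split3_words: "PT [V.P xs, V.P ys, V.P zs] = split3 (length xs) (length ys) (length zs) (V.P (xs @ ys @ zs))"
  by (simp add: split3_P)

lemma tmap_PT_left:
  assumes f: "flinear (T.Tn 2) T.TC f" and "a \<in> TV s" "b \<in> TV s" "c \<in> TV s"
  shows "tml f (PT [a, b, c]) = T.ct (f (PT [a, b])) (PT [c])"
  using T.tmap_P[OF f T.id_flinear, of "[a, b, c]" 1] assms by simp

lemma tmap_PT_right:
  assumes f: "flinear (T.Tn 2) T.TC f" and "a \<in> TV s" "b \<in> TV s" "c \<in> TV s"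
  shows "tmr f (PT [a, b, c]) = T.ct (PT [a]) (f (PT [b, c]))"
  using T.tmap_P[OF T.id_flinear f, of "[a, b, c]" 1] assms by simp

lemma beta_TC: "flinear (T.Tn 2) T.TC bt"
  by (rule T.linear_on_Tn_TC[OF beta_linear'])

text \<open>After evaluation on a word, \<beta> on the first two blocks is
  \<open>beta_split\<close>. Its value need not be a word, and \<open>split3_cat_left\<close> puts
  the third block back.\<close>

lemma tmap_beta_left:
  assumes t: "t \<in> V.Tn (i + j + k)"
  shows "tml bt (split3 i j k t) = split3 j i k (ap (V.RT k (B.b i j)) t)"
proof (rule V.Tn_eq[OF linear_on_compose[OF split3_linear T.tmap_linear_on]
      linear_on_compose[OF V.tame_linear_on split3_linear] _ t])
  fix zs :: "'v list" assume zs: "length zs = i + j + k"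
  have b: "ap (B.b i j) (V.P (take (i + j) zs)) \<in> V.Tn (j + i)" by (rule V.hom_in_Tn[OF B.hom_b])
  have "tml bt (split3 i j k (V.P zs))
      = T.ct (bt (split_at s i j (V.P (take (i + j) zs)))) (PT [V.P (drop (i + j) zs)])"
    using zs tmap_PT_left[OF beta_TC] by (simp add: split3_P split_at_P drop_take min_def)
  also have "\<dots> = T.ct (split_at s j i (ap (B.b i j) (V.P (take (i + j) zs)))) (PT [V.P (drop (i + j) zs)])"
    using zs by (simp add: beta_split V.P_in_Tn')
  also have "\<dots> = split3 j i k (V.ct (ap (B.b i j) (V.P (take (i + j) zs))) (V.P (drop (i + j) zs)))"
    using zs by (simp add: split3_cat_left[OF b] V.P_in_Tn')
  also have "\<dots> = split3 j i k (ap (V.RT k (B.b i j)) (V.P zs))"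
    using zs by (simp add: V.RT_P)
  finally show "tml bt (split3 i j k (V.P zs)) = split3 j i k (ap (V.RT k (B.b i j)) (V.P zs))" .
qed (use beta_linear' T.linear_on_id_Tn T.linear_on_Tn_TC in auto)

lemma tmap_beta_right:
  assumes t: "t \<in> V.Tn (i + j + k)"
  shows "tmr bt (split3 i j k t) = split3 i k j (ap (V.LT i (B.b j k)) t)"
proof (rule V.Tn_eq[OF linear_on_compose[OF split3_linear T.tmap_linear_on]
      linear_on_compose[OF V.tame_linear_on split3_linear] _ t])
  fix zs :: "'v list" assume zs: "length zs = i + j + k"
  have b: "ap (B.b j k) (V.P (drop i zs)) \<in> V.Tn (k + j)" by (rule V.hom_in_Tn[OF B.hom_b])
  have "tmr bt (split3 i j k (V.P zs))
      = T.ct (PT [V.P (take i zs)]) (bt (split_at s j k (V.P (drop i zs))))"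
    using zs tmap_PT_right[OF beta_TC] by (simp add: split3_P split_at_P drop_take min_def add.commute)
  also have "\<dots> = T.ct (PT [V.P (take i zs)]) (split_at s k j (ap (B.b j k) (V.P (drop i zs))))"
    using zs by (simp add: beta_split V.P_in_Tn')
  also have "\<dots> = split3 i k j (V.ct (V.P (take i zs)) (ap (B.b j k) (V.P (drop i zs))))"
    using zs by (simp add: split3_cat_right[OF _ b] V.P_in_Tn')
  also have "\<dots> = split3 i k j (ap (V.LT i (B.b j k)) (V.P zs))"
    using zs by (simp add: V.LT_P)
  finally show "tmr bt (split3 i j k (V.P zs)) = split3 i k j (ap (V.LT i (B.b j k)) (V.P zs))" .
qed (use beta_linear' T.linear_on_id_Tn T.linear_on_Tn_TC in auto)

lemma tmap_beta_left_linear: "flinear (T.Tn 3) (T.Tn 3) (tml bt)"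
  using T.tmap_in_Tn[OF beta_linear' T.linear_on_id_Tn[of 1]]
  by (intro linear_on_mono[OF T.tmap_linear_on[OF T.linear_on_Tn_TC[OF beta_linear'] T.id_flinear, of UNIV]])
    simp_all

lemma tmap_beta_right_linear: "flinear (T.Tn 3) (T.Tn 3) (tmr bt)"
proof -
  have "1 + 2 = (3::nat)" by simp
  then show ?thesis
    using T.tmap_in_Tn[OF T.linear_on_id_Tn[of 1] beta_linear']
    by (intro linear_on_mono[OF T.tmap_linear_on[OF T.id_flinear T.linear_on_Tn_TC[OF beta_linear'], of UNIV]])
      (simp_all only: UNIV_I subset_UNIV)
qed

text \<open>Both sides are linear, so triples of words suffice; there the equation is
  \<open>yang_baxter\<close> applied to the concatenated word.\<close>

lemma beta_yang_baxter:
  assumes t: "t \<in> T.Tn 3"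
  shows "tml bt (tmr bt (tml bt t))
      = tmr bt (tml bt (tmr bt t))"
proof -
  let ?l = "tml bt" and ?r = "tmr bt"
  note l = tmap_beta_left_linear and r = tmap_beta_right_linear
  have 3: "flinear (T.Tn 3) UNIV (\<lambda>t. ?l (?r (?l t)))"
    using linear_on_compose[OF linear_on_compose[OF l r] l] by (simp add: linear_on_def)
  have 4: "flinear (T.Tn 3) UNIV (\<lambda>t. ?r (?l (?r t)))"
    using linear_on_compose[OF linear_on_compose[OF r l] r] by (simp add: linear_on_def)
  show ?thesis
  proof (rule T3_eq[OF 3 4 _ t])
    fix xs ys zs
    let ?i = "length xs" and ?j = "length ys" and ?k = "length zs" and ?t = "V.P (xs @ ys @ zs)"
    have t: "?t \<in> V.Tn (?i + ?j + ?k)" by (simp add: V.P_in_Tn')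
    have 1: "ap (V.RT k (B.b i j)) u \<in> V.Tn (j + i + k)" for i j k u
      by (rule V.hom_in_Tn[OF V.W.hom_R[OF B.hom_b]])
    have 2: "ap (V.LT i (B.b j k)) u \<in> V.Tn (i + k + j)" for i j k u
      using V.hom_in_Tn[OF V.W.hom_L[OF B.hom_b]] by (simp add: add.assoc)
    show "?l (?r (?l (PT [V.P xs, V.P ys, V.P zs]))) = ?r (?l (?r (PT [V.P xs, V.P ys, V.P zs])))"
      unfolding split3_words
      using arg_cong[OF B.yang_baxter[of ?i ?j ?k], of "\<lambda>f. ap f ?t"]
      by (simp only: tmap_beta_left tmap_beta_right t 1 2 ap_mult)
  qed
qed

definition b_inv :: "nat \<Rightarrow> nat \<Rightarrow> ('v list \<Rightarrow> 'k, 'k) endo" where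
  "b_inv i j = (SOME g. V.W.hom (j + i) (i + j) g \<and> B.b i j * g = V.eT (j + i) \<and> g * B.b i j = V.eT (i + j))"

lemma b_inv: "V.W.hom (j + i) (i + j) (b_inv i j)" "B.b i j * b_inv i j = V.eT (j + i)"
    "b_inv i j * B.b i j = V.eT (i + j)"
proof -
  have "\<exists>g. V.W.hom (j + i) (i + j) g \<and> B.b i j * g = V.eT (j + i) \<and> g * B.b i j = V.eT (i + j)"
    using B.iso_b[of i j] unfolding B.iso_def by blast
  from someI_ex[OF this] show "V.W.hom (j + i) (i + j) (b_inv i j)" "B.b i j * b_inv i j = V.eT (j + i)"
    "b_inv i j * B.b i j = V.eT (i + j)"
    unfolding b_inv_def by blast+
qed

text \<open>The indices of \<open>b_inv\<close> are swapped because the summand of bidegree (i, j)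
  is the target of \<beta> on bidegree (j, i).\<close>

definition beta_inv :: "(('v, 'k) tensor, 'k) tensor \<Rightarrow> (('v, 'k) tensor, 'k) tensor" where
  "beta_inv = liftTT s fscale (bilift s UNIV fscale (\<lambda>xs ys.
     split_at s (length ys) (length xs) (ap (b_inv (length ys) (length xs)) (V.P (xs @ ys)))))"

lemma tame_b_inv: "V.tame (b_inv i j)"
  using b_inv(1) by (rule V.W.hom_A)

lemma beta_inv_linear: "flinear A UNIV beta_inv"
  unfolding beta_inv_def
  by (rule liftTT_bilift(1)[OF vector_space_fscale bimultilinear_ap_split[where F = "\<lambda>i j. b_inv j i"]])
    (rule tame_b_inv)

lemma beta_inv_P: "beta_inv (PT [V.P xs, V.P ys]) =
    split_at s (length ys) (length xs) (ap (b_inv (length ys) (length xs)) (V.P (xs @ ys)))"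
  unfolding beta_inv_def
  by (rule liftTT_bilift(3)[OF vector_space_fscale bimultilinear_ap_split[where F = "\<lambda>i j. b_inv j i"]])
    (rule tame_b_inv)

lemma beta_inv_split:
  assumes "t \<in> V.Tn (j + i)"
  shows "beta_inv (split_at s j i t) = split_at s i j (ap (b_inv i j) t)"
  by (rule V.Tn_eq[OF linear_on_compose[OF split_at_linear beta_inv_linear]
        linear_on_compose[OF V.tame_linear_on split_at_linear] _ assms])
    (simp_all add: split_at_P beta_inv_P tame_b_inv)

lemma beta_inv_in_T2: "t \<in> T.Tn 2 \<Longrightarrow> beta_inv t \<in> T.Tn 2"
  by (rule T2_into[OF beta_inv_linear _ T.subspace_Tn])
    (auto simp: beta_inv_P tame_b_inv intro!: split_at_in' V.tame_in_TC)

lemma beta_inv_linear': "flinear (T.Tn 2) (T.Tn 2) beta_inv"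
  by (rule linear_on_mono[OF beta_inv_linear[of UNIV]]) (auto intro: beta_inv_in_T2)

lemma split2_words: "PT [V.P xs, V.P ys] = split_at s (length xs) (length ys) (V.P (xs @ ys))"
  by (simp add: split_at_P)

lemma id_T2: "flinear (T.Tn 2) UNIV (\<lambda>x. x)"
  by (simp add: linear_on_def)

lemma beta_bij: "bij_betw bt (T.Tn 2) (T.Tn 2)"
proof (rule bij_betw_byWitness[where f' = beta_inv])
  show "bt ` T.Tn 2 \<subseteq> T.Tn 2" "beta_inv ` T.Tn 2 \<subseteq> T.Tn 2"
    using beta_in_T2 beta_inv_in_T2 by auto
  show "\<forall>t\<in>T.Tn 2. beta_inv (bt t) = t"
  proof
    fix t assume t: "t \<in> T.Tn 2"
    show "beta_inv (bt t) = t"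
    proof (rule T2_eq[OF linear_on_compose[OF beta_linear' beta_inv_linear] id_T2 _ t])
      fix xs ys
      show "beta_inv (bt (PT [V.P xs, V.P ys])) = PT [V.P xs, V.P ys]"
        unfolding split2_words
        by (simp add: beta_split beta_inv_split V.P_in_Tn' V.hom_in_Tn[OF B.hom_b] V.eT_P b_inv
            flip: ap_mult)
    qed
  qed
  show "\<forall>t\<in>T.Tn 2. bt (beta_inv t) = t"
  proof
    fix t assume t: "t \<in> T.Tn 2"
    show "bt (beta_inv t) = t"
    proof (rule T2_eq[OF linear_on_compose[OF beta_inv_linear' beta_linear] id_T2 _ t])
      fix xs ys
      show "bt (beta_inv (PT [V.P xs, V.P ys])) = PT [V.P xs, V.P ys]"
        unfolding split2_words
        by (simp add: beta_split beta_inv_split V.P_in_Tn' V.hom_in_Tn[OF b_inv(1)] V.eT_P b_inv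
            flip: ap_mult)
    qed
  qed
qed

theorem braiding_beta: "braiding fscale (TV s) bt"
  unfolding braiding_def Let_def using beta_linear' beta_bij beta_yang_baxter by blast

lemma beta_unit:
  assumes "a \<in> TV s"
  shows "bt (PT [unitT s, a]) = PT [a, unitT s]" "bt (PT [a, unitT s]) = PT [unitT s, a]"
proof -
  have u: "unitT s \<in> TV s" by simp
  show "bt (PT [unitT s, a]) = PT [a, unitT s]"
    by (rule V.TC_eq[OF linear_on_compose[OF T.P_2_right[OF u] beta_linear] linear_on_compose[OF T.P_2_left[OF u] id_T2]
          vector_space_fscale _ assms]) (simp add: beta_P V.eT_P split_at_P)
  show "bt (PT [a, unitT s]) = PT [unitT s, a]"
    by (rule V.TC_eq[OF linear_on_compose[OF T.P_2_left[OF u] beta_linear] linear_on_compose[OF T.P_2_right[OF u] id_T2]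
          vector_space_fscale _ assms]) (simp add: beta_P V.eT_P split_at_P)
qed

end

section \<open>The coproduct and the powers of \<open>M\<close>\<close>

lemma sum_dec: "(\<Sum>(a, c)\<in>dec n. F a c) = (\<Sum>a\<le>n. F a (n - a))"
  by (rule sum.reindex_bij_witness[where j = fst and i = "\<lambda>a. (a, n - a)"]) auto

locale multibrace_space =
  fixes s :: "'k::field \<Rightarrow> 'v::ab_group_add \<Rightarrow> 'v"
    and M :: "nat \<Rightarrow> nat \<Rightarrow> ('v, 'k) tensor \<Rightarrow> 'v"
    and \<sigma> :: "('v, 'k) tensor \<Rightarrow> ('v, 'k) tensor"
  assumes qmb: "quantum_multibrace s M \<sigma>"

sublocale multibrace_space \<subseteq> braided_space s \<sigma>
proof -
  have "vector_space s" "braiding s UNIV \<sigma>" using qmb by (auto simp: quantum_multibrace_def Let_def)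
  then interpret vector_space s by simp
  show "braided_space s \<sigma>"
    by unfold_locales (use \<open>braiding s UNIV \<sigma>\<close> in auto)
qed

context multibrace_space
begin

lemmas qmb_conj = qmb[unfolded quantum_multibrace_def Let_def]

lemma M_linear: "linear_on fscale (V.Tn (p + q)) s UNIV (M p q)"
  using qmb_conj[THEN conjunct2, THEN conjunct2, THEN conjunct1] by blast

lemma M_0_0: "t \<in> V.Tn 0 \<Longrightarrow> M 0 0 t = 0"
  using qmb_conj[THEN conjunct2, THEN conjunct2, THEN conjunct2, THEN conjunct1] by blast

lemma M_1_0: "M 1 0 (V.P [v]) = v" "M 0 1 (V.P [v]) = v"
  using qmb_conj[THEN conjunct2, THEN conjunct2, THEN conjunct2, THEN conjunct2, THEN conjunct1] by blast+

lemma M_n_0: "n \<ge> 2 \<Longrightarrow> t \<in> V.Tn n \<Longrightarrow> M n 0 t = 0" "n \<ge> 2 \<Longrightarrow> t \<in> V.Tn n \<Longrightarrow> M 0 n t = 0"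
  using qmb_conj[THEN conjunct2, THEN conjunct2, THEN conjunct2, THEN conjunct2, THEN conjunct2, THEN conjunct1] by blast+

lemma M_natr: "i \<ge> 1 \<Longrightarrow> j \<ge> 1 \<Longrightarrow> k \<ge> 1 \<Longrightarrow> t \<in> V.Tn (i + j + k) \<Longrightarrow>
     beta_comp s \<sigma> 1 k (tmap s UNIV (i + j) k (\<lambda>t. V.P [M i j t]) id t)
           = tmap s UNIV k (i + j) id (\<lambda>t. V.P [M i j t]) (beta_comp s \<sigma> (i + j) k t)"
  using qmb_conj[THEN conjunct2, THEN conjunct2, THEN conjunct2, THEN conjunct2, THEN conjunct2, THEN conjunct2, THEN conjunct1] by blast

lemma M_natl: "i \<ge> 1 \<Longrightarrow> j \<ge> 1 \<Longrightarrow> k \<ge> 1 \<Longrightarrow> t \<in> V.Tn (i + j + k) \<Longrightarrow>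
     beta_comp s \<sigma> i 1 (tmap s UNIV i (j + k) id (\<lambda>t. V.P [M j k t]) t)
           = tmap s UNIV (j + k) i (\<lambda>t. V.P [M j k t]) id (beta_comp s \<sigma> i (j + k) t)"
  using qmb_conj[THEN conjunct2, THEN conjunct2, THEN conjunct2, THEN conjunct2, THEN conjunct2, THEN conjunct2, THEN conjunct2, THEN conjunct1] by blast

lemma M_assoc: "i \<ge> 1 \<Longrightarrow> j \<ge> 1 \<Longrightarrow> k \<ge> 1 \<Longrightarrow> x \<in> V.Tn i \<Longrightarrow> y \<in> V.Tn j \<Longrightarrow> z \<in> V.Tn k \<Longrightarrow>
  (\<Sum>r = 1..i + j. M r k (V.ct (brace_power s M r (coprod_iter s \<sigma> (r - 1) (PT [x, y]))) z))
   = (\<Sum>l = 1..j + k. M i l (V.ct x (brace_power s M l (coprod_iter s \<sigma> (l - 1) (PT [y, z])))))"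
  using qmb_conj[THEN conjunct2, THEN conjunct2, THEN conjunct2, THEN conjunct2, THEN conjunct2, THEN conjunct2, THEN conjunct2, THEN conjunct2] by blast

text \<open>Values in V are placed in degree one, so that brackets can be composed and whiskered
  like the braiding.\<close>

definition Mop :: "nat \<Rightarrow> nat \<Rightarrow> ('v list \<Rightarrow> 'k, 'k) endo" where
  "Mop i j = V.op_of (i + j) (\<lambda>t. V.P [M i j t])"

lemma PM_linear: "flinear (V.Tn (p + q)) (V.Tn 1) (\<lambda>t. V.P [M p q t])"
  by (rule linear_on_compose[OF M_linear V.P_1_linear])

lemma hom_Mop: "V.W.hom (i + j) 1 (Mop i j)"
  unfolding Mop_def by (rule V.hom_op_of[OF PM_linear])

lemma Mop_Tn: "t \<in> V.Tn (i + j) \<Longrightarrow> ap (Mop i j) t = V.P [M i j t]"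
  unfolding Mop_def by (rule V.op_of_Tn[OF V.linear_on_Tn_TC[OF PM_linear]])

lemma tame_Mop [simp]: "V.tame (Mop i j)"
  using hom_Mop by (rule V.W.hom_A)

text \<open>The unit and naturality conditions on \<open>M\<close>, restated for operators:
  \<open>tmap\<close> becomes whiskering and \<open>beta_comp\<close> becomes
  \<open>b\<close>.\<close>

sublocale C: multibrace_core V.eT V.tame V.LT V.RT "V.op_of 2 \<sigma>" Mop
proof
  fix i j k n :: nat
  show "V.W.hom (i + j) 1 (Mop i j)" by (rule hom_Mop)
  show "Mop 0 0 = 0"
    by (rule V.hom_eqI[OF hom_Mop V.W.hom_zero]) (simp add: Mop_Tn V.P_in_Tn' M_0_0 V.P_zero ap_0)
  show "Mop 1 0 = V.eT 1"
  proof (rule V.hom_eqI[OF hom_Mop])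
    show "V.W.hom (1 + 0) 1 (V.eT 1)" by simp
    fix xs :: "'v list" assume "length xs = 1 + 0"
    then obtain v where "xs = [v]" by (auto simp: length_Suc_conv)
    then show "ap (Mop 1 0) (V.P xs) = ap (V.eT 1) (V.P xs)"
      using Mop_Tn[of "V.P [v]" 1 0] M_1_0(1)[of v] by (simp add: V.P_in_Tn' V.eT_P)
  qed
  show "Mop 0 1 = V.eT 1"
  proof (rule V.hom_eqI[OF hom_Mop])
    show "V.W.hom (0 + 1) 1 (V.eT 1)" by simp
    fix xs :: "'v list" assume "length xs = 0 + 1"
    then obtain v where "xs = [v]" by (auto simp: length_Suc_conv)
    then show "ap (Mop 0 1) (V.P xs) = ap (V.eT 1) (V.P xs)"
      using Mop_Tn[of "V.P [v]" 0 1] M_1_0(2)[of v] by (simp add: V.P_in_Tn' V.eT_P)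
  qed
  show "2 \<le> n \<Longrightarrow> Mop n 0 = 0"
    by (rule V.hom_eqI[OF hom_Mop V.W.hom_zero]) (simp add: Mop_Tn V.P_in_Tn' M_n_0 V.P_zero ap_0)
  show "2 \<le> n \<Longrightarrow> Mop 0 n = 0"
    by (rule V.hom_eqI[OF hom_Mop V.W.hom_zero]) (simp add: Mop_Tn V.P_in_Tn' M_n_0 V.P_zero ap_0)
  assume ijk: "1 \<le> i" "1 \<le> j" "1 \<le> k"
  note PM = V.linear_on_Tn_TC[OF PM_linear]
  show "B.b 1 k * V.RT k (Mop i j) = V.LT k (Mop i j) * B.b (i + j) k"
  proof (rule V.hom_eqI)
    show "V.W.hom (i + j + k) (k + 1) (B.b 1 k * V.RT k (Mop i j))"
      by (rule V.W.hom_mult[OF B.hom_b V.W.hom_R[OF hom_Mop]])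
    show "V.W.hom (i + j + k) (k + 1) (V.LT k (Mop i j) * B.b (i + j) k)"
      by (rule V.W.hom_mult[OF V.W.hom_L[OF hom_Mop] B.hom_b])
    fix xs :: "'v list" assume "length xs = i + j + k"
    then have t: "V.P xs \<in> V.Tn (i + j + k)" by (simp add: V.P_in_Tn')
    have "tmap s UNIV (i + j) k (\<lambda>t. V.P [M i j t]) id (V.P xs) = ap (V.RT k (Mop i j)) (V.P xs)"
      unfolding Mop_def by (rule V.tmap_left[OF PM t])
    moreover have "ap (V.RT k (Mop i j)) (V.P xs) \<in> V.Tn (1 + k)"
      by (rule V.hom_in_Tn[OF V.W.hom_R[OF hom_Mop]])
    moreover have "tmap s UNIV k (i + j) id (\<lambda>t. V.P [M i j t]) u = ap (V.LT k (Mop i j)) u"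
      if "u \<in> V.Tn (k + (i + j))" for u
      unfolding Mop_def by (rule V.tmap_right[OF PM that])
    moreover have "ap (B.b (i + j) k) (V.P xs) \<in> V.Tn (k + (i + j))"
      by (rule V.hom_in_Tn[OF B.hom_b])
    ultimately show "ap (B.b 1 k * V.RT k (Mop i j)) (V.P xs) = ap (V.LT k (Mop i j) * B.b (i + j) k) (V.P xs)"
      using M_natr[OF ijk t] by (simp only: beta_comp_eq t ap_mult)
  qed
  show "B.b i 1 * V.LT i (Mop j k) = V.RT i (Mop j k) * B.b i (j + k)"
  proof (rule V.hom_eqI)
    show "V.W.hom (i + (j + k)) (1 + i) (B.b i 1 * V.LT i (Mop j k))"
      by (rule V.W.hom_mult[OF B.hom_b V.W.hom_L[OF hom_Mop]])
    show "V.W.hom (i + (j + k)) (1 + i) (V.RT i (Mop j k) * B.b i (j + k))"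
      by (rule V.W.hom_mult[OF V.W.hom_R[OF hom_Mop] B.hom_b])
    fix xs :: "'v list" assume "length xs = i + (j + k)"
    then have t: "V.P xs \<in> V.Tn (i + (j + k))" "V.P xs \<in> V.Tn (i + j + k)" by (simp_all add: V.P_in_Tn')
    have "tmap s UNIV i (j + k) id (\<lambda>t. V.P [M j k t]) (V.P xs) = ap (V.LT i (Mop j k)) (V.P xs)"
      unfolding Mop_def by (rule V.tmap_right[OF PM t(1)])
    moreover have "ap (V.LT i (Mop j k)) (V.P xs) \<in> V.Tn (i + 1)"
      by (rule V.hom_in_Tn[OF V.W.hom_L[OF hom_Mop]])
    moreover have "tmap s UNIV (j + k) i (\<lambda>t. V.P [M j k t]) id u = ap (V.RT i (Mop j k)) u"
      if "u \<in> V.Tn (j + k + i)" for u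
      unfolding Mop_def by (rule V.tmap_left[OF PM that])
    moreover have "ap (B.b i (j + k)) (V.P xs) \<in> V.Tn (j + k + i)"
      by (rule V.hom_in_Tn[OF B.hom_b])
    ultimately show "ap (B.b i 1 * V.LT i (Mop j k)) (V.P xs) = ap (V.RT i (Mop j k) * B.b i (j + k)) (V.P xs)"
      using M_natl[OF ijk t(2)] by (simp only: beta_comp_eq t ap_mult)
  qed
qed

lemma split_at_sum_linear: "flinear V.TC (T.Tn 2) (\<lambda>t. \<Sum>i\<le>n. split_at s i (n - i) t)"
proof (rule linear_onI)
  fix x y c assume x: "x \<in> V.TC"
  show "(\<Sum>i\<le>n. split_at s i (n - i) x) \<in> T.Tn 2"
    using x by (intro T.Tn_sum split_at_in')
  show "(\<Sum>i\<le>n. split_at s i (n - i) (fscale c x)) = fscale c (\<Sum>i\<le>n. split_at s i (n - i) x)"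
    using x by (simp add: linear_on_scale[OF split_at_TC] T.F.scale_sum_right)
  assume y: "y \<in> V.TC"
  show "(\<Sum>i\<le>n. split_at s i (n - i) (x + y)) = (\<Sum>i\<le>n. split_at s i (n - i) x) + (\<Sum>i\<le>n. split_at s i (n - i) y)"
    using x y by (simp add: linear_on_add[OF split_at_TC] sum.distrib)
qed

text \<open>On words of length n deconcatenation is the sum of n + 1 linear maps
  \<open>split_at\<close>. The number of summands varies with the length, which is harmless for
  multilinearity.\<close>

lemma deconc_ml: "multilinear s UNIV fscale (\<lambda>xs.
     \<Sum>i\<le>length xs. PT [V.P (take i xs), V.P (drop i xs)])"
proof -
  have "multilinear s UNIV fscale (\<lambda>xs. \<Sum>i\<le>length xs. split_at s i (length xs - i) (V.P xs))"
    by (rule V.multilinear_linear_on_length[where A = "\<lambda>_. V.TC" and B = "\<lambda>_. T.Tn 2" and g = V.P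
          and f = "\<lambda>n t. \<Sum>i\<le>n. split_at s i (n - i) t", OF split_at_sum_linear V.multilinear_P]) simp
  then show ?thesis by (simp add: split_at_P)
qed

abbreviation "dc \<equiv> deconc s"
abbreviation "cp \<equiv> coprod s \<sigma>"
abbreviation "ci \<equiv> coprod_iter s \<sigma>"
abbreviation "bp \<equiv> brace_power s M"
abbreviation "btot \<equiv> brace_total s M"

lemma deconc_P: "dc (V.P xs) = (\<Sum>i\<le>length xs. PT [V.P (take i xs), V.P (drop i xs)])"
  unfolding deconc_def by (simp add: V.lift_P[OF vector_space_fscale deconc_ml])

lemma deconc_linear: "flinear V.TC (T.Tn 2) dc"
proof -
  have l: "flinear UNIV UNIV dc"
    unfolding deconc_def by (rule V.linear_on_lift[OF vector_space_fscale deconc_ml])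
  have "dc t \<in> T.Tn 2" if "t \<in> V.TC" for t
    by (rule V.linear_on_into_TC[OF linear_on_mono[OF l] _ T.subspace_Tn that])
      (auto simp: deconc_P intro!: T.Tn_sum T.P_in_Tn')
  then show ?thesis by (intro linear_on_mono[OF l]) auto
qed

abbreviation "dd \<equiv> liftTT s fscale (\<lambda>x y. T.ct (dc x) (dc y))"

lemma dc_TC: "x \<in> V.TC \<Longrightarrow> dc x \<in> T.TC"
  using linear_on_in[OF deconc_linear] T.Tn_in_TC by blast

lemma dd_ml: "multilinear fscale (TV s) fscale (\<lambda>ts. if length ts = 2 then T.ct (dc (ts ! 0)) (dc (ts ! 1)) else 0)"
proof (rule T.multilinear_pair[OF vector_space_fscale])
  fix b assume "b \<in> V.TC"
  then show "flinear V.TC UNIV (\<lambda>a. T.ct (dc a) (dc b))"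
    "flinear V.TC UNIV (\<lambda>a. T.ct (dc b) (dc a))"
    by (auto intro!: linear_on_compose[OF deconc_linear] T.cat_left T.cat_right_Tn dc_TC)
qed

lemma dd_linear: "flinear A UNIV dd"
  by (rule T.linear_on_lift[OF vector_space_fscale dd_ml])

lemma dd_PT: "x \<in> V.TC \<Longrightarrow> y \<in> V.TC \<Longrightarrow> dd (PT [x, y]) = T.ct (dc x) (dc y)"
  by (simp add: T.lift_P[OF vector_space_fscale dd_ml])

lemma dd_in: "t \<in> T.Tn 2 \<Longrightarrow> dd t \<in> T.Tn 4"
proof (rule T2_into[OF dd_linear _ T.subspace_Tn])
  fix xs ys
  have "T.ct (dc (V.P xs)) (dc (V.P ys)) \<in> T.Tn (2 + 2)"
    by (intro T.cat_in_Tn linear_on_in[OF deconc_linear]) simp_all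
  then show "dd (PT [V.P xs, V.P ys]) \<in> T.Tn 4" by (simp add: dd_PT)
qed

abbreviation "mid \<equiv> tmr bt"
abbreviation "mid1 \<equiv> tmap fscale (TV s) 3 1 mid id"

lemma mid1_linear: "flinear A UNIV mid1"
  by (rule T.tmap_linear_on[OF T.linear_on_Tn_TC[OF tmap_beta_right_linear] T.id_flinear])

lemma mid1_in: "t \<in> T.Tn 4 \<Longrightarrow> mid1 t \<in> T.Tn 4"
  using T.tmap_in_Tn[OF tmap_beta_right_linear T.linear_on_id_Tn[of 1]] by simp

lemma mid1_PT:
  assumes "a \<in> V.TC" "b \<in> V.TC" "c \<in> V.TC" "d \<in> V.TC"
  shows "mid1 (PT [a, b, c, d]) = T.ct (T.ct (PT [a]) (bt (PT [b, c]))) (PT [d])"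
  using T.tmap_P[OF T.linear_on_Tn_TC[OF tmap_beta_right_linear] T.id_flinear, of "[a, b, c, d]" 1]
    tmap_PT_right[OF beta_TC, of a b c] assms by simp

lemma coprod_linear: "flinear A UNIV cp"
  unfolding coprod_def comp_def by (rule linear_on_compose[OF dd_linear mid1_linear])

lemma coprod_in: "t \<in> T.Tn 2 \<Longrightarrow> cp t \<in> T.Tn 4"
  unfolding coprod_def comp_def by (intro mid1_in dd_in)

lemma linear_UNIV_sum: "linear_on fscale UNIV w UNIV f \<Longrightarrow> vector_space w \<Longrightarrow> f (\<Sum>x\<in>X. g x) = (\<Sum>x\<in>X. f (g x))"
  for f :: "('b \<Rightarrow> 'k) \<Rightarrow> 'w::ab_group_add"
proof -
  assume f: "linear_on fscale UNIV w UNIV f" and w: "vector_space w"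
  interpret W: vector_space w by (fact w)
  interpret FF: vector_space "fscale :: 'k \<Rightarrow> ('b \<Rightarrow> 'k) \<Rightarrow> _" by (rule vector_space_fscale)
  have "f 0 = 0" using linear_on_scale[OF f, of 0 0] by simp
  then show ?thesis by (intro linear_on_sum[OF f]) auto
qed

lemma coprod_P: "cp (PT [V.P xs, V.P ys]) = (\<Sum>i\<le>length xs. \<Sum>j\<le>length ys.
    T.ct (T.ct (PT [V.P (take i xs)]) (bt (PT [V.P (drop i xs), V.P (take j ys)]))) (PT [V.P (drop j ys)]))"
proof -
  let ?a = "\<lambda>i. PT [V.P (take i xs), V.P (drop i xs)]" and ?b = "\<lambda>j. PT [V.P (take j ys), V.P (drop j ys)]"
  have *: "(\<Sum>i\<in>I. ?a i) \<in> T.TC" "(\<Sum>j\<in>I. ?b j) \<in> T.TC" for I :: "nat set" by (simp_all add: T.TC_sum)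
  have "dd (PT [V.P xs, V.P ys]) = T.ct (\<Sum>i\<le>length xs. ?a i) (\<Sum>j\<le>length ys. ?b j)"
    by (simp add: dd_PT deconc_P)
  also have "\<dots> = (\<Sum>i\<le>length xs. T.ct (?a i) (\<Sum>j\<le>length ys. ?b j))"
    by (rule linear_UNIV_sum[OF T.cat_left[OF *(2)] vector_space_fscale])
  also have "\<dots> = (\<Sum>i\<le>length xs. \<Sum>j\<le>length ys. T.ct (?a i) (?b j))"
    by (rule sum.cong[OF refl], rule linear_on_sum[OF T.cat_right]) simp_all
  also have "\<dots> = (\<Sum>i\<le>length xs. \<Sum>j\<le>length ys. PT [V.P (take i xs), V.P (drop i xs), V.P (take j ys), V.P (drop j ys)])"
    by (simp add: PT_cat)
  finally have dd: "dd (PT [V.P xs, V.P ys]) = \<dots>" .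
  show ?thesis
    unfolding coprod_def comp_def dd linear_UNIV_sum[OF mid1_linear vector_space_fscale]
    by (intro sum.cong refl mid1_PT) simp_all
qed

text \<open>Linearity and degree are proved together, because both are needed to form the tensor
  product of \<open>ci n\<close> with the identity in the next step.\<close>

lemma ci_linear_in: "flinear UNIV UNIV (ci n) \<and> (\<forall>t\<in>T.Tn 2. ci n t \<in> T.Tn (2 * n + 2))"
proof (induction n)
  case 0
  then show ?case by (simp add: linear_on_def numeral_2_eq_2)
next
  case (Suc n)
  then have l: "flinear (T.Tn 2) (T.Tn (2 * n + 2)) (ci n)"
    by (auto intro: linear_on_mono)
  have "flinear UNIV UNIV (ci (Suc n))"
    unfolding coprod_iter.simps comp_def
    by (rule linear_on_compose[OF coprod_linear T.tmap_linear_on[OF T.linear_on_Tn_TC[OF l] T.id_flinear]])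
  moreover have "ci (Suc n) t \<in> T.Tn (2 * Suc n + 2)" if "t \<in> T.Tn 2" for t
    using T.tmap_in_Tn[OF l T.linear_on_id_Tn[of 2], of "cp t"] coprod_in[OF that] by simp
  ultimately show ?case by blast
qed

lemma ci_linear: "flinear UNIV UNIV (ci n)"
  and ci_in: "t \<in> T.Tn 2 \<Longrightarrow> ci n t \<in> T.Tn (2 * n + 2)"
  using ci_linear_in by blast+

lemma ci_TC: "flinear (T.Tn 2) T.TC (ci n)"
  by (rule linear_on_mono[OF ci_linear]) (auto intro: T.Tn_in_TC ci_in)

lemma vs_s: "vector_space s" by (rule V.vector_space_axioms)

lemma btot_bml: "V.bimultilinear s (\<lambda>xs ys. M (length xs) (length ys) (V.P (xs @ ys)))"
  unfolding V.bimultilinear_def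
proof (intro conjI ballI)
  fix ys :: "'v list"
  show "multilinear s UNIV s (\<lambda>xs. M (length xs) (length ys) (V.P (xs @ ys)))"
    by (rule V.multilinear_linear_on_length[where A = "\<lambda>n. V.Tn (n + length ys)" and B = "\<lambda>_. UNIV"
          and f = "\<lambda>n. M n (length ys)" and g = "\<lambda>xs. V.P (xs @ ys)", OF M_linear V.multilinear_append_left[OF V.multilinear_P]])
      (simp_all add: V.P_in_Tn')
  show "multilinear s UNIV s (\<lambda>xs. M (length ys) (length xs) (V.P (ys @ xs)))"
    by (rule V.multilinear_linear_on_length[where A = "\<lambda>n. V.Tn (length ys + n)" and B = "\<lambda>_. UNIV"
          and f = "\<lambda>n. M (length ys) n" and g = "\<lambda>xs. V.P (ys @ xs)", OF M_linear V.multilinear_append_right[OF V.multilinear_P]])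
      (simp_all add: V.P_in_Tn')
qed

lemma btot_linear: "linear_on fscale A s UNIV btot"
  unfolding brace_total_def by (rule liftTT_bilift(1)[OF vs_s btot_bml])

lemma btot_P: "btot (PT [V.P xs, V.P ys]) = M (length xs) (length ys) (V.P (xs @ ys))"
  unfolding brace_total_def by (rule liftTT_bilift(3)[OF vs_s btot_bml])

lemma Pbtot_linear: "flinear A (V.Tn 1) (\<lambda>t. V.P [btot t])"
  by (rule linear_on_compose[OF btot_linear V.P_1_linear])

definition brace_word :: "nat \<Rightarrow> ('v, 'k) tensor list \<Rightarrow> ('v, 'k) tensor" where
  "brace_word r ts = V.P (map (\<lambda>k. btot (PT [ts ! (2 * k), ts ! (2 * k + 1)])) [0..<r])"

lemma brace_word_Suc:
  assumes "length ts = 2 * r + 2"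
  shows "brace_word (Suc r) ts = V.ct (brace_word r (take (2 * r) ts)) (V.P [btot (PT (drop (2 * r) ts))])"
proof -
  have "drop (2 * r) ts = [ts ! (2 * r), ts ! (2 * r + 1)]"
    using assms by (simp add: list_eq_iff_nth_eq nth_Cons' less_2_cases_iff)
  moreover have "brace_word r (take (2 * r) ts) = V.P (map (\<lambda>k. btot (PT [ts ! (2 * k), ts ! (2 * k + 1)])) [0..<r])"
    unfolding brace_word_def by (intro arg_cong[of _ _ V.P] map_cong) auto
  ultimately show ?thesis by (simp add: brace_word_def V.cat_P)
qed

text \<open>Induction on r splits off the last pair of arguments, so that the changed slot is
  located by \<open>multilinear_split\<close> and not by index arithmetic.\<close>

lemma bp_ml: "multilinear fscale (TV s) fscale (\<lambda>ts. if length ts = 2 * r then brace_word r ts else 0)"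
proof (induction r)
  case 0
  then show ?case by (simp add: multilinear_def T.F.scale_zero_right)
next
  case (Suc r)
  \<comment> \<open>Zero outside the expected lengths, so that \<open>?h\<close> is multilinear in
    each argument on words of every length.\<close>
  let ?h = "\<lambda>xs ys. V.ct (if length xs = 2 * r then brace_word r xs else 0) (if length ys = 2 then V.P [btot (PT ys)] else 0)"
  have 1: "multilinear fscale (TV s) fscale (\<lambda>ys. if length ys = 2 then V.P [btot (PT ys)] else 0)"
    by (rule T.multilinear_if_length[OF vector_space_fscale
          T.multilinear_linear_on[OF Pbtot_linear[of T.TC] T.multilinear_P]]) simp
  have "multilinear fscale (TV s) fscale (\<lambda>ts. if length ts = 2 * r + 2
      then ?h (take (2 * r) ts) (drop (2 * r) ts) else 0)"
  proof (rule T.multilinear_split[OF vector_space_fscale, where D = "\<lambda>n. n = 2 * r + 2" and k = "\<lambda>_. 2 * r" and h = ?h])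
    fix xs
    show "multilinear fscale (TV s) fscale (\<lambda>ys. ?h ys xs)"
      by (rule T.multilinear_linear_on[OF V.cat_left[where A = UNIV] Suc]) auto
    show "multilinear fscale (TV s) fscale (?h xs)"
      by (rule T.multilinear_linear_on[OF V.cat_right 1]) (auto simp: brace_word_def)
  qed
  then show ?case
    by (rule T.multilinear_cong) (simp add: brace_word_Suc)
qed

lemma bp_def': "bp r = lift fscale (TV s) fscale (\<lambda>ts. if length ts = 2 * r then brace_word r ts else 0)"
  unfolding brace_power_def brace_word_def ..

lemma bp_linear: "flinear A UNIV (bp r)"
  unfolding bp_def' by (rule T.linear_on_lift[OF vector_space_fscale bp_ml])

lemma bp_PT: "ts \<in> lists (TV s) \<Longrightarrow> length ts = 2 * r \<Longrightarrow> bp r (PT ts) = brace_word r ts"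
  unfolding bp_def' by (simp add: T.lift_P[OF vector_space_fscale bp_ml])

lemma bp_in: "t \<in> T.Tn (2 * r) \<Longrightarrow> bp r t \<in> V.Tn r"
  by (rule T.linear_on_into_Tn[OF bp_linear _ V.subspace_Tn])
    (auto simp: bp_PT brace_word_def intro!: V.P_in_Tn')

text \<open>The power of order r + 1 is the tensor product of the power of order r with one bracket.
  It is needed for sums of pure tensors, such as iterated coproducts.\<close>

lemma bp_cat:
  assumes x: "x \<in> T.Tn (2 * r)" and y: "y \<in> T.Tn 2"
  shows "bp (Suc r) (T.ct x y) = V.ct (bp r x) (V.P [btot y])"
proof -
  have 1: "bp (Suc r) (T.ct (PT xs) y) = V.ct (bp r (PT xs)) (V.P [btot y])"
    if xs: "xs \<in> lists (TV s)" "length xs = 2 * r" for xs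
  proof (rule T.Tn_eq[OF linear_on_compose[OF T.cat_right_Tn bp_linear]
        linear_on_compose[OF Pbtot_linear V.cat_right_Tn] _ y])
    show "PT xs \<in> T.TC" using xs by simp
    have "PT xs \<in> T.Tn (2 * r)" using xs by (rule T.P_in_Tn')
    then show "bp r (PT xs) \<in> V.TC" using bp_in V.Tn_in_TC by blast
    fix ys assume ys: "ys \<in> lists (TV s)" "length ys = 2"
    then show "bp (Suc r) (T.ct (PT xs) (PT ys)) = V.ct (bp r (PT xs)) (V.P [btot (PT ys)])"
      using xs brace_word_Suc[of "xs @ ys" r] by (simp add: PT_cat bp_PT)
  qed
  show ?thesis
    by (rule T.Tn_eq[OF linear_on_compose[OF T.cat_left bp_linear]
        linear_on_compose[OF bp_linear V.cat_left] _ x])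
      (use 1 y T.Tn_in_TC in auto)
qed

text \<open>One step of the recursion for a fixed splitting. The braiding turns the middle blocks
  into a general tensor, so the claim is made for every u in that place; \<open>y1\<close> and
  \<open>x2\<close> enter through their lengths only.\<close>

lemma bp_step:
  assumes IH: "\<And>xs ys. bp (Suc r) (ci r (PT [V.P xs, V.P ys])) = ap (C.st (Suc r) (length xs) (length ys)) (V.P (xs @ ys))"
    and u: "u \<in> V.Tn (length y1 + length x2)"
  shows "bp (Suc (Suc r)) (tmap fscale (TV s) 2 2 (ci r) id
      (T.ct (T.ct (PT [V.P x1]) (split_at s (length y1) (length x2) u)) (PT [V.P y2])))
    = ap (V.RT 1 (C.st (Suc r) (length x1) (length y1)) * V.LT (length x1 + length y1) (Mop (length x2) (length y2)))
        (V.ct (V.ct (V.P x1) u) (V.P y2))"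
proof (rule V.Tn_eq[OF _ _ _ u])
  let ?j = "length y1" and ?i = "length x2"
  let ?t = "tmap fscale (TV s) 2 2 (ci r) id"
  have t: "flinear A UNIV ?t" for A
    by (rule T.tmap_linear_on[OF ci_TC T.id_flinear])
  have s: "flinear (V.Tn n) T.TC (split_at s ?j ?i)" for n
    by (rule linear_on_mono[OF split_at_TC]) (auto intro: V.Tn_in_TC linear_on_in[OF split_at_TC])
  show "flinear (V.Tn (?j + ?i)) UNIV (\<lambda>u. bp (Suc (Suc r)) (?t
      (T.ct (T.ct (PT [V.P x1]) (split_at s ?j ?i u)) (PT [V.P y2]))))"
    by (rule linear_on_compose[OF linear_on_compose[OF linear_on_compose[OF linear_on_compose[OF s T.cat_right] T.cat_left] t] bp_linear])
      simp_all
  show "flinear (V.Tn (?j + ?i)) V.TC (\<lambda>u.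
      ap (V.RT 1 (C.st (Suc r) (length x1) (length y1)) * V.LT (length x1 + length y1) (Mop (length x2) (length y2)))
        (V.ct (V.ct (V.P x1) u) (V.P y2)))"
    by (rule linear_on_compose[OF linear_on_compose[OF V.cat_right_Tn V.cat_left] V.tame_linear_on])
      (simp_all del: C.st.simps)
  fix us :: "'v list" assume us: "length us = ?j + ?i"
  let ?v1 = "take ?j us" and ?v2 = "drop ?j us"
  have x: "PT [V.P x1, V.P ?v1] \<in> T.Tn 2" "PT [V.P ?v2, V.P y2] \<in> T.Tn 2" by (auto intro!: T.P_in_Tn')
  have l: "length ?v1 = ?j" "length ?v2 = ?i" using us by auto
  \<comment> \<open>The braided middle word is cut again: its first part joins \<open>x1\<close> in
    the remaining coproducts, its second part joins \<open>y2\<close> in the last bracket.\<close>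
  have "T.ct (T.ct (PT [V.P x1]) (split_at s ?j ?i (V.P us))) (PT [V.P y2]) = T.ct (PT [V.P x1, V.P ?v1]) (PT [V.P ?v2, V.P y2])"
    using us by (simp add: split_at_P PT_cat)
  then have "bp (Suc (Suc r)) (?t (T.ct (T.ct (PT [V.P x1]) (split_at s ?j ?i (V.P us))) (PT [V.P y2])))
     = bp (Suc (Suc r)) (T.ct (ci r (PT [V.P x1, V.P ?v1])) (PT [V.P ?v2, V.P y2]))"
    by (simp add: T.tmap_cat[OF ci_TC T.id_flinear x])
  also have "\<dots> = V.ct (bp (Suc r) (ci r (PT [V.P x1, V.P ?v1]))) (V.P [btot (PT [V.P ?v2, V.P y2])])"
    using ci_in[OF x(1), of r] by (intro bp_cat x(2)) simp
  also have "\<dots> = V.ct (ap (C.st (Suc r) (length x1) ?j) (V.P (x1 @ ?v1))) (V.P [M ?i (length y2) (V.P (?v2 @ y2))])"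
    by (simp only: IH btot_P l)
  also have "\<dots> = ap (V.RT 1 (C.st (Suc r) (length x1) ?j)) (V.ct (V.P (x1 @ ?v1)) (V.P [M ?i (length y2) (V.P (?v2 @ y2))]))"
    by (rule V.RT_cat[symmetric]) (simp_all add: V.P_in_Tn' del: C.st.simps)
  also have "V.P [M ?i (length y2) (V.P (?v2 @ y2))] = ap (Mop ?i (length y2)) (V.P (?v2 @ y2))"
    by (rule Mop_Tn[symmetric]) (simp add: V.P_in_Tn' us)
  also have "V.ct (V.P (x1 @ ?v1)) \<dots> = ap (V.LT (length x1 + ?j) (Mop ?i (length y2))) (V.ct (V.P (x1 @ ?v1)) (V.P (?v2 @ y2)))"
    by (rule V.LT_cat[symmetric]) (simp_all add: V.P_in_Tn' us)
  also have "V.ct (V.P (x1 @ ?v1)) (V.P (?v2 @ y2)) = V.ct (V.ct (V.P x1) (V.P us)) (V.P y2)"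
    by (simp add: V.cat_P) (simp add: append_assoc[symmetric] del: append_assoc)
  finally show "bp (Suc (Suc r)) (?t (T.ct (T.ct (PT [V.P x1]) (split_at s ?j ?i (V.P us))) (PT [V.P y2])))
    = ap (V.RT 1 (C.st (Suc r) (length x1) ?j) * V.LT (length x1 + ?j) (Mop ?i (length y2)))
        (V.ct (V.ct (V.P x1) (V.P us)) (V.P y2))"
    by (simp only: ap_mult)
qed

text \<open>The bridge from the literal definition by iterated coproducts to \<open>st\<close>: both
  take off one bracket on the right, so the induction matches them splitting by splitting. The
  iterate of index r has r + 1 pairs of factors, hence the shift.\<close>

theorem bp_ci:
  "bp (Suc r) (ci r (PT [V.P xs, V.P ys])) = ap (C.st (Suc r) (length xs) (length ys)) (V.P (xs @ ys))"
proof (induction r arbitrary: xs ys)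
  case 0
  have "bp (Suc 0) (PT [V.P xs, V.P ys]) = V.P [btot (PT [V.P xs, V.P ys])]"
    by (simp add: bp_PT brace_word_def)
  also have "\<dots> = ap (Mop (length xs) (length ys)) (V.P (xs @ ys))"
    by (simp add: btot_P Mop_Tn V.P_in_Tn')
  finally show ?case using C.st_1 by (simp del: C.st.simps)
next
  case (Suc r)
  let ?t = "tmap fscale (TV s) 2 2 (ci r) id"
  let ?n = "length xs" and ?m = "length ys"
  have t: "flinear A UNIV (\<lambda>x. bp (Suc (Suc r)) (?t x))" for A
    by (rule linear_on_compose[OF T.tmap_linear_on[OF ci_TC T.id_flinear] bp_linear])
  have step: "bp (Suc (Suc r)) (?t (T.ct (T.ct (PT [V.P (take i xs)]) (bt (PT [V.P (drop i xs), V.P (take j ys)]))) (PT [V.P (drop j ys)])))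
     = ap (V.RT 1 (C.st (Suc r) i j) * (V.LT (i + j) (Mop (?n - i) (?m - j)) * V.RT (?m - j) (V.LT i (B.b (?n - i) j)))) (V.P (xs @ ys))"
    if "i \<le> ?n" "j \<le> ?m" for i j
  proof -
    have l: "length (take i xs) = i" "length (take j ys) = j" using that by auto
    let ?u = "ap (B.b (?n - i) j) (V.P (drop i xs @ take j ys))"
    have u: "?u \<in> V.Tn (j + (?n - i))" by (rule V.hom_in_Tn[OF B.hom_b])
    have b: "bt (PT [V.P (drop i xs), V.P (take j ys)]) = split_at s j (?n - i) ?u"
      using that by (simp add: beta_P)
    have "V.P (xs @ ys) = V.ct (V.ct (V.P (take i xs)) (V.P (drop i xs @ take j ys))) (V.P (drop j ys))"
      by (simp add: V.cat_P) (simp flip: append_assoc)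
    moreover have "V.ct (V.P (take i xs)) (V.P (drop i xs @ take j ys)) \<in> V.TC"
      by simp
    ultimately have "ap (V.RT (?m - j) (V.LT i (B.b (?n - i) j))) (V.P (xs @ ys)) = V.ct (V.ct (V.P (take i xs)) ?u) (V.P (drop j ys))"
      using that by (simp only:) (subst V.RT_cat, simp_all add: V.LT_cat V.P_in_Tn')
    then show ?thesis
      using bp_step[OF Suc, of ?u "take j ys" "drop i xs" "take i xs" "drop j ys"] u l
      unfolding b by (simp only: length_drop ap_mult)
  qed
  have "bp (Suc (Suc r)) (ci (Suc r) (PT [V.P xs, V.P ys])) = (\<Sum>i\<le>?n. \<Sum>j\<le>?m.
     ap (V.RT 1 (C.st (Suc r) i j) * (V.LT (i + j) (Mop (?n - i) (?m - j)) * V.RT (?m - j) (V.LT i (B.b (?n - i) j)))) (V.P (xs @ ys)))"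
    unfolding coprod_iter.simps comp_def coprod_P
    by (simp only: linear_UNIV_sum[OF t vector_space_fscale]) (intro sum.cong refl step, simp_all)
  also have "\<dots> = ap (C.st (Suc (Suc r)) ?n ?m) (V.P (xs @ ys))"
    unfolding C.st.simps(2)[of "Suc r"] dsum_def sum_dec by (simp add: ap_sum)
  finally show ?case .
qed

end

context multibrace_space
begin

declare C.st.simps [simp del]

lemma bp_ci': "1 \<le> r \<Longrightarrow> bp r (ci (r - 1) (PT [V.P xs, V.P ys])) = ap (C.st r (length xs) (length ys)) (V.P (xs @ ys))"
  using bp_ci[of "r - 1" xs ys] by simp

lemma P_sum: "V.P [\<Sum>x\<in>X. f x] = (\<Sum>x\<in>X. V.P [f x])"
  by (rule linear_on_sum[OF V.P_1_linear]) (simp_all add: V.P_zero)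

text \<open>On words the associativity condition on \<open>M\<close> becomes an equation of
  operators once \<open>bp_ci\<close> has replaced the iterated coproducts by
  \<open>st\<close>.\<close>

sublocale CA: multibrace_assoc V.eT V.tame V.LT V.RT "V.op_of 2 \<sigma>" Mop
proof
  fix i j k :: nat assume ijk: "1 \<le> i" "1 \<le> j" "1 \<le> k"
  show "(\<Sum>r = 1..i + j. Mop r k * V.RT k (C.st r i j)) = (\<Sum>l = 1..j + k. Mop i l * V.LT i (C.st l j k))"
  proof (rule V.hom_eqI)
    show "V.W.hom (i + j + k) 1 (\<Sum>r = 1..i + j. Mop r k * V.RT k (C.st r i j))"
      by (intro V.W.hom_sum V.W.hom_mult[OF hom_Mop] V.W.hom_R C.hom_st)
    have "V.W.hom (i + (j + k)) 1 (\<Sum>l = 1..j + k. Mop i l * V.LT i (C.st l j k))"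
      by (intro V.W.hom_sum V.W.hom_mult[OF hom_Mop] V.W.hom_L C.hom_st)
    then show "V.W.hom (i + j + k) 1 (\<Sum>l = 1..j + k. Mop i l * V.LT i (C.st l j k))"
      by (simp add: add.assoc)
    fix ws :: "'v list" assume ws: "length ws = i + j + k"
    define xs ys zs where "xs = take i ws" and "ys = take j (drop i ws)" and "zs = drop (i + j) ws"
    have w: "ws = xs @ ys @ zs" unfolding xs_def ys_def zs_def
      by (metis append_take_drop_id drop_drop add.commute)
    have l: "length xs = i" "length ys = j" "length zs = k" using ws by (simp_all add: xs_def ys_def zs_def)
    have 1: "ap (Mop r k * V.RT k (C.st r i j)) (V.P ws) = V.P [M r k (V.ct (bp r (ci (r - 1) (PT [V.P xs, V.P ys]))) (V.P zs))]"
      if "1 \<le> r" for r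
    proof -
      have "V.P ws = V.ct (V.P (xs @ ys)) (V.P zs)" by (simp add: V.cat_P w)
      then have "ap (V.RT k (C.st r i j)) (V.P ws) = V.ct (bp r (ci (r - 1) (PT [V.P xs, V.P ys]))) (V.P zs)"
        using that l bp_ci'[OF that, of xs ys] by (simp add: V.RT_cat V.P_in_Tn')
      moreover have "ap (V.RT k (C.st r i j)) (V.P ws) \<in> V.Tn (r + k)"
        by (rule V.hom_in_Tn[OF V.W.hom_R[OF C.hom_st]])
      ultimately show ?thesis by (simp add: ap_mult Mop_Tn)
    qed
    have 2: "ap (Mop i r * V.LT i (C.st r j k)) (V.P ws) = V.P [M i r (V.ct (V.P xs) (bp r (ci (r - 1) (PT [V.P ys, V.P zs]))))]"
      if "1 \<le> r" for r
    proof -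
      have "V.P ws = V.ct (V.P xs) (V.P (ys @ zs))" by (simp add: V.cat_P w)
      then have "ap (V.LT i (C.st r j k)) (V.P ws) = V.ct (V.P xs) (bp r (ci (r - 1) (PT [V.P ys, V.P zs])))"
        using that l bp_ci'[OF that, of ys zs] by (simp add: V.LT_cat V.P_in_Tn')
      moreover have "ap (V.LT i (C.st r j k)) (V.P ws) \<in> V.Tn (i + r)"
        by (rule V.hom_in_Tn[OF V.W.hom_L[OF C.hom_st]])
      ultimately show ?thesis by (simp add: ap_mult Mop_Tn)
    qed
    have "(\<Sum>r = 1..i + j. M r k (V.ct (bp r (ci (r - 1) (PT [V.P xs, V.P ys]))) (V.P zs)))
      = (\<Sum>r = 1..j + k. M i r (V.ct (V.P xs) (bp r (ci (r - 1) (PT [V.P ys, V.P zs])))))"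
      by (rule M_assoc[OF ijk]) (simp_all add: V.P_in_Tn' l)
    then show "ap (\<Sum>r = 1..i + j. Mop r k * V.RT k (C.st r i j)) (V.P ws)
        = ap (\<Sum>l = 1..j + k. Mop i l * V.LT i (C.st l j k)) (V.P ws)"
      by (simp add: ap_sum 1 2 P_sum[symmetric])
  qed
qed

section \<open>The product on \<open>T(V)\<close>: linearity, associativity, unit, compatibility
  with \<beta>\<close>

lemma counit_ml: "multilinear s UNIV (*) (\<lambda>xs. if xs = [] then 1 else 0)"
  by (simp add: multilinear_def)

lemma counit_P: "counit s (V.P xs) = (if xs = [] then 1 else 0)"
  unfolding counit_def by (simp add: V.lift_P[OF vector_space_times counit_ml])

lemma counit_linear: "linear_on fscale A (*) UNIV (counit s)"
  unfolding counit_def by (rule V.linear_on_lift[OF vector_space_times counit_ml])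

abbreviation "eps \<equiv> liftTT s fscale (\<lambda>x y. fscale (counit s x * counit s y) (unitT s))"

lemma eps_ml: "multilinear fscale (TV s) fscale
    (\<lambda>ts. if length ts = 2 then fscale (counit s (ts ! 0) * counit s (ts ! 1)) (unitT s) else 0)"
  by (rule T.multilinear_pair[OF vector_space_fscale]; rule linear_onI)
    (simp_all add: linear_on_add[OF counit_linear[of UNIV]] linear_on_scale[OF counit_linear[of UNIV]]
      algebra_simps V.F.scale_left_distrib)

lemma eps_linear: "flinear A UNIV eps"
  by (rule T.linear_on_lift[OF vector_space_fscale eps_ml])

text \<open>Both counits see the empty word only, so \<epsilon> \<otimes> \<epsilon> is the
  component with zero outputs.\<close>

lemma eps_P: "eps (PT [V.P xs, V.P ys]) = ap (C.st 0 (length xs) (length ys)) (V.P (xs @ ys))"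
  by (simp add: T.lift_P[OF vector_space_fscale eps_ml] counit_P C.st.simps V.eT_P ap_0)

abbreviation "nn r t \<equiv> bp (Suc r) (ci r t)"

lemma nn_linear: "flinear UNIV UNIV (nn r)"
  by (rule linear_on_compose[OF ci_linear bp_linear])

lemma nn_in: "t \<in> T.Tn 2 \<Longrightarrow> nn r t \<in> V.TC"
  using bp_in[of "ci r t" "Suc r"] ci_in[of t r] V.Tn_in_TC by simp

text \<open>The bound depends on the tensor. The tensors whose terms vanish eventually form a
  subspace, and it contains every pair of words because the letters run out.\<close>

lemma nn_eventually_0:
  assumes "t \<in> T.Tn 2"
  shows "\<exists>N. \<forall>r\<ge>N. nn r t = 0"
proof -
  let ?U = "{t. \<exists>N. \<forall>r\<ge>N. nn r t = 0}"
  have U: "T.F.subspace ?U"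
    unfolding T.F.subspace_def
  proof (intro conjI ballI allI)
    have "nn r 0 = 0" for r
      using linear_on_scale[OF nn_linear[of r], of 0 0] by (simp only: T.F.scale_zero_left V.F.scale_zero_left UNIV_I)
    then show "0 \<in> ?U" by simp
    fix x y c assume "x \<in> ?U"
    then obtain N where x: "\<forall>r\<ge>N. nn r x = 0" by blast
    then show "fscale c x \<in> ?U" using linear_on_scale[OF nn_linear, of x] by auto
    assume "y \<in> ?U"
    then obtain N' where y: "\<forall>r\<ge>N'. nn r y = 0" by blast
    have "\<forall>r\<ge>max N N'. nn r (x + y) = 0"
      using x y linear_on_add[OF nn_linear, of x y] by simp
    then show "x + y \<in> ?U" by blast
  qed
  have "t \<in> ?U"
  proof (rule T2_into[OF id_T2 _ U assms])
    fix xs ys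
    have "nn r (PT [V.P xs, V.P ys]) = 0" if "length xs + length ys \<le> r" for r
      using that by (simp add: bp_ci C.st_eq_0 ap_0)
    then show "PT [V.P xs, V.P ys] \<in> ?U" by blast
  qed
  then show ?thesis by simp
qed

abbreviation "mu \<equiv> star s M \<sigma>"

lemma star_eq: "\<forall>r\<ge>N. nn r t = 0 \<Longrightarrow> mu t = eps t + (\<Sum>r<N. nn r t)"
  unfolding star_def by (subst Sum_any.expand_superset[of "{..<N}"]) (auto simp: not_less[symmetric])

text \<open>Before linearity of the single terms can be used, \<open>Sum_any\<close> is replaced by
  a finite sum over a range that serves both arguments.\<close>

lemma star_linear: "flinear (T.Tn 2) V.TC mu"
proof (rule linear_onI)
  fix x y c assume x: "x \<in> T.Tn 2"
  obtain N where N: "\<forall>r\<ge>N. nn r x = 0" using nn_eventually_0[OF x] by blast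
  have "eps x \<in> V.TC"
    by (rule T2_into[OF eps_linear _ V.subspace_TC x]) (simp add: eps_P V.tame_in_TC)
  then show "mu x \<in> V.TC"
    unfolding star_eq[OF N] using nn_in[OF x] by (simp add: V.TC_sum)
  have "\<forall>r\<ge>N. nn r (fscale c x) = 0"
    using N linear_on_scale[OF nn_linear, of x] by simp
  from star_eq[OF this] show "mu (fscale c x) = fscale c (mu x)"
    by (simp add: star_eq[OF N] linear_on_scale[OF nn_linear] linear_on_scale[OF eps_linear[of UNIV]]
        V.F.scale_right_distrib V.F.scale_sum_right)
  assume y: "y \<in> T.Tn 2"
  obtain N' where N': "\<forall>r\<ge>N'. nn r y = 0" using nn_eventually_0[OF y] by blast
  have m: "\<forall>r\<ge>max N N'. nn r x = 0" "\<forall>r\<ge>max N N'. nn r y = 0" using N N' by auto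
  then have "\<forall>r\<ge>max N N'. nn r (x + y) = 0"
    using linear_on_add[OF nn_linear, of x y] by simp
  from star_eq[OF this] show "mu (x + y) = mu x + mu y"
    by (simp add: star_eq[OF m(1)] star_eq[OF m(2)] linear_on_add[OF nn_linear]
        linear_on_add[OF eps_linear[of UNIV]] sum.distrib add.assoc add.left_commute)
qed

lemma star_P:
  assumes "length xs + length ys \<le> N"
  shows "mu (PT [V.P xs, V.P ys]) = (\<Sum>r\<le>N. ap (C.st r (length xs) (length ys)) (V.P (xs @ ys)))"
proof -
  have "\<forall>r\<ge>N. nn r (PT [V.P xs, V.P ys]) = 0"
    using assms by (simp add: bp_ci C.st_eq_0 ap_0)
  \<comment> \<open>The summand \<epsilon> \<otimes> \<epsilon> joins the others as the term r = 0,
    which removes the index shift.\<close>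
  from star_eq[OF this] show ?thesis
    unfolding eps_P bp_ci lessThan_Suc_atMost[symmetric] sum.lessThan_Suc_shift by simp
qed

lemma mu_left: "b \<in> V.TC \<Longrightarrow> flinear V.TC V.TC (\<lambda>a. mu (PT [a, b]))"
  by (rule linear_on_compose[OF T.P_2_left star_linear])

lemma mu_right: "a \<in> V.TC \<Longrightarrow> flinear V.TC V.TC (\<lambda>b. mu (PT [a, b]))"
  by (rule linear_on_compose[OF T.P_2_right star_linear])

lemma mu_in: "a \<in> V.TC \<Longrightarrow> b \<in> V.TC \<Longrightarrow> mu (PT [a, b]) \<in> V.TC"
  using linear_on_in[OF mu_left] by blast

text \<open>Extends \<open>star_P\<close> from pairs of words to all tensors of degree i + j, as
  needed when an argument is itself a product.\<close>

lemma mu_split: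
  assumes t: "t \<in> V.Tn (i + j)" and N: "i + j \<le> N"
  shows "mu (split_at s i j t) = (\<Sum>r\<le>N. ap (C.st r i j) t)"
proof (rule V.Tn_eq[OF _ _ _ t])
  show "flinear (V.Tn (i + j)) V.TC (\<lambda>t. mu (split_at s i j t))"
    by (rule linear_on_compose'[OF split_at_linear split_at_in star_linear])
  show "flinear (V.Tn (i + j)) V.TC (\<lambda>t. \<Sum>r\<le>N. ap (C.st r i j) t)"
    by (rule linear_onI) (simp_all add: V.TC_sum V.tame_in_TC ap_plus_right ap_fscale sum.distrib V.F.scale_sum_right)
  fix zs :: "'v list" assume "length zs = i + j"
  then show "mu (split_at s i j (V.P zs)) = (\<Sum>r\<le>N. ap (C.st r i j) (V.P zs))"
    using star_P[of "take i zs" "drop i zs" N] N by (simp add: split_at_P)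
qed

text \<open>On words the claim is \<open>st_assoc\<close>, summed over the number n of outputs. It
  remains to expand the inner product into homogeneous parts and to extend all ranges to
  \<open>N\<close>.\<close>

lemma mu_assoc_P: "mu (PT [mu (PT [V.P xs, V.P ys]), V.P zs]) = mu (PT [V.P xs, mu (PT [V.P ys, V.P zs])])"
proof -
  define i j k where "i = length xs" and "j = length ys" and "k = length zs"
  \<comment> \<open>A common bound for the degrees of all intermediate tensors, and thus for both
    summation indices.\<close>
  define N where "N = i + j + k + (i + j + k)"
  let ?w = "V.P (xs @ ys @ zs)"
  have N2: "i + j + k \<le> N" by (simp add: N_def)
  have w1: "?w = V.ct (V.P (xs @ ys)) (V.P zs)" and w2: "?w = V.ct (V.P xs) (V.P (ys @ zs))"
    by (simp_all add: V.cat_P)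
  have st_Tn: "ap (C.st r a b) t \<in> V.Tn r" for r a b t by (rule V.hom_in_Tn[OF C.hom_st])
  have st0: "ap (C.st r a b) t = 0" if "a + b < r" for r a b t using that by (simp add: C.st_eq_0 ap_0)
  have split_left: "mu (PT [ap (C.st r i j) (V.P (xs @ ys)), V.P zs])
      = (\<Sum>n\<le>N. ap (C.st n r k * V.RT k (C.st r i j)) ?w)" if "r \<le> i + j" for r
  proof -
    have zs: "V.P zs \<in> V.Tn k" by (simp add: V.P_in_Tn' k_def)
    have "PT [ap (C.st r i j) (V.P (xs @ ys)), V.P zs] = split_at s r k (V.ct (ap (C.st r i j) (V.P (xs @ ys))) (V.P zs))"
      using split_at_cat[OF st_Tn zs] by simp
    also have "V.ct (ap (C.st r i j) (V.P (xs @ ys))) (V.P zs) = ap (V.RT k (C.st r i j)) ?w"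
      unfolding w1 by (simp add: V.RT_cat zs)
    finally have "PT [ap (C.st r i j) (V.P (xs @ ys)), V.P zs] = split_at s r k (ap (V.RT k (C.st r i j)) ?w)" .
    moreover have "ap (V.RT k (C.st r i j)) ?w \<in> V.Tn (r + k)"
      by (rule V.hom_in_Tn[OF V.W.hom_R[OF C.hom_st]])
    ultimately show ?thesis using that by (simp add: mu_split[where N = N] N_def ap_mult)
  qed
  have split_right: "mu (PT [V.P xs, ap (C.st r j k) (V.P (ys @ zs))])
      = (\<Sum>n\<le>N. ap (C.st n i r * V.LT i (C.st r j k)) ?w)" if "r \<le> j + k" for r
  proof -
    have xs: "V.P xs \<in> V.Tn i" by (simp add: V.P_in_Tn' i_def)
    have "PT [V.P xs, ap (C.st r j k) (V.P (ys @ zs))] = split_at s i r (V.ct (V.P xs) (ap (C.st r j k) (V.P (ys @ zs))))"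
      using split_at_cat[OF xs st_Tn] by simp
    also have "V.ct (V.P xs) (ap (C.st r j k) (V.P (ys @ zs))) = ap (V.LT i (C.st r j k)) ?w"
      unfolding w2 by (simp add: V.LT_cat xs)
    finally have "PT [V.P xs, ap (C.st r j k) (V.P (ys @ zs))] = split_at s i r (ap (V.LT i (C.st r j k)) ?w)" .
    moreover have "ap (V.LT i (C.st r j k)) ?w \<in> V.Tn (i + r)"
      by (rule V.hom_in_Tn[OF V.W.hom_L[OF C.hom_st]])
    ultimately show ?thesis using that by (simp add: mu_split[where N = N] N_def ap_mult)
  qed
  have "mu (PT [mu (PT [V.P xs, V.P ys]), V.P zs]) = mu (PT [\<Sum>r\<le>i + j. ap (C.st r i j) (V.P (xs @ ys)), V.P zs])"
    by (subst star_P[where N = "i + j"]) (simp_all add: i_def j_def)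
  also have "\<dots> = (\<Sum>r\<le>i + j. mu (PT [ap (C.st r i j) (V.P (xs @ ys)), V.P zs]))"
    by (rule linear_on_sum[OF mu_left]) (simp_all add: V.tame_in_TC linear_on_scale[OF mu_left, of _ 0 0, simplified])
  also have "\<dots> = (\<Sum>r\<le>i + j. \<Sum>n\<le>N. ap (C.st n r k * V.RT k (C.st r i j)) ?w)"
    by (simp add: split_left)
  also have "\<dots> = (\<Sum>r\<le>N. \<Sum>n\<le>N. ap (C.st n r k * V.RT k (C.st r i j)) ?w)"
    by (rule sum.mono_neutral_left) (auto simp: N_def C.st_eq_0 ap_0)
  also have "\<dots> = (\<Sum>n\<le>N. ap (\<Sum>r\<le>N. C.st n r k * V.RT k (C.st r i j)) ?w)"
    by (subst sum.swap) (simp add: ap_sum)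
  also have "\<dots> = (\<Sum>n\<le>N. ap (\<Sum>r\<le>N. C.st n i r * V.LT i (C.st r j k)) ?w)"
    by (simp only: CA.st_assoc[OF N2])
  also have "\<dots> = (\<Sum>r\<le>N. \<Sum>n\<le>N. ap (C.st n i r * V.LT i (C.st r j k)) ?w)"
    by (subst sum.swap) (simp add: ap_sum)
  also have "\<dots> = (\<Sum>r\<le>j + k. \<Sum>n\<le>N. ap (C.st n i r * V.LT i (C.st r j k)) ?w)"
    by (rule sum.mono_neutral_right) (auto simp: N_def C.st_eq_0 ap_0)
  also have "\<dots> = (\<Sum>r\<le>j + k. mu (PT [V.P xs, ap (C.st r j k) (V.P (ys @ zs))]))"
    by (simp add: split_right)
  also have "\<dots> = mu (PT [V.P xs, \<Sum>r\<le>j + k. ap (C.st r j k) (V.P (ys @ zs))])"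
    by (rule linear_on_sum[OF mu_right, symmetric]) (simp_all add: V.tame_in_TC linear_on_scale[OF mu_right, of _ 0 0, simplified])
  also have "\<dots> = mu (PT [V.P xs, mu (PT [V.P ys, V.P zs])])"
    by (subst star_P[where N = "j + k"]) (simp_all add: j_def k_def)
  finally show ?thesis .
qed

lemma mu_assoc:
  assumes a: "a \<in> V.TC" and b: "b \<in> V.TC" and c: "c \<in> V.TC"
  shows "mu (PT [mu (PT [a, b]), c]) = mu (PT [a, mu (PT [b, c])])"
proof -
  have 1: "mu (PT [mu (PT [V.P xs, V.P ys]), c]) = mu (PT [V.P xs, mu (PT [V.P ys, c])])" for xs ys
  proof (rule V.TC_eq[OF mu_right _ vector_space_fscale _ c])
    show "flinear V.TC V.TC (\<lambda>c. mu (PT [V.P xs, mu (PT [V.P ys, c])]))"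
      by (rule linear_on_compose[OF mu_right mu_right]) simp_all
  qed (simp_all add: mu_in mu_assoc_P)
  have 2: "mu (PT [mu (PT [V.P xs, b]), c]) = mu (PT [V.P xs, mu (PT [b, c])])" for xs
  proof (rule V.TC_eq[OF _ _ vector_space_fscale _ b])
    show "flinear V.TC V.TC (\<lambda>b. mu (PT [mu (PT [V.P xs, b]), c]))"
      by (rule linear_on_compose[OF mu_right mu_left]) (simp_all add: c)
    show "flinear V.TC V.TC (\<lambda>b. mu (PT [V.P xs, mu (PT [b, c])]))"
      by (rule linear_on_compose[OF mu_left mu_right]) (simp_all add: c)
  qed (rule 1)
  show ?thesis
  proof (rule V.TC_eq[OF _ _ vector_space_fscale _ a])
    show "flinear V.TC V.TC (\<lambda>a. mu (PT [mu (PT [a, b]), c]))"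
      by (rule linear_on_compose[OF mu_left mu_left]) (simp_all add: b c)
    show "flinear V.TC V.TC (\<lambda>a. mu (PT [a, mu (PT [b, c])]))"
      by (rule mu_left) (simp add: b c mu_in)
  qed (rule 2)
qed

lemma mu_unit:
  assumes a: "a \<in> V.TC"
  shows "mu (PT [unitT s, a]) = a" "mu (PT [a, unitT s]) = a"
proof -
  have u: "unitT s \<in> V.TC" by simp
  have i: "flinear V.TC UNIV (\<lambda>x. x)" by (simp add: linear_on_def)
  have d: "(\<Sum>r\<le>n. ap (if r = n then f else 0) t) = ap f t" for n :: nat and f and t :: "('v, 'k) tensor"
  proof -
    have "(\<Sum>r\<le>n. ap (if r = n then f else 0) t) = (\<Sum>r\<le>n. if r = n then ap f t else 0)"
      by (intro sum.cong refl) (simp add: ap_0)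
    then show ?thesis by simp
  qed
  show "mu (PT [unitT s, a]) = a"
  proof (rule V.TC_eq[OF mu_right[OF u] i vector_space_fscale _ a])
    fix xs :: "'v list"
    show "mu (PT [unitT s, V.P xs]) = V.P xs"
      by (simp add: star_P[where N = "length xs"] C.st_left_0 d V.eT_P)
  qed
  show "mu (PT [a, unitT s]) = a"
  proof (rule V.TC_eq[OF mu_left[OF u] i vector_space_fscale _ a])
    fix xs :: "'v list"
    show "mu (PT [V.P xs, unitT s]) = V.P xs"
      by (simp add: star_P[where N = "length xs"] C.st_right_0 d V.eT_P)
  qed
qed

abbreviation "mu' \<equiv> (\<lambda>t. PT [mu t])"

lemma mu'_linear: "flinear (T.Tn 2) (T.Tn 1) mu'"
  by (rule linear_on_compose[OF star_linear T.P_1_linear])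

lemma mu'_TC: "flinear (T.Tn 2) T.TC mu'"
  by (rule T.linear_on_Tn_TC[OF mu'_linear])

text \<open>The product of the first two blocks has a component in each degree r up to i + j, so the
  result is spread over the bidegrees (r, k).\<close>

lemma tmap_mu_left:
  assumes t: "t \<in> V.Tn (i + j + k)"
  shows "tml mu' (split3 i j k t) = (\<Sum>r\<le>i + j. split_at s r k (ap (V.RT k (C.st r i j)) t))"
proof (rule V.Tn_eq[OF _ _ _ t])
  show "flinear (V.Tn (i + j + k)) UNIV (\<lambda>t. tml mu' (split3 i j k t))"
    by (rule linear_on_compose[OF split3_linear T.tmap_linear_on[OF mu'_TC T.id_flinear]])
  show "flinear (V.Tn (i + j + k)) UNIV (\<lambda>t. \<Sum>r\<le>i + j. split_at s r k (ap (V.RT k (C.st r i j)) t))"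
    by (rule linear_onI) (simp_all add: ap_plus_right ap_fscale linear_on_add[OF split_at_linear[of UNIV]]
        linear_on_scale[OF split_at_linear[of UNIV]] sum.distrib T.F.scale_sum_right)
  fix ws :: "'v list" assume ws: "length ws = i + j + k"
  let ?x = "V.P (take (i + j) ws)" and ?z = "V.P (drop (i + j) ws)"
  have z: "?z \<in> V.Tn k" and x: "?x \<in> V.Tn (i + j)" using ws by (simp_all add: V.P_in_Tn')
  have "tml mu' (split3 i j k (V.P ws))
      = T.ct (PT [mu (split_at s i j ?x)]) (PT [?z])"
    using ws tmap_PT_left[OF mu'_TC] by (simp add: split3_P split_at_P drop_take min_def)
  also have "\<dots> = PT [\<Sum>r\<le>i + j. ap (C.st r i j) ?x, ?z]"
    by (simp add: mu_split[OF x, of "i + j"] PT_cat V.TC_sum V.tame_in_TC)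
  also have "\<dots> = (\<Sum>r\<le>i + j. PT [ap (C.st r i j) ?x, ?z])"
    by (rule linear_on_sum[OF T.P_2_left]) (simp_all add: V.tame_in_TC linear_on_scale[OF T.P_2_left, of _ 0 0, simplified])
  also have "\<dots> = (\<Sum>r\<le>i + j. split_at s r k (ap (V.RT k (C.st r i j)) (V.P ws)))"
  proof (rule sum.cong[OF refl])
    fix r
    have w: "V.P ws = V.ct ?x ?z" by (simp add: V.cat_P)
    show "PT [ap (C.st r i j) ?x, ?z] = split_at s r k (ap (V.RT k (C.st r i j)) (V.P ws))"
      unfolding w using split_at_cat[OF V.hom_in_Tn[OF C.hom_st] z] by (simp add: V.RT_cat z del: V.cat_P)
  qed
  finally show "tml mu' (split3 i j k (V.P ws))
    = (\<Sum>r\<le>i + j. split_at s r k (ap (V.RT k (C.st r i j)) (V.P ws)))" .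
qed

lemma tmap_mu_right:
  assumes t: "t \<in> V.Tn (i + j + k)"
  shows "tmr mu' (split3 i j k t) = (\<Sum>r\<le>j + k. split_at s i r (ap (V.LT i (C.st r j k)) t))"
proof (rule V.Tn_eq[OF _ _ _ t])
  show "flinear (V.Tn (i + j + k)) UNIV (\<lambda>t. tmr mu' (split3 i j k t))"
    by (rule linear_on_compose[OF split3_linear T.tmap_linear_on[OF T.id_flinear mu'_TC]])
  show "flinear (V.Tn (i + j + k)) UNIV (\<lambda>t. \<Sum>r\<le>j + k. split_at s i r (ap (V.LT i (C.st r j k)) t))"
    by (rule linear_onI) (simp_all add: ap_plus_right ap_fscale linear_on_add[OF split_at_linear[of UNIV]]
        linear_on_scale[OF split_at_linear[of UNIV]] sum.distrib T.F.scale_sum_right)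
  fix ws :: "'v list" assume ws: "length ws = i + j + k"
  let ?x = "V.P (take i ws)" and ?z = "V.P (drop i ws)"
  have x: "?x \<in> V.Tn i" and z: "?z \<in> V.Tn (j + k)" using ws by (simp_all add: V.P_in_Tn')
  have "tmr mu' (split3 i j k (V.P ws))
      = T.ct (PT [?x]) (PT [mu (split_at s j k ?z)])"
    using ws tmap_PT_right[OF mu'_TC] by (simp add: split3_P split_at_P add.commute)
  also have "\<dots> = PT [?x, \<Sum>r\<le>j + k. ap (C.st r j k) ?z]"
    by (simp add: mu_split[OF z, of "j + k"] PT_cat V.TC_sum V.tame_in_TC)
  also have "\<dots> = (\<Sum>r\<le>j + k. PT [?x, ap (C.st r j k) ?z])"
    by (rule linear_on_sum[OF T.P_2_right]) (simp_all add: V.tame_in_TC linear_on_scale[OF T.P_2_right, of _ 0 0, simplified])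
  also have "\<dots> = (\<Sum>r\<le>j + k. split_at s i r (ap (V.LT i (C.st r j k)) (V.P ws)))"
  proof (rule sum.cong[OF refl])
    fix r
    have w: "V.P ws = V.ct ?x ?z" by (simp add: V.cat_P)
    show "PT [?x, ap (C.st r j k) ?z] = split_at s i r (ap (V.LT i (C.st r j k)) (V.P ws))"
      unfolding w using split_at_cat[OF x V.hom_in_Tn[OF C.hom_st]] by (simp add: V.LT_cat x del: V.cat_P)
  qed
  finally show "tmr mu' (split3 i j k (V.P ws))
    = (\<Sum>r\<le>j + k. split_at s i r (ap (V.LT i (C.st r j k)) (V.P ws)))" .
qed

lemma tmap_mu_left_linear: "flinear (T.Tn 3) (T.Tn 2) (tml mu')"
proof -
  have "2 + 1 = (3::nat)" "1 + 1 = (2::nat)" by simp_all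
  then show ?thesis
    using T.tmap_in_Tn[OF mu'_linear T.linear_on_id_Tn[of 1]]
    by (intro linear_on_mono[OF T.tmap_linear_on[OF mu'_TC T.id_flinear, of UNIV]])
      (simp_all only: subset_UNIV)
qed

lemma tmap_mu_right_linear: "flinear (T.Tn 3) (T.Tn 2) (tmr mu')"
proof -
  have "1 + 2 = (3::nat)" "1 + 1 = (2::nat)" by simp_all
  then show ?thesis
    using T.tmap_in_Tn[OF T.linear_on_id_Tn[of 1] mu'_linear]
    by (intro linear_on_mono[OF T.tmap_linear_on[OF T.id_flinear mu'_TC, of UNIV]])
      (simp_all only: subset_UNIV)
qed

lemma beta_sum: "bt (\<Sum>x\<in>X. f x) = (\<Sum>x\<in>X. bt (f x))"
  by (rule linear_UNIV_sum[OF beta_linear vector_space_fscale])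

lemma C_nat: "B.b r k * V.RT k (C.st r i j) = V.LT k (C.st r i j) * B.b (i + j) k"
  "B.b k r * V.LT k (C.st r i j) = V.RT k (C.st r i j) * B.b k (i + j)"
  using C.nat2_st[of i j r] B.natrD B.natlD by (auto simp: B.nat2_def)

text \<open>For each r, naturality of \<open>st r i j\<close> lets the crossing with k take place
  before the product, and a hexagon identity breaks it into the crossings with the two
  factors.\<close>

lemma beta_mu_left:
  assumes t: "t \<in> T.Tn 3"
  shows "bt (tml mu' t) =
    tmr mu' (tml bt (tmr bt t))"
proof -
  have 3: "flinear (T.Tn 3) UNIV (\<lambda>t. bt (tml mu' t))"
    by (rule linear_on_compose[OF tmap_mu_left_linear beta_linear])
  have 4: "flinear (T.Tn 3) UNIV (\<lambda>t.
      tmr mu' (tml bt (tmr bt t)))"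
    using linear_on_compose[OF linear_on_compose[OF tmap_beta_right_linear tmap_beta_left_linear] tmap_mu_right_linear]
    by (simp add: linear_on_def)
  show ?thesis
  proof (rule T3_eq[OF 3 4 _ t])
    fix xs ys zs :: "'v list"
    define i j k where "i = length xs" and "j = length ys" and "k = length zs"
    let ?w = "V.P (xs @ ys @ zs)"
    have w: "?w \<in> V.Tn (i + j + k)" by (simp add: V.P_in_Tn' i_def j_def k_def)
    have r: "ap (V.RT k (C.st r i j)) u \<in> V.Tn (r + k)" for r u
      by (rule V.hom_in_Tn[OF V.W.hom_R[OF C.hom_st]])
    have 1: "ap (V.LT i (B.b j k)) u \<in> V.Tn (i + k + j)" for u
      using V.hom_in_Tn[OF V.W.hom_L[OF B.hom_b]] by (simp add: add.assoc)
    have 2: "ap (V.RT j (B.b i k)) u \<in> V.Tn (k + i + j)" for u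
      by (rule V.hom_in_Tn[OF V.W.hom_R[OF B.hom_b]])
    have "bt (tml mu' (split3 i j k ?w))
      = (\<Sum>r\<le>i + j. split_at s k r (ap (B.b r k * V.RT k (C.st r i j)) ?w))"
      by (simp only: tmap_mu_left[OF w] beta_sum beta_split[OF r] ap_mult)
    also have "\<dots> = (\<Sum>r\<le>i + j. split_at s k r (ap (V.LT k (C.st r i j)) (ap (V.RT j (B.b i k)) (ap (V.LT i (B.b j k)) ?w))))"
      by (simp only: C_nat B.b_add_left ap_mult)
    also have "\<dots> = tmr mu' (tml bt (tmr bt (split3 i j k ?w)))"
      by (simp only: tmap_beta_right[OF w] tmap_beta_left[OF 1] tmap_mu_right[OF 2])
    finally show "bt (tml mu' (PT [V.P xs, V.P ys, V.P zs])) =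
      tmr mu' (tml bt (tmr bt (PT [V.P xs, V.P ys, V.P zs])))"
      by (simp only: split3_words i_def j_def k_def)
  qed
qed

text \<open>The same with the strands on the other side, by the second naturality of
  \<open>st\<close> and the other hexagon identity.\<close>

lemma beta_mu_right:
  assumes t: "t \<in> T.Tn 3"
  shows "bt (tmr mu' t) =
    tml mu' (tmr bt (tml bt t))"
proof -
  have 3: "flinear (T.Tn 3) UNIV (\<lambda>t. bt (tmr mu' t))"
    by (rule linear_on_compose[OF tmap_mu_right_linear beta_linear])
  have 4: "flinear (T.Tn 3) UNIV (\<lambda>t.
      tml mu' (tmr bt (tml bt t)))"
    using linear_on_compose[OF linear_on_compose[OF tmap_beta_left_linear tmap_beta_right_linear] tmap_mu_left_linear]
    by (simp add: linear_on_def)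
  show ?thesis
  proof (rule T3_eq[OF 3 4 _ t])
    fix xs ys zs :: "'v list"
    define i j k where "i = length xs" and "j = length ys" and "k = length zs"
    let ?w = "V.P (xs @ ys @ zs)"
    have w: "?w \<in> V.Tn (i + j + k)" by (simp add: V.P_in_Tn' i_def j_def k_def)
    have r: "ap (V.LT i (C.st r j k)) u \<in> V.Tn (i + r)" for r u
      by (rule V.hom_in_Tn[OF V.W.hom_L[OF C.hom_st]])
    have 1: "ap (V.RT k (B.b i j)) u \<in> V.Tn (j + i + k)" for u
      by (rule V.hom_in_Tn[OF V.W.hom_R[OF B.hom_b]])
    have 2: "ap (V.LT j (B.b i k)) u \<in> V.Tn (j + k + i)" for u
      using V.hom_in_Tn[OF V.W.hom_L[OF B.hom_b]] by (simp add: add.assoc)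
    have "bt (tmr mu' (split3 i j k ?w))
      = (\<Sum>r\<le>j + k. split_at s r i (ap (B.b i r * V.LT i (C.st r j k)) ?w))"
      by (simp only: tmap_mu_right[OF w] beta_sum beta_split[OF r] ap_mult)
    also have "\<dots> = (\<Sum>r\<le>j + k. split_at s r i (ap (V.RT i (C.st r j k)) (ap (V.LT j (B.b i k)) (ap (V.RT k (B.b i j)) ?w))))"
      by (simp only: C_nat B.b_add_right ap_mult)
    also have "\<dots> = tml mu' (tmr bt (tml bt (split3 i j k ?w)))"
      by (simp only: tmap_beta_left[OF w] tmap_beta_right[OF 1] tmap_mu_left[OF 2])
    finally show "bt (tmr mu' (PT [V.P xs, V.P ys, V.P zs])) =
      tml mu' (tmr bt (tml bt (PT [V.P xs, V.P ys, V.P zs])))"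
      by (simp only: split3_words i_def j_def k_def)
  qed
qed

theorem braided_algebra_star: "braided_algebra fscale (TV s) mu (unitT s) bt"
  unfolding braided_algebra_def Let_def
  using vector_space_fscale V.subspace_TC star_linear mu_assoc mu_unit braiding_beta beta_mu_left
    beta_mu_right beta_unit V.P_in_TC[of "[]"]
  by simp

end

theorem theorem4p15:
  fixes s :: "'k::field_char_0 \<Rightarrow> 'v::ab_group_add \<Rightarrow> 'v"
    and M :: "nat \<Rightarrow> nat \<Rightarrow> ('v, 'k) tensor \<Rightarrow> 'v"
    and \<sigma> :: "('v, 'k) tensor \<Rightarrow> ('v, 'k) tensor"
  assumes "quantum_multibrace s M \<sigma>"
  shows "braided_algebra fscale (TV s) (star s M \<sigma>) (unitT s) (beta s \<sigma>)"
proof -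
  interpret multibrace_space s M \<sigma> by unfold_locales (rule assms)
  show ?thesis by (rule braided_algebra_star)
qed

end
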